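(* Fix $n\in\mathbb{N}_0$ and let $U\in\left(0,\frac{T}{\ln^2T}\right]$. Consider the set $\bigcup_{k=0}^{n+1}[\varphi_1^k(T),\varphi_1^k(T+U)]$. Then, for every fixed $\epsilon>0$ and all sufficiently large $T$: (i) $t\sim\varphi_1^k(t)$ as $t\to\infty$ and $\varphi_1^k(T)\ge(1-\epsilon)T$, for $k=0,1,\dots,n+1$; (ii) $\varphi_1^k(T+U)-\varphi_1^k(T)<\frac{1}{2n+5}\frac{T}{\ln T}$ for $k=1,\dots,n+1$; (iii) $\varphi_1^k(T)-\varphi_1^{k+1}(T+U)>0.18\cdot\frac{T}{\ln T}$ for $k=0,1,\dots,n$. In particular the set is disconnected, with components $[\varphi_1^k(T),\varphi_1^k(T+U)]$ ordered from right to left as $k$ increases.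
   Context: Let $\zeta$ be the Riemann zeta-function and $Z(t)=e^{i\vartheta(t)}\zeta(\tfrac12+it)$ with $\vartheta(t)=-\tfrac t2\ln\pi+\operatorname{Im}\ln\Gamma(\tfrac14+\tfrac{it}{2})$, so that $Z(t)$ is real and $Z^2(t)=|\zeta(\tfrac12+it)|^2$. Let $\mu(y)$ be any function with $\mu(y)\ge 7y\ln y$; a Jacob's ladder is $\varphi_1(T)=\tfrac12\varphi(T)$, where $\varphi(T)=\varphi_\mu(T)$ is a solution $x=x(T)$ of the nonlinear integral equation $\int_0^{\mu[x(T)]}Z^2(t)e^{-2t/x(T)}\,dt=\int_0^T Z^2(t)\,dt$. The function $\varphi_1$ is increasing for $t\ge T_0[\varphi_1]$. Its iterates are $\varphi_1^0(t)=t$, $\varphi_1^k(t)=\varphi_1(\varphi_1^{k-1}(t))$ for $k\ge1$. $U=U(T)$ denotes an arbitrary function of $T$ in the indicated range, and $A\sim B$ means $A/B\to1$ as $T\to\infty$. *)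

theory Defs
  imports "HOL-Analysis.Analysis"
begin

text \<open>Dirichlet eta function, defined by its (conditionally convergent) alternating series;
  converges for Re s > 0.\<close>
definition dirichlet_eta :: "complex \<Rightarrow> complex" where
  "dirichlet_eta s = (\<Sum>n. (-1) ^ n / (of_nat (Suc n)) powr s)"

text \<open>Riemann zeta function via zeta(s) = eta(s) / (1 - 2^(1-s)); valid for Re s > 0 away from
  the zeros of the denominator, in particular on the whole critical line Re s = 1/2.\<close>
definition riemann_zeta :: "complex \<Rightarrow> complex" where
  "riemann_zeta s = dirichlet_eta s / (1 - 2 powr (1 - s))"

definition Z2 :: "real \<Rightarrow> real" where
  "Z2 t = (cmod (riemann_zeta (1/2 + \<i> * of_real t)))^2"

definition jacob_solution :: "(real \<Rightarrow> real) \<Rightarrow> (real \<Rightarrow> real) \<Rightarrow> bool" where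
  "jacob_solution \<mu> \<phi> \<longleftrightarrow>
     (\<forall>y>0. \<mu> y \<ge> 7 * y * ln y) \<and>
     (\<forall>\<^sub>F T in at_top. \<phi> T > 0 \<and>
        integral {0..\<mu> (\<phi> T)} (\<lambda>t. Z2 t * exp (- 2 * t / \<phi> T)) = integral {0..T} Z2)"

end

theory Submission
  imports Defs "HOL-Real_Asymp.Real_Asymp"
begin

text \<open>
  The only information on zeta that is needed is
  \<open>M(T) = \<integral>\<^sub>0\<^sup>T Z\<^sup>2 = T ln T + C T + o(T)\<close> with \<^emph>\<open>some\<close> constant \<open>C\<close>. Taking the Laplace average of this
  expansion turns the integral equation, with \<open>X = \<phi>\<^sub>1(T)\<close>, into
  \<open>T ln T + C T = X ln X + (C + \<kappa>) X + o(T)\<close>, where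
  \<open>\<kappa> = \<integral>\<^sub>0\<^sup>\<infinity> u ln u e\<^sup>-\<^sup>u du = 1 - \<gamma>\<close>. Hence \<open>C\<close> drops out and \<open>T - \<phi>\<^sub>1(T) \<sim> \<kappa> T / ln T\<close>;
  iterating gives \<open>T - \<phi>\<^sub>1\<^sup>k(T) \<sim> k \<kappa> T / ln T\<close>, and \<open>\<kappa> > 0.4\<close>.

  For the mean square it suffices by dyadic summation to treat \<open>[T, 2T]\<close>, where zeta is within
  \<open>O(T\<^sup>-\<^sup>1\<^sup>/\<^sup>2)\<close> of the partial sum of length \<open>N \<approx> 8T\<close>. Off-diagonal terms with an index below
  \<open>P = T / ln\<^sup>2 T\<close> are trivially \<open>o(T)\<close>. For the others, the twice integrated mean square is
  computed asymptotically: its off-diagonal terms decay like the inverse square of the difference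
  \<open>h\<close> of the indices, so only small \<open>h\<close> matter and a Riemann sum appears. As the twice integrated
  mean square is convex, the mean square itself can be recovered by difference quotients.
\<close>

subsection \<open>Approximation of zeta by partial sums on the critical line\<close>

text \<open>A single integration is not enough for the off-diagonal terms: it leaves weights of size
  about 1/h, whose absolute sum over pairs below 8T has order T ln T, the size of the main term.
  Integrating twice gives 1/h^2 with the nonnegative numerator 1 - cos, but the way back by
  difference quotients has a price. With step D the quotient loses the error of the second integral
  divided by D, and the mean square itself moves by D times its slope. The diagonal slope is the sum
  of 1/n, of order ln T over all indices, so D = T / ln T would shift the result by a multiple of T.
  Removing the indices below P first lowers this slope to O(ln ln T) and the shift to o(T); the
  second integral is then wanted up to o(T^2 / ln T). The removed diagonal terms are restored
  exactly afterwards. The lengths in (ii) are o(T / ln T), because U ln T / T \<le> 1 / ln T. In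
  (iii) the distances are asymptotic to \<kappa> T / ln T, and 0.18 lies well below \<kappa> = 1 -
  \<gamma> = 0.42...\<close>

lemma norm_powr_real_base:
  fixes x :: real and w :: complex
  assumes "x > 0"
  shows "cmod (complex_of_real x powr w) = x powr Re w"
  using assms by (simp add: norm_powr_real_powr)

lemma one_plus_powr_deriv:
  fixes x :: real and w :: complex
  assumes "x \<ge> 0"
  shows "((\<lambda>x. complex_of_real (1 + x) powr w) has_vector_derivative
           w * complex_of_real (1 + x) powr (w - 1)) (at x within S)"
proof -
  have "((\<lambda>z. (1 + z) powr w) has_field_derivative w * (1 + complex_of_real x) powr (w - 1))
         (at (complex_of_real x))"
    using assms by (auto intro!: derivative_eq_intros simp: complex_nonpos_Reals_iff)
  from has_vector_derivative_real_field[OF this] show ?thesis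
    by (simp add: has_vector_derivative_at_within)
qed

text \<open>On the line Re w = 1/2 one has |w - 1| = |w|, and the second derivative of (1 + x)^w
  carries the factor (1 + x)^(w - 2) of modulus at most 1; this is why the remainder is |w|^2 z^2 /
  2. The second estimate serves for the derivative of \<open>incr_quot\<close>.\<close>

lemma one_plus_powr_bounds:
  fixes z :: real and w :: complex
  assumes w: "Re w = 1/2" and z: "z \<ge> 0"
  defines "K \<equiv> \<lambda>x. complex_of_real (1 + x) powr w"
  shows "cmod (K z - 1 - w * z) \<le> (cmod w)\<^sup>2 * z\<^sup>2 / 2"
    and "cmod (K z - 1 - z * (w * complex_of_real (1 + z) powr (w - 1))) \<le> (cmod w)\<^sup>2 * z\<^sup>2 / 2"
proof -
  define K1 where "K1 = (\<lambda>x::real. complex_of_real (1 + x) powr (w - 1))"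
  define K2 where "K2 = (\<lambda>x::real. complex_of_real (1 + x) powr (w - 2))"
  have w1: "cmod (w - 1) = cmod w"
    using w by (simp add: cmod_def power2_eq_square algebra_simps)
  have dK: "(K has_vector_derivative w * K1 x) (at x within S)" if "x \<ge> 0" for x S
    unfolding K_def K1_def by (rule one_plus_powr_deriv[OF that])
  have dK1: "(K1 has_vector_derivative (w - 1) * K2 x) (at x within S)" if "x \<ge> 0" for x S
    using one_plus_powr_deriv[OF that, of "w - 1" S] by (simp add: K1_def K2_def)
  have n2: "cmod (K2 x) \<le> 1" if "x \<ge> 0" for x
  proof -
    have "cmod (K2 x) = (1 + x) powr (- 3/2)"
      unfolding K2_def using that w by (subst norm_powr_real_base) (auto simp: w)
    also have "\<dots> \<le> (1 + x) powr 0" by (rule powr_mono) (use that in auto)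
    finally show ?thesis using that by simp
  qed
  have b1: "cmod (K1 x - 1) \<le> cmod w * x" if "x \<ge> 0" for x
  proof (cases "x = 0")
    case True then show ?thesis by (simp add: K1_def)
  next
    case False
    have "cmod (K1 x - K1 0) \<le> cmod w * x - cmod w * 0"
    proof (rule differentiable_bound_general[where f' = "\<lambda>x. (w - 1) * K2 x" and \<phi>' = "\<lambda>_. cmod w"])
      show "continuous_on {0..x} K1"
        using dK1 by (intro continuous_on_vector_derivative) auto
      show "continuous_on {0..x} ((*) (cmod w))" by (intro continuous_intros)
      show "(K1 has_vector_derivative (w - 1) * K2 y) (at y)" if "0 < y" for y
        using dK1[of y UNIV] that by simp
      show "((*) (cmod w) has_vector_derivative cmod w) (at y)" for y
        by (auto intro!: derivative_eq_intros simp: has_real_derivative_iff_has_vector_derivative[symmetric])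
      show "cmod ((w - 1) * K2 y) \<le> cmod w" if "0 < y" for y
        using n2[of y] that w1 by (simp add: norm_mult mult_left_le)
    qed (use that False in auto)
    then show ?thesis by (simp add: K1_def)
  qed
  show "cmod (K z - 1 - w * z) \<le> (cmod w)\<^sup>2 * z\<^sup>2 / 2"
  proof (cases "z = 0")
    case True then show ?thesis by (simp add: K_def)
  next
    case False
    define f where "f = (\<lambda>x::real. K x - 1 - w * x)"
    define g where "g = (\<lambda>x::real. (cmod w)\<^sup>2 * x\<^sup>2 / 2)"
    have df: "(f has_vector_derivative w * K1 x - w) (at x within S)" if "x \<ge> 0" for x S
      unfolding f_def using dK[OF that, of S] by (auto intro!: derivative_eq_intros)
    have "cmod (f z - f 0) \<le> g z - g 0"
    proof (rule differentiable_bound_general[where f' = "\<lambda>x. w * K1 x - w" and \<phi>' = "\<lambda>x. (cmod w)\<^sup>2 * x"])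
      show "continuous_on {0..z} f"
        using df by (intro continuous_on_vector_derivative) auto
      show "continuous_on {0..z} g" unfolding g_def by (intro continuous_intros) auto
      show "(f has_vector_derivative w * K1 y - w) (at y)" if "0 < y" for y
        using df[of y UNIV] that by simp
      show "(g has_vector_derivative (cmod w)\<^sup>2 * y) (at y)" for y
        unfolding g_def
        by (auto intro!: derivative_eq_intros simp: has_real_derivative_iff_has_vector_derivative[symmetric])
      show "cmod (w * K1 y - w) \<le> (cmod w)\<^sup>2 * y" if "0 < y" for y
      proof -
        have "cmod (w * K1 y - w) = cmod w * cmod (K1 y - 1)"
          by (simp add: norm_mult[symmetric] algebra_simps)
        also have "\<dots> \<le> cmod w * (cmod w * y)"
          by (intro mult_left_mono b1) (use that in auto)
        finally show ?thesis by (simp add: power2_eq_square)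
      qed
    qed (use z False in auto)
    then show ?thesis by (simp add: f_def g_def K_def)
  qed
  show "cmod (K z - 1 - z * (w * complex_of_real (1 + z) powr (w - 1))) \<le> (cmod w)\<^sup>2 * z\<^sup>2 / 2"
  proof (cases "z = 0")
    case True then show ?thesis by (simp add: K_def)
  next
    case False
    define f where "f = (\<lambda>x::real. K x - 1 - x * (w * K1 x))"
    define g where "g = (\<lambda>x::real. (cmod w)\<^sup>2 * x\<^sup>2 / 2)"
    have df: "(f has_vector_derivative - (x * (w * ((w - 1) * K2 x)))) (at x within S)" if "x \<ge> 0" for x S
      unfolding f_def using dK[OF that, of S] dK1[OF that, of S]
      by (auto intro!: derivative_eq_intros has_vector_derivative_of_real simp: algebra_simps)
    have "cmod (f z - f 0) \<le> g z - g 0"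
    proof (rule differentiable_bound_general[where f' = "\<lambda>x. - (x * (w * ((w - 1) * K2 x)))" and \<phi>' = "\<lambda>x. (cmod w)\<^sup>2 * x"])
      show "continuous_on {0..z} f"
        using df by (intro continuous_on_vector_derivative) auto
      show "continuous_on {0..z} g" unfolding g_def by (intro continuous_intros) auto
      show "(f has_vector_derivative - (y * (w * ((w - 1) * K2 y)))) (at y)" if "0 < y" for y
        using df[of y UNIV] that by simp
      show "(g has_vector_derivative (cmod w)\<^sup>2 * y) (at y)" for y
        unfolding g_def
        by (auto intro!: derivative_eq_intros simp: has_real_derivative_iff_has_vector_derivative[symmetric])
      show "cmod (- (y * (w * ((w - 1) * K2 y)))) \<le> (cmod w)\<^sup>2 * y" if "0 < y" for y
      proof -
        have "cmod (- (y * (w * ((w - 1) * K2 y)))) = (cmod w)\<^sup>2 * y * cmod (K2 y)"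
          using that by (simp only: norm_minus_cancel norm_mult w1) (simp add: power2_eq_square)
        also have "\<dots> \<le> (cmod w)\<^sup>2 * y * 1"
          by (intro mult_left_mono n2) (use that in auto)
        finally show ?thesis by simp
      qed
    qed (use z False in auto)
    then show ?thesis by (simp add: f_def g_def K_def K1_def)
  qed
qed

text \<open>The quotient of \<open>n\<^sup>-\<^sup>s\<close> by the increment of its antiderivative over \<open>[n, n+1]\<close>, as a function
  of \<open>z = 1/n\<close>, with \<open>w = 1 - s\<close>.\<close>

definition incr_quot :: "complex \<Rightarrow> real \<Rightarrow> complex" where
  "incr_quot w z = w * z / (complex_of_real (1 + z) powr w - 1)"

lemma incr_quot_denom_lower:
  assumes w: "Re w = 1/2" and z: "z \<ge> 0" and wz: "cmod w * z \<le> 1/2"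
  shows "cmod (complex_of_real (1 + z) powr w - 1) \<ge> 3/4 * (cmod w * z)"
proof -
  define K where "K = complex_of_real (1 + z) powr w"
  have "cmod (w * z) \<le> cmod (K - 1) + cmod (K - 1 - w * z)"
    by (metis norm_minus_commute norm_triangle_sub)
  moreover have "(cmod w)\<^sup>2 * z\<^sup>2 / 2 \<le> 1/4 * (cmod w * z)"
    using mult_right_mono[OF wz, of "cmod w * z"] z by (simp add: power2_eq_square mult_ac)
  moreover have "cmod (K - 1 - w * z) \<le> (cmod w)\<^sup>2 * z\<^sup>2 / 2"
    using one_plus_powr_bounds(1)[OF w z] by (simp only: K_def)
  ultimately have "cmod (K - 1) \<ge> 3/4 * (cmod w * z)"
    using z by (simp only: norm_mult norm_of_real abs_of_nonneg)
  then show ?thesis by (simp only: K_def)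
qed

lemma incr_quot_near_one:
  assumes w: "Re w = 1/2" and z: "z > 0" and wz: "cmod w * z \<le> 1/2"
  shows "cmod (incr_quot w z - 1) \<le> cmod w * z"
proof -
  define K where "K = complex_of_real (1 + z) powr w"
  have w0: "cmod w > 0" using w by auto
  have wz0: "cmod w * z > 0" using w0 z by simp
  have den: "cmod (K - 1) \<ge> 3/4 * (cmod w * z)"
    unfolding K_def using incr_quot_denom_lower[OF w _ wz] z by simp
  then have K0: "K - 1 \<noteq> 0" using wz0 by (metis norm_zero not_less mult_pos_pos zero_less_divide_iff zero_less_numeral)
  have "incr_quot w z - 1 = - (K - 1 - w * z) / (K - 1)"
    unfolding incr_quot_def K_def[symmetric] using K0 by (simp add: divide_simps)
  then have "cmod (incr_quot w z - 1) = cmod (K - 1 - w * z) / cmod (K - 1)"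
    by (simp only: norm_divide norm_minus_cancel)
  also have "\<dots> \<le> ((cmod w)\<^sup>2 * z\<^sup>2 / 2) / (3/4 * (cmod w * z))"
    by (rule frac_le) (use den wz0 z one_plus_powr_bounds(1)[OF w, of z] in \<open>auto simp: K_def\<close>)
  also have "\<dots> = 2/3 * (cmod w * z)"
    using wz0 by (simp add: field_simps power2_eq_square)
  finally show ?thesis using wz0 by linarith
qed

text \<open>In the derivative w (K - 1 - x K') / (K - 1)^2 the numerator is of second order in x and
  cancels the square in the denominator, so the derivative stays below |w| however small x
  is.\<close>

lemma incr_quot_lipschitz:
  assumes w: "Re w = 1/2" and ab: "0 < a" "a \<le> b" and wb: "cmod w * b \<le> 1/2"
  shows "cmod (incr_quot w b - incr_quot w a) \<le> cmod w * (b - a)"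
proof (cases "a = b")
  case False
  define K where "K = (\<lambda>x. complex_of_real (1 + x) powr w)"
  define K1 where "K1 = (\<lambda>x. w * complex_of_real (1 + x) powr (w - 1))"
  have w0: "cmod w > 0" using w by auto
  have wx: "cmod w * x \<le> 1/2" if "x \<le> b" for x
    using mult_left_mono[OF that, of "cmod w"] wb by simp
  have den: "cmod (K x - 1) \<ge> 3/4 * (cmod w * x)" if "0 < x" "x \<le> b" for x
    unfolding K_def using incr_quot_denom_lower[OF w _ wx] that by simp
  have K0: "K x - 1 \<noteq> 0" if "0 < x" "x \<le> b" for x
    using den[OF that] w0 that(1) by (metis norm_zero not_less mult_pos_pos zero_less_divide_iff zero_less_numeral)
  define B' where "B' = (\<lambda>x. w * (K x - 1 - x * K1 x) / (K x - 1)\<^sup>2)"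
  have dB: "(incr_quot w has_vector_derivative B' x) (at x within S)" if "0 < x" "x \<le> b" for x S
  proof -
    have "((\<lambda>z. (1 + z) powr w) has_field_derivative w * (1 + complex_of_real x) powr (w - 1))
         (at (complex_of_real x))"
      using that by (auto intro!: derivative_eq_intros simp: complex_nonpos_Reals_iff)
    moreover have "1 + complex_of_real x \<notin> \<real>\<^sub>\<le>\<^sub>0"
      using that by (simp add: complex_nonpos_Reals_iff)
    ultimately have "((\<lambda>z. w * z / ((1 + z) powr w - 1)) has_field_derivative B' x) (at (complex_of_real x))"
      using K0[OF that] unfolding B'_def K_def K1_def
      by (auto intro!: derivative_eq_intros simp: power2_eq_square algebra_simps)
    from has_vector_derivative_real_field[OF this] show ?thesis
      by (simp add: incr_quot_def[abs_def] has_vector_derivative_at_within)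
  qed
  have "cmod (incr_quot w b - incr_quot w a) \<le> cmod w * b - cmod w * a"
  proof (rule differentiable_bound_general[where f' = B' and \<phi>' = "\<lambda>_. cmod w"])
    show "continuous_on {a..b} (incr_quot w)"
      using dB ab by (intro continuous_on_vector_derivative[where f' = B']) auto
    show "continuous_on {a..b} ((*) (cmod w))" by (intro continuous_intros)
    show "(incr_quot w has_vector_derivative B' y) (at y)" if "a < y" "y < b" for y
      using dB[of y UNIV] that ab by simp
    show "((*) (cmod w) has_vector_derivative cmod w) (at y)" for y
      by (auto intro!: derivative_eq_intros simp: has_real_derivative_iff_has_vector_derivative[symmetric])
    show "cmod (B' y) \<le> cmod w" if "a < y" "y < b" for y
    proof -
      have y: "0 < y" "y \<le> b" using that ab by auto
      have wy: "cmod w * y > 0" using w0 y by simp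
      have "cmod (B' y) = cmod w * cmod (K y - 1 - y * K1 y) / (cmod (K y - 1))\<^sup>2"
        by (simp add: B'_def norm_divide norm_mult norm_power)
      also have "\<dots> \<le> cmod w * ((cmod w)\<^sup>2 * y\<^sup>2 / 2) / (3/4 * (cmod w * y))\<^sup>2"
      proof (rule frac_le)
        show "cmod w * cmod (K y - 1 - y * K1 y) \<le> cmod w * ((cmod w)\<^sup>2 * y\<^sup>2 / 2)"
          using one_plus_powr_bounds(2)[OF w, of y] y by (intro mult_left_mono) (auto simp: K_def K1_def)
        show "(3/4 * (cmod w * y))\<^sup>2 \<le> (cmod (K y - 1))\<^sup>2"
          using den[OF y] wy by (intro power_mono) auto
      qed (use wy in auto)
      also have "\<dots> = 8/9 * cmod w"
        using w0 y by (simp add: field_simps power2_eq_square)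
      also have "\<dots> \<le> cmod w" using w0 by simp
      finally show ?thesis .
    qed
  qed (use ab False in auto)
  then show ?thesis by (simp add: algebra_simps)
qed simp

definition zeta_approx :: "nat \<Rightarrow> real \<Rightarrow> complex" where
  "zeta_approx N t = (\<Sum>n=1..<N. of_nat n powr (- (1/2 + \<i> * t))) - of_nat N powr (1/2 - \<i> * t) / (1/2 - \<i> * t)"

lemma zeta_approx_Suc_diff:
  assumes "n \<ge> 1"
  shows "zeta_approx (Suc n) t - zeta_approx n t = of_nat n powr (- (1/2 + \<i> * t))
     - (of_nat (Suc n) powr (1/2 - \<i> * t) / (1/2 - \<i> * t) - of_nat n powr (1/2 - \<i> * t) / (1/2 - \<i> * t))"
  using assms by (simp add: zeta_approx_def sum.atLeastLessThan_Suc)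

lemma inverse_sqrt_telescope:
  fixes x :: real
  assumes "x \<ge> 1"
  shows "1 / (x * sqrt (x + 1)) \<le> 3 * (1 / sqrt x - 1 / sqrt (x + 1))"
proof -
  define a b where "a = sqrt x" and "b = sqrt (x + 1)"
  have a: "a > 0" and b: "b > 0" and a2: "a\<^sup>2 = x" and b2: "b\<^sup>2 = x + 1" using assms by (auto simp: a_def b_def)
  have "b \<le> 2 * a" using assms unfolding a_def b_def
    by (intro real_le_lsqrt) (auto simp: power_mult_distrib)
  have "(b - a) * (b + a) = 1" using a2 b2 by (simp add: power2_eq_square algebra_simps)
  then have e: "b - a = 1 / (b + a)" using a b by (simp add: field_simps)
  have "3 * (1 / a - 1 / b) = 3 / ((a + b) * a * b)"
    using a b by (simp add: diff_frac_eq e)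
  moreover have "1 / (x * b) \<le> 3 / ((a + b) * a * b)"
  proof -
    have "(a + b) * a * b \<le> (3 * a) * a * b"
      using a b \<open>b \<le> 2 * a\<close> by (intro mult_right_mono) auto
    moreover have "1 / (x * b) = 3 / ((3 * a) * a * b)"
      using a b a2[symmetric] by (simp add: power2_eq_square)
    moreover have "0 < (a + b) * a * b" using a b by simp
    ultimately show ?thesis using a b by (simp only:) (rule divide_left_mono, auto)
  qed
  ultimately show ?thesis by (simp add: a_def b_def)
qed

text \<open>The condition on N keeps |w| / n \<le> 1/2 for all n \<ge> N. The factor |w| of the
  Lipschitz bound for \<open>incr_quot\<close> cancels the 1 / |w| in the antiderivative, which
  makes the result uniform in t. The main increments telescope to 3 / sqrt N, and each of the two
  boundary terms adds at most 1 / sqrt N.\<close>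

lemma zeta_approx_cauchy:
  assumes N: "real N \<ge> 1 + 2 * \<bar>t\<bar>" and M: "M \<ge> N"
  shows "cmod (zeta_approx M t - zeta_approx N t) \<le> 5 / sqrt N"
proof -
  define w where "w = 1/2 - \<i> * complex_of_real t"
  have w: "Re w = 1/2" by (simp add: w_def)
  have w0: "cmod w > 0" "w \<noteq> 0" using w by auto
  have wle: "cmod w \<le> 1/2 + \<bar>t\<bar>"
    using cmod_le[of w] by (simp add: w_def)
  define g where "g = (\<lambda>n::nat. of_nat n powr w / w)"
  define b where "b = (\<lambda>n::nat. incr_quot w (1 / real n))"
  \<comment> \<open>Abel summation: \<open>c\<close> is \<open>zeta_approx\<close> without the boundary term, and its increments only involve
    the differences of \<open>b\<close>, which are smaller by a factor of order \<open>1/n\<close>.\<close>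
  define c where "c = (\<lambda>n. zeta_approx n t - g n * (b n - 1))"
  have N1: "N \<ge> 1" using N by (cases N) auto
  have wn: "cmod w * (1 / real n) \<le> 1/2" if "n \<ge> N" for n
  proof -
    have "cmod w * 2 \<le> real n" using wle N that by simp
    then show ?thesis using that N1 by (simp add: field_simps)
  qed
  have ng: "cmod (g n) = sqrt n / cmod w" if "n \<ge> 1" for n
    using norm_powr_real_base[of "real n" w] that w by (simp add: g_def norm_divide powr_half_sqrt)
  have dg: "of_nat n powr (w - 1) = (g (Suc n) - g n) * b n" if "n \<ge> N" for n
  proof -
    have n: "n \<ge> 1" using that N1 by simp
    have nz: "complex_of_nat n \<noteq> 0" using n by simp
    define K where "K = complex_of_real (1 + 1 / real n) powr w"
    have "cmod (K - 1) \<ge> 3/4 * (cmod w * (1 / real n))"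
      unfolding K_def using incr_quot_denom_lower[OF w _ wn[OF that]] by simp
    moreover have "cmod w * (1 / real n) > 0" using w0 n by simp
    ultimately have K0: "K - 1 \<noteq> 0"
      by (metis norm_zero not_less mult_pos_pos zero_less_divide_iff zero_less_numeral)
    have "complex_of_nat (Suc n) = complex_of_real (real n) * complex_of_real (1 + 1 / real n)"
      using n by (simp add: field_simps)
    then have S: "complex_of_nat (Suc n) powr w = of_nat n powr w * K"
      using n unfolding K_def by (simp only:) (subst powr_times_real, auto)
    have "of_nat n powr (w - 1) = of_nat n powr w / of_nat n"
      using nz by (simp add: powr_diff)
    moreover have "(g (Suc n) - g n) * b n = of_nat n powr w / of_nat n"
    proof -
      have "g (Suc n) - g n = of_nat n powr w * (K - 1) / w"
        by (simp only: g_def S) (simp add: diff_divide_distrib right_diff_distrib)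
      moreover have "b n = w / of_nat n / (K - 1)" by (simp add: b_def incr_quot_def K_def)
      ultimately show ?thesis using K0 w0 by simp
    qed
    ultimately show ?thesis by simp
  qed
  have ws: "- (1/2 + \<i> * complex_of_real t) = w - 1" by (simp add: w_def)
  have c_step: "cmod (c (Suc n) - c n) \<le> 3 * (1 / sqrt n - 1 / sqrt (real (Suc n)))" if "n \<ge> N" for n
  proof -
    have n: "n \<ge> 1" using that N1 by simp
    have "zeta_approx (Suc n) t - zeta_approx n t = of_nat n powr (w - 1) - (g (Suc n) - g n)"
      using zeta_approx_Suc_diff[OF n, of t] unfolding ws by (simp add: g_def w_def)
    then have "c (Suc n) - c n = - (g (Suc n) * (b (Suc n) - b n))"
      unfolding c_def dg[OF that] by (simp add: algebra_simps)
    then have "cmod (c (Suc n) - c n) = (sqrt (Suc n) / cmod w) * cmod (b n - b (Suc n))"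
      using ng[of "Suc n"] by (simp add: norm_mult norm_minus_commute)
    also have "\<dots> \<le> (sqrt (Suc n) / cmod w) * (cmod w * (1 / real n - 1 / real (Suc n)))"
    proof (intro mult_left_mono)
      show "cmod (b n - b (Suc n)) \<le> cmod w * (1 / real n - 1 / real (Suc n))"
        unfolding b_def
        by (rule incr_quot_lipschitz[OF w _ _ wn[OF that]]) (use n in \<open>auto simp: field_simps\<close>)
    qed (use w0 in auto)
    also have "\<dots> = 1 / (real n * sqrt (real n + 1))"
    proof -
      have s: "real n + 1 = sqrt (real n + 1) * sqrt (real n + 1)" by simp
      have "1 / real n - 1 / real (Suc n) = 1 / (real n * (real n + 1))"
        using n by (subst diff_frac_eq) (auto simp: add.commute)
      also have "\<dots> = 1 / (real n * (sqrt (real n + 1) * sqrt (real n + 1)))" using s by presburger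
      finally have e: "1 / real n - 1 / real (Suc n) = 1 / (real n * (sqrt (real n + 1) * sqrt (real n + 1)))" .
      have q: "sqrt (real n + 1) > 0" by simp
      have S: "sqrt (real (Suc n)) = sqrt (real n + 1)" by (simp add: add.commute)
      define r where "r = sqrt (real n + 1)"
      show ?thesis unfolding e S using w0 n q unfolding r_def[symmetric] by simp
    qed
    also have "\<dots> \<le> 3 * (1 / sqrt n - 1 / sqrt (real n + 1))"
      by (rule inverse_sqrt_telescope) (use n in auto)
    finally show ?thesis by (simp add: add.commute)
  qed
  have "cmod (c M - c N) \<le> 3 * (1 / sqrt N - 1 / sqrt M)"
    using M
  proof (induction M rule: dec_induct)
    case base then show ?case by simp
  next
    case (step n)
    have "cmod (c (Suc n) - c N) \<le> cmod (c (Suc n) - c n) + cmod (c n - c N)"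
      by (metis norm_triangle_ineq diff_add_cancel add_diff_eq)
    also have "\<dots> \<le> 3 * (1 / sqrt n - 1 / sqrt (real (Suc n))) + 3 * (1 / sqrt N - 1 / sqrt n)"
      using step by (intro add_mono c_step) auto
    also have "\<dots> = 3 * (1 / sqrt N - 1 / sqrt (real (Suc n)))"
      by (simp only: right_diff_distrib)
    finally show ?case .
  qed
  moreover have near: "cmod (zeta_approx n t - c n) \<le> 1 / sqrt n" if "n \<ge> N" for n
  proof -
    have n: "n \<ge> 1" using that N1 by simp
    have "cmod (zeta_approx n t - c n) = (sqrt n / cmod w) * cmod (b n - 1)"
      using ng[OF n] by (simp add: c_def norm_mult)
    also have "\<dots> \<le> (sqrt n / cmod w) * (cmod w * (1 / real n))"
      unfolding b_def using incr_quot_near_one[OF w _ wn[OF that]] n w0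
      by (intro mult_left_mono) auto
    also have "\<dots> = 1 / sqrt n"
      using w0 n by (simp add: field_simps flip: real_sqrt_mult)
    finally show ?thesis .
  qed
  ultimately have "cmod (c M - c N) \<le> 3 / sqrt N - 3 / sqrt M" by simp
  moreover have "1 / sqrt M \<le> 1 / sqrt N" using M N1 by (intro divide_left_mono) auto
  moreover have "cmod (zeta_approx M t - zeta_approx N t)
     \<le> cmod (zeta_approx M t - c M) + cmod (c M - c N) + cmod (zeta_approx N t - c N)"
    by (smt (verit, best) norm_triangle_ineq norm_minus_commute diff_add_cancel add_diff_eq norm_triangle_ineq4)
  moreover have "1 / sqrt M \<ge> 0" by simp
  ultimately show ?thesis using near[OF M] near[of N] by linarith
qed

section \<open>Identification of the limit with zeta through the eta series\<close>

lemma LIMSEQ_even_odd: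
  fixes f :: "nat \<Rightarrow> 'a::metric_space"
  assumes e: "(\<lambda>n. f (2 * n)) \<longlonglongrightarrow> l" and o: "(\<lambda>n. f (Suc (2 * n))) \<longlonglongrightarrow> l"
  shows "f \<longlonglongrightarrow> l"
proof (rule metric_LIMSEQ_I)
  fix r :: real assume r: "r > 0"
  obtain A where A: "\<And>n. n \<ge> A \<Longrightarrow> dist (f (2 * n)) l < r" using metric_LIMSEQ_D[OF e r] by auto
  obtain B where B: "\<And>n. n \<ge> B \<Longrightarrow> dist (f (Suc (2 * n))) l < r" using metric_LIMSEQ_D[OF o r] by auto
  have "dist (f n) l < r" if n: "n \<ge> 2 * A + 2 * B + 2" for n
  proof (cases "even n")
    case True
    then obtain m where "n = 2 * m" by (rule evenE)
    then show ?thesis using A[of m] n by auto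
  next
    case False
    then obtain m where "n = Suc (2 * m)" by (metis oddE Suc_eq_plus1)
    then show ?thesis using B[of m] n by auto
  qed
  then show "\<exists>N. \<forall>n\<ge>N. dist (f n) l < r" by blast
qed

lemma tendsto_five_over_sqrt: "(\<lambda>n. 5 / sqrt (real n)) \<longlonglongrightarrow> 0"
  by real_asymp

lemma zeta_approx_convergent: "convergent (\<lambda>N. zeta_approx N t)"
proof (rule Cauchy_convergent, rule metric_CauchyI)
  fix e :: real assume e: "e > 0"
  have "\<forall>\<^sub>F N in sequentially. 5 / sqrt (real N) < e / 2"
    using order_tendstoD(2)[OF tendsto_five_over_sqrt, of "e/2"] e by simp
  moreover have "\<forall>\<^sub>F N in sequentially. real N \<ge> 1 + 2 * \<bar>t\<bar>"
    using filterlim_real_sequentially unfolding filterlim_at_top by blast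
  ultimately have "\<forall>\<^sub>F N in sequentially. 5 / sqrt (real N) < e / 2 \<and> real N \<ge> 1 + 2 * \<bar>t\<bar>"
    by eventually_elim auto
  then obtain N where N: "5 / sqrt (real N) < e / 2" "real N \<ge> 1 + 2 * \<bar>t\<bar>"
    unfolding eventually_sequentially by blast
  have "dist (zeta_approx m t) (zeta_approx n t) < e" if "m \<ge> N" "n \<ge> N" for m n
    using zeta_approx_cauchy[OF N(2) that(1)] zeta_approx_cauchy[OF N(2) that(2)] N(1)
      dist_triangle2[of "zeta_approx m t" "zeta_approx n t" "zeta_approx N t"]
    by (simp add: dist_norm)
  then show "\<exists>M. \<forall>m\<ge>M. \<forall>n\<ge>M. dist (zeta_approx m t) (zeta_approx n t) < e" by blast
qed

lemma eta_partial_sum: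
  fixes s :: complex
  shows "(\<Sum>n<2*N. (-1) ^ n / (of_nat (Suc n)) powr s)
       = (\<Sum>n=1..<2*N+1. of_nat n powr - s) - 2 powr (1 - s) * (\<Sum>n=1..<N+1. of_nat n powr - s)"
proof (induction N)
  case 0 then show ?case by simp
next
  case (Suc N)
  have "complex_of_nat (2 * N + 2) powr - s = (of_real 2 * of_real (real (N + 1))) powr - s"
    by (simp add: algebra_simps)
  also have "\<dots> = 2 powr - s * of_nat (N + 1) powr - s"
    by (subst powr_times_real) auto
  finally have e: "2 powr (1 - s) * of_nat (N + 1) powr - s = 2 * complex_of_nat (2 * N + 2) powr - s"
    by (simp add: powr_diff powr_minus field_simps)
  have a: "(\<Sum>n<2 * Suc N. (-1) ^ n / (of_nat (Suc n)) powr s) =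
      (\<Sum>n<2 * N. (-1) ^ n / (of_nat (Suc n)) powr s)
      + of_nat (2 * N + 1) powr - s - of_nat (2 * N + 2) powr - s"
    by (simp add: powr_minus divide_inverse)
  have b: "(\<Sum>n=1..<2*Suc N+1. complex_of_nat n powr - s) = (\<Sum>n=1..<2*N+1. of_nat n powr - s)
      + of_nat (2 * N + 1) powr - s + of_nat (2 * N + 2) powr - s"
    by (simp add: numeral_2_eq_2)
  have c: "(\<Sum>n=1..<Suc N+1. complex_of_nat n powr - s) = (\<Sum>n=1..<N+1. of_nat n powr - s)
      + of_nat (N + 1) powr - s"
    by simp
  show ?case unfolding a b c Suc.IH distrib_left e by simp
qed

lemma norm_nat_powr_half:
  assumes "n \<ge> 1"
  shows "cmod (of_nat n powr - (1/2 + \<i> * complex_of_real t)) = 1 / sqrt n"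
proof -
  have "cmod (of_nat n powr - (1/2 + \<i> * complex_of_real t)) = real n powr - (1/2)"
    using norm_powr_real_base[of "real n" "- (1/2 + \<i> * complex_of_real t)"] assms by simp
  also have "\<dots> = 1 / sqrt n"
    using assms by (subst powr_minus_divide) (simp add: powr_half_sqrt)
  finally show ?thesis .
qed

text \<open>The first 2N terms of the eta series give zs (2N+1) - 2^w zs (N+1). Each of these sums
  contains an unbounded term g, but 2^w g (N+1) = g (2N+2), so only the increment of g at 2N+1 is
  left over, and it tends to 0. Division by 1 - 2^w is legitimate because 2^w has modulus sqrt
  2.\<close>

lemma riemann_zeta_limit: "(\<lambda>N. zeta_approx N t) \<longlonglongrightarrow> riemann_zeta (1/2 + \<i> * t)"
proof -
  define s where "s = 1/2 + \<i> * complex_of_real t"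
  define w where "w = 1 - s"
  have w: "w = 1/2 - \<i> * complex_of_real t" by (simp add: w_def s_def)
  have w0: "w \<noteq> 0" by (auto simp: w complex_eq_iff)
  define zs where "zs = (\<lambda>N. \<Sum>n=1..<N. complex_of_nat n powr - s)"
  define g where "g = (\<lambda>n::nat. of_nat n powr w / w)"
  define A where "A = (\<lambda>N. zeta_approx N t)"
  obtain Z where Z: "A \<longlonglongrightarrow> Z"
    using zeta_approx_convergent[of t] by (auto simp: convergent_def A_def)
  have zs: "zs N = A N + g N" for N
    by (simp add: zs_def A_def g_def zeta_approx_def s_def w)
  define a where "a = (\<lambda>n. (-1) ^ n / complex_of_nat (Suc n) powr s)"
  define P where "P = (\<lambda>m. \<Sum>n<m. a n)"
  have term0: "a \<longlonglongrightarrow> 0"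
  proof -
    have "cmod (a n) = 1 / sqrt (Suc n)" for n
    proof -
      have "a n = (-1) ^ n * of_nat (Suc n) powr - s"
        by (simp only: a_def powr_minus divide_inverse)
      then show ?thesis
        using norm_nat_powr_half[of "Suc n" t] by (simp add: norm_mult norm_power s_def)
    qed
    moreover have "(\<lambda>n. 1 / sqrt (Suc n)) \<longlonglongrightarrow> 0" by real_asymp
    ultimately show ?thesis by (subst tendsto_norm_zero_iff[symmetric]) simp
  qed
  have nat0: "(\<lambda>n. complex_of_nat n powr - s) \<longlonglongrightarrow> 0"
  proof (rule Lim_null_comparison)
    show "\<forall>\<^sub>F n in sequentially. cmod (of_nat n powr - s) \<le> 1 / sqrt (real n)"
      using eventually_ge_at_top[of 1]
      by eventually_elim (simp only: s_def norm_nat_powr_half order_refl)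
    show "(\<lambda>n. 1 / sqrt (real n)) \<longlonglongrightarrow> 0" by real_asymp
  qed
  \<comment> \<open>\<open>zeta_approx_Suc_diff\<close> is solved for the increment of g: n^(-s)
    tends to 0, and so do the increments of the convergent sequence A.\<close>
  have dg: "(\<lambda>n. g (Suc n) - g n) \<longlonglongrightarrow> 0"
  proof -
    have "(\<lambda>n. of_nat n powr - s - (A (Suc n) - A n)) \<longlonglongrightarrow> 0 - (Z - Z)"
      by (intro tendsto_diff nat0 Z LIMSEQ_Suc[OF Z])
    moreover have "\<forall>\<^sub>F n in sequentially. of_nat n powr - s - (A (Suc n) - A n) = g (Suc n) - g n"
      using eventually_ge_at_top[of 1]
      by eventually_elim (simp add: A_def zeta_approx_Suc_diff g_def s_def w del: of_nat_Suc)
    ultimately show ?thesis by (simp add: tendsto_cong)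
  qed
  have P: "P (2 * N) = A (2 * N + 1) - 2 powr w * A (N + 1) - (g (Suc (2 * N + 1)) - g (2 * N + 1))" for N
  proof -
    have "complex_of_nat (Suc (2 * N + 1)) powr w = (of_real 2 * of_real (real (N + 1))) powr w"
      by (simp add: algebra_simps)
    also have "\<dots> = 2 powr w * of_nat (N + 1) powr w"
      by (subst powr_times_real) auto
    finally have "g (Suc (2 * N + 1)) = 2 powr w * g (N + 1)" by (simp add: g_def)
    moreover have "P (2 * N) = zs (2 * N + 1) - 2 powr w * zs (N + 1)"
      unfolding P_def a_def zs_def w_def by (rule eta_partial_sum)
    ultimately show ?thesis unfolding zs by (simp add: algebra_simps)
  qed
  have sub: "filterlim (\<lambda>N::nat. 2 * N + 1) at_top at_top" "filterlim (\<lambda>N::nat. N + 1) at_top at_top"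
    by (auto intro!: filterlim_subseq simp: strict_mono_def)
  have "(\<lambda>N. P (2 * N)) \<longlonglongrightarrow> Z - 2 powr w * Z - 0"
    unfolding P by (intro tendsto_intros filterlim_compose[OF Z] filterlim_compose[OF dg] sub)
  then have even: "(\<lambda>N. P (2 * N)) \<longlonglongrightarrow> (1 - 2 powr w) * Z" by (simp add: algebra_simps)
  have "(\<lambda>N. P (2 * N) + a (2 * N)) \<longlonglongrightarrow> (1 - 2 powr w) * Z + 0"
    by (intro tendsto_add even filterlim_compose[OF term0]) (auto intro!: filterlim_subseq simp: strict_mono_def)
  then have odd: "(\<lambda>N. P (Suc (2 * N))) \<longlonglongrightarrow> (1 - 2 powr w) * Z" by (simp add: P_def)
  have "P \<longlonglongrightarrow> (1 - 2 powr w) * Z" by (rule LIMSEQ_even_odd[OF even odd])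
  then have "a sums ((1 - 2 powr w) * Z)" by (simp add: sums_def P_def)
  then have "dirichlet_eta s = (1 - 2 powr w) * Z"
    by (simp add: dirichlet_eta_def a_def sums_iff)
  moreover have "1 - 2 powr w \<noteq> 0"
  proof -
    have "cmod (2 powr w) = sqrt 2"
      using norm_powr_real_base[of 2 w] by (simp add: w powr_half_sqrt)
    then show ?thesis by (metis norm_one eq_iff_diff_eq_0 real_sqrt_eq_1_iff numeral_eq_one_iff semiring_norm(85))
  qed
  ultimately have "riemann_zeta s = Z" by (simp add: riemann_zeta_def w_def)
  then show ?thesis using Z by (simp add: A_def s_def)
qed

lemma riemann_zeta_approx:
  assumes "real N \<ge> 1 + 2 * \<bar>t\<bar>"
  shows "cmod (riemann_zeta (1/2 + \<i> * t) - zeta_approx N t) \<le> 5 / sqrt N"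
proof (rule tendsto_upperbound)
  show "(\<lambda>M. cmod (zeta_approx M t - zeta_approx N t)) \<longlonglongrightarrow> cmod (riemann_zeta (1/2 + \<i> * t) - zeta_approx N t)"
    by (intro tendsto_intros riemann_zeta_limit)
  show "\<forall>\<^sub>F M in sequentially. cmod (zeta_approx M t - zeta_approx N t) \<le> 5 / sqrt N"
    using eventually_ge_at_top[of N] by eventually_elim (rule zeta_approx_cauchy[OF assms])
qed simp

lemma continuous_on_zeta_approx:
  assumes "N \<ge> 1"
  shows "continuous_on S (zeta_approx N)"
  unfolding zeta_approx_def
  using assms by (intro continuous_intros) (auto simp: complex_eq_iff)

text \<open>The eta series converges only conditionally here, so continuity is inherited from
  \<open>zeta_approx\<close>, whose convergence is uniform for bounded t.\<close>

lemma continuous_on_riemann_zeta_critical_line: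
  "continuous_on S (\<lambda>t::real. riemann_zeta (1/2 + \<i> * t))"
proof -
  have "continuous_on {-B<..<B} (\<lambda>t::real. riemann_zeta (1/2 + \<i> * t))" for B :: real
  proof (rule uniform_limit_theorem)
    show "\<forall>\<^sub>F N in sequentially. continuous_on {-B<..<B} (zeta_approx N)"
      using eventually_ge_at_top[of 1] by eventually_elim (rule continuous_on_zeta_approx)
    show "uniform_limit {-B<..<B} zeta_approx (\<lambda>t. riemann_zeta (1/2 + \<i> * t)) sequentially"
    proof (rule uniform_limitI)
      fix e :: real assume e: "e > 0"
      have "\<forall>\<^sub>F N in sequentially. 5 / sqrt (real N) < e"
        using order_tendstoD(2)[OF tendsto_five_over_sqrt e] .
      moreover have "\<forall>\<^sub>F N in sequentially. real N \<ge> 1 + 2 * \<bar>B\<bar>"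
        using filterlim_real_sequentially unfolding filterlim_at_top by blast
      ultimately show "\<forall>\<^sub>F N in sequentially. \<forall>t\<in>{-B<..<B}. dist (zeta_approx N t) (riemann_zeta (1/2 + \<i> * t)) < e"
      proof eventually_elim
        case (elim N)
        show ?case
        proof
          fix t assume "t \<in> {-B<..<B}"
          then have "cmod (riemann_zeta (1/2 + \<i> * t) - zeta_approx N t) \<le> 5 / sqrt N"
            using elim by (intro riemann_zeta_approx) auto
          then show "dist (zeta_approx N t) (riemann_zeta (1/2 + \<i> * t)) < e"
            using elim by (simp add: dist_norm norm_minus_commute)
        qed
      qed
    qed
  qed simp
  then have "isCont (\<lambda>t::real. riemann_zeta (1/2 + \<i> * t)) t" for t
    by (rule continuous_on_interior[where S = "{-(\<bar>t\<bar>+1)<..<\<bar>t\<bar>+1}"]) auto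
  then show ?thesis by (simp add: continuous_at_imp_continuous_on)
qed

lemma continuous_on_Z2: "continuous_on S Z2"
  unfolding Z2_def by (intro continuous_intros continuous_on_riemann_zeta_critical_line)

lemma Z2_nonneg: "Z2 t \<ge> 0"
  by (simp add: Z2_def)

subsection \<open>Mean squares of Dirichlet polynomials\<close>

definition dpoly :: "nat \<Rightarrow> nat \<Rightarrow> real \<Rightarrow> complex" where
  "dpoly a N t = (\<Sum>n=a..<N. of_nat n powr (- (1/2 + \<i> * t)))"

definition upper_sum :: "nat \<Rightarrow> nat \<Rightarrow> (nat \<Rightarrow> nat \<Rightarrow> real) \<Rightarrow> real" where
  "upper_sum a N f = (\<Sum>m=a..<N. \<Sum>n=Suc m..<N. f m n)"

definition log_gap :: "nat \<Rightarrow> nat \<Rightarrow> real" where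
  "log_gap m n = ln (real n) - ln (real m)"

text \<open>The closed form of the integral of |dpoly|^2 over [0, \<tau>]; \<open>msq2\<close> is in
  turn the integral of \<open>msq\<close>. Each integration contributes one factor 1 /
  \<open>log_gap\<close> to the off-diagonal terms.\<close>

definition msq :: "nat \<Rightarrow> nat \<Rightarrow> real \<Rightarrow> real" where
  "msq a N \<tau> = \<tau> * (\<Sum>n=a..<N. 1 / real n)
     + 2 * upper_sum a N (\<lambda>m n. sin (\<tau> * log_gap m n) / (sqrt (real m * real n) * log_gap m n))"

definition msq2_off :: "nat \<Rightarrow> nat \<Rightarrow> real \<Rightarrow> real" where
  "msq2_off a N \<tau> = upper_sum a N (\<lambda>m n. (1 - cos (\<tau> * log_gap m n)) / (sqrt (real m * real n) * (log_gap m n)\<^sup>2))"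

definition msq2 :: "nat \<Rightarrow> nat \<Rightarrow> real \<Rightarrow> real" where
  "msq2 a N \<tau> = \<tau>\<^sup>2 / 2 * (\<Sum>n=a..<N. 1 / real n) + 2 * msq2_off a N \<tau>"

lemma sum_square_symmetric:
  fixes f :: "nat \<Rightarrow> nat \<Rightarrow> real"
  assumes sym: "\<And>m n. f m n = f n m"
  shows "(\<Sum>m=a..<N. \<Sum>n=a..<N. f m n) = (\<Sum>n=a..<N. f n n) + 2 * upper_sum a N f"
proof (cases "a \<le> N")
  case True
  then show ?thesis
  proof (induction N rule: dec_induct)
    case base then show ?case by (simp add: upper_sum_def)
  next
    case (step N)
    have "(\<Sum>m=a..<Suc N. \<Sum>n=a..<Suc N. f m n)
        = (\<Sum>m=a..<N. (\<Sum>n=a..<N. f m n) + f m N) + ((\<Sum>n=a..<N. f N n) + f N N)"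
      using step(1) by simp
    also have "\<dots> = (\<Sum>m=a..<N. \<Sum>n=a..<N. f m n) + 2 * (\<Sum>m=a..<N. f m N) + f N N"
    proof -
      have "(\<Sum>n=a..<N. f N n) = (\<Sum>m=a..<N. f m N)" by (intro sum.cong refl sym)
      then show ?thesis by (simp add: sum.distrib)
    qed
    finally have 1: "(\<Sum>m=a..<Suc N. \<Sum>n=a..<Suc N. f m n)
        = (\<Sum>m=a..<N. \<Sum>n=a..<N. f m n) + 2 * (\<Sum>m=a..<N. f m N) + f N N" .
    have "upper_sum a (Suc N) f = (\<Sum>m=a..<N. \<Sum>n=Suc m..<Suc N. f m n)"
      using step(1) by (simp add: upper_sum_def)
    also have "\<dots> = (\<Sum>m=a..<N. (\<Sum>n=Suc m..<N. f m n) + f m N)"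
      by (rule sum.cong) auto
    finally have 2: "upper_sum a (Suc N) f = upper_sum a N f + (\<Sum>m=a..<N. f m N)"
      by (simp add: sum.distrib upper_sum_def)
    show ?case unfolding 1 2 step.IH using step(1) by simp
  qed
qed (simp add: upper_sum_def)

lemma log_gap_pos: "0 < m \<Longrightarrow> m < n \<Longrightarrow> log_gap m n > 0"
  by (simp add: log_gap_def)

lemma nat_powr_critical:
  assumes "n \<ge> 1"
  shows "of_nat n powr (- (1/2 + \<i> * complex_of_real t)) = of_real (1 / sqrt n) * cis (- (t * ln n))"
proof -
  have "complex_of_nat n powr (- (1/2 + \<i> * complex_of_real t))
      = exp (complex_of_real (- (ln n / 2)) + \<i> * complex_of_real (- (t * ln n)))"
    using assms Ln_of_nat[of n] by (simp add: powr_def) (simp add: algebra_simps)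
  also have "\<dots> = complex_of_real (exp (- (ln n / 2))) * cis (- (t * ln n))"
    by (simp only: exp_add cis_conv_exp exp_of_real)
  also have "exp (- (ln (real n) / 2)) = 1 / sqrt n"
  proof -
    have "ln (real n) / 2 = ln (sqrt n)" using assms by (simp add: ln_sqrt)
    then have "exp (- (ln (real n) / 2)) = inverse (exp (ln (sqrt n)))" by (simp only: exp_minus)
    also have "\<dots> = inverse (sqrt n)" using assms by (subst exp_ln) auto
    finally show ?thesis by (simp only: inverse_eq_divide)
  qed
  finally show ?thesis .
qed

lemma norm_dpoly_squared:
  assumes a: "a \<ge> 1"
  shows "(cmod (dpoly a N t))\<^sup>2 = (\<Sum>n=a..<N. 1 / real n)
     + 2 * upper_sum a N (\<lambda>m n. cos (t * log_gap m n) / sqrt (real m * real n))"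
proof -
  define z where "z = (\<lambda>n::nat. complex_of_real (1 / sqrt n) * cis (- (t * ln n)))"
  define f where "f = (\<lambda>m n. cos (t * log_gap m n) / sqrt (real m * real n))"
  have d: "dpoly a N t = (\<Sum>n=a..<N. z n)"
    unfolding dpoly_def z_def using a by (intro sum.cong refl nat_powr_critical) auto
  have "(cmod (dpoly a N t))\<^sup>2 = Re (dpoly a N t * cnj (dpoly a N t))"
    by (simp add: complex_mult_cnj cmod_power2)
  also have "\<dots> = (\<Sum>m=a..<N. \<Sum>n=a..<N. Re (z m * cnj (z n)))"
    by (simp only: d cnj_sum sum_product Re_sum)
  also have "\<dots> = (\<Sum>m=a..<N. \<Sum>n=a..<N. f m n)"
  proof (intro sum.cong refl)
    fix m n
    have "Re (z m * cnj (z n)) = (1 / sqrt m) * (1 / sqrt n) * Re (cis (- (t * ln m)) * cis (t * ln n))"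
      by (simp add: z_def cis_cnj field_simps)
    also have "cis (- (t * ln (real m))) * cis (t * ln (real n)) = cis (t * log_gap m n)"
      by (simp add: cis_mult log_gap_def algebra_simps)
    finally show "Re (z m * cnj (z n)) = f m n"
      by (simp add: f_def real_sqrt_mult)
  qed
  also have "\<dots> = (\<Sum>n=a..<N. f n n) + 2 * upper_sum a N f"
  proof (rule sum_square_symmetric)
    fix m n
    have "t * log_gap m n = - (t * log_gap n m)" by (simp add: log_gap_def algebra_simps)
    then show "f m n = f n m" by (simp add: f_def mult.commute)
  qed
  also have "(\<Sum>n=a..<N. f n n) = (\<Sum>n=a..<N. 1 / real n)"
    by (intro sum.cong refl) (simp add: f_def log_gap_def)
  finally show ?thesis by (simp add: f_def)
qed

lemma msq_deriv:
  assumes a: "a \<ge> 1"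
  shows "(msq a N has_real_derivative (cmod (dpoly a N t))\<^sup>2) (at t within S)"
proof -
  define g where "g = (\<lambda>m n \<tau>. sin (\<tau> * log_gap m n) / (sqrt (real m * real n) * log_gap m n))"
  have g: "((\<lambda>\<tau>. g m n \<tau>) has_real_derivative cos (t * log_gap m n) / sqrt (real m * real n)) (at t within S)"
    if "a \<le> m" "m < n" for m n
    using log_gap_pos[of m n] that a unfolding g_def
    by (auto intro!: derivative_eq_intros simp: field_simps)
  have "((\<lambda>\<tau>. upper_sum a N (\<lambda>m n. g m n \<tau>)) has_real_derivative
      upper_sum a N (\<lambda>m n. cos (t * log_gap m n) / sqrt (real m * real n))) (at t within S)"
    unfolding upper_sum_def by (intro DERIV_sum g) auto
  then show ?thesis
    unfolding norm_dpoly_squared[OF a] msq_def g_def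
    by (auto intro!: derivative_eq_intros)
qed

lemma msq2_deriv:
  assumes a: "a \<ge> 1"
  shows "(msq2 a N has_real_derivative msq a N t) (at t within S)"
proof -
  define g where "g = (\<lambda>m n \<tau>. (1 - cos (\<tau> * log_gap m n)) / (sqrt (real m * real n) * (log_gap m n)\<^sup>2))"
  have g: "((\<lambda>\<tau>. g m n \<tau>) has_real_derivative sin (t * log_gap m n) / (sqrt (real m * real n) * log_gap m n)) (at t within S)"
    if "a \<le> m" "m < n" for m n
    using log_gap_pos[of m n] that a unfolding g_def
    by (auto intro!: derivative_eq_intros simp: field_simps power2_eq_square)
  have "(msq2_off a N has_real_derivative
      upper_sum a N (\<lambda>m n. sin (t * log_gap m n) / (sqrt (real m * real n) * log_gap m n))) (at t within S)"
    unfolding upper_sum_def msq2_off_def[abs_def] by (intro DERIV_sum g[unfolded g_def]) auto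
  then show ?thesis
    unfolding msq2_def[abs_def] msq_def
    by (auto intro!: derivative_eq_intros)
qed

lemma msq_has_integral:
  assumes "a \<ge> 1" "x \<le> y"
  shows "((\<lambda>t. (cmod (dpoly a N t))\<^sup>2) has_integral (msq a N y - msq a N x)) {x..y}"
  using assms msq_deriv[OF assms(1)]
  by (intro fundamental_theorem_of_calculus) (auto simp: has_real_derivative_iff_has_vector_derivative[symmetric])

lemma msq_mono:
  assumes "a \<ge> 1" "x \<le> y"
  shows "msq a N x \<le> msq a N y"
  using has_integral_nonneg[OF msq_has_integral[OF assms]] by simp

lemma msq_le_difference_quotient:
  assumes "a \<ge> 1" "x < y"
  shows "(y - x) * msq a N x \<le> msq2 a N y - msq2 a N x"
    and "msq2 a N y - msq2 a N x \<le> (y - x) * msq a N y"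
proof -
  obtain z where z: "x < z" "z < y" "msq2 a N y - msq2 a N x = (y - x) * msq a N z"
    using MVT2[OF assms(2), of "msq2 a N" "msq a N"] msq2_deriv[OF assms(1)] by blast
  show "(y - x) * msq a N x \<le> msq2 a N y - msq2 a N x"
    using z msq_mono[OF assms(1), of x z N] by (auto intro!: mult_left_mono)
  show "msq2 a N y - msq2 a N x \<le> (y - x) * msq a N y"
    using z msq_mono[OF assms(1), of z y N] by (auto intro!: mult_left_mono)
qed

section \<open>Trivial estimates for pairs with a small index\<close>

lemma sum_inverse_le_ln:
  assumes "N \<ge> 1"
  shows "(\<Sum>h=1..N. 1 / real h) \<le> 1 + ln N"
  using assms
proof (induction N rule: dec_induct)
  case base then show ?case by simp
next
  case (step n)
  have "ln (real n / real (Suc n)) \<le> real n / real (Suc n) - 1"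
    by (rule ln_le_minus_one) (use step in auto)
  then have "1 / real (Suc n) \<le> ln (Suc n) - ln n"
    using step(1) by (simp add: ln_div field_simps)
  then show ?case using step by simp
qed

lemma sum_inverse_sqrt_le:
  "(\<Sum>h=1..N. 1 / sqrt (real h)) \<le> 2 * sqrt N"
proof (induction N)
  case 0 then show ?case by simp
next
  case (Suc n)
  have "1 / sqrt (real (Suc n)) \<le> 2 * sqrt (Suc n) - 2 * sqrt n"
  proof -
    define u v where "u = sqrt (Suc n)" and "v = sqrt n"
    have "u > 0" "v \<ge> 0" "v \<le> u" "u * u = v * v + 1" by (auto simp: u_def v_def)
    have "(u - v) * (u - v) \<ge> 0" by simp
    then have "1 \<le> (2 * u - 2 * v) * u" using \<open>u * u = v * v + 1\<close> by (simp add: algebra_simps)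
    then show ?thesis using \<open>u > 0\<close> unfolding u_def[symmetric] v_def[symmetric] by (simp add: field_simps)
  qed
  then show ?case using Suc by simp
qed

text \<open>From ln (n / m) \<ge> h / n the weight is at most sqrt n / (h sqrt m), and sqrt n \<le>
  sqrt m + sqrt h separates a harmonic term from one that matters only for h large compared with
  m.\<close>

lemma pair_weight_bound:
  assumes m: "m \<ge> 1" and n: "n = m + h" and h: "h \<ge> 1"
  shows "1 / (sqrt (real m * real n) * log_gap m n) \<le> 1 / real h + 1 / (sqrt m * sqrt h)"
proof -
  have l: "log_gap m n \<ge> real h / real n"
  proof -
    have "ln (real m / real n) \<le> real m / real n - 1"
      by (rule ln_le_minus_one) (use m n in auto)
    then show ?thesis using m n by (simp add: log_gap_def ln_div field_simps)
  qed
  have pos: "real h / real n > 0" "sqrt (real m * real n) > 0" using m n h by auto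
  have "1 / (sqrt (real m * real n) * log_gap m n) \<le> 1 / (sqrt (real m * real n) * (real h / real n))"
  proof (intro divide_left_mono mult_left_mono l)
    show "0 < sqrt (real m * real n) * log_gap m n * (sqrt (real m * real n) * (real h / real n))"
      using l pos by (intro mult_pos_pos) auto
  qed (use pos in auto)
  also have "\<dots> = sqrt n / (sqrt m * h)"
  proof -
    define q where "q = sqrt (real n)"
    have q: "real n = q * q" "q > 0" using m n by (auto simp: q_def)
    have "sqrt (real m * real n) = sqrt m * q" by (simp add: q_def real_sqrt_mult)
    then show ?thesis unfolding q_def[symmetric] using q m h by (simp add: field_simps)
  qed
  also have "\<dots> \<le> (sqrt m + sqrt h) / (sqrt m * h)"
    using m n h sqrt_add_le_add_sqrt[of m h] by (intro divide_right_mono) auto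
  also have "\<dots> = 1 / real h + 1 / (sqrt m * sqrt h)"
  proof -
    have "real h = sqrt h * sqrt h" by simp
    define r where "r = sqrt (real h)"
    have r: "real h = r * r" "r > 0" using h by (auto simp: r_def)
    have "sqrt (real m) > 0" using m by simp
    then show ?thesis unfolding r(1) r_def[symmetric] using r(2)
      by (simp add: field_simps)
  qed
  finally show ?thesis .
qed

text \<open>The harmonic part yields P (1 + ln N), the other part sqrt (P N). With P = T / ln^2 T
  and N of order T both are O(T / ln T), which explains this choice of P.\<close>

lemma sum_pair_weights_bound:
  assumes P: "P \<ge> 1" and N: "N \<ge> 1"
  shows "(\<Sum>m=1..<P. \<Sum>n=Suc m..<N. 1 / (sqrt (real m * real n) * log_gap m n))
     \<le> P * (1 + ln N) + 4 * sqrt (real P * real N)"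
proof -
  have inner: "(\<Sum>n=Suc m..<N. 1 / (sqrt (real m * real n) * log_gap m n))
      \<le> (1 + ln N) + (1 / sqrt m) * (2 * sqrt N)" if "m \<ge> 1" for m
  proof -
    have "(\<Sum>n=Suc m..<N. 1 / (sqrt (real m * real n) * log_gap m n))
       \<le> (\<Sum>n=Suc m..<N. 1 / real (n - m) + (1 / sqrt m) * (1 / sqrt (n - m)))"
    proof (rule sum_mono)
      fix n assume "n \<in> {Suc m..<N}"
      then show "1 / (sqrt (real m * real n) * log_gap m n) \<le> 1 / real (n - m) + (1 / sqrt m) * (1 / sqrt (n - m))"
        using pair_weight_bound[of m n "n - m"] that by (simp add: Suc_le_eq)
    qed
    also have "\<dots> = (\<Sum>h\<in>(\<lambda>n. n - m) ` {Suc m..<N}. 1 / real h + (1 / sqrt m) * (1 / sqrt h))"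
      by (subst sum.reindex) (auto simp: inj_on_def)
    also have "\<dots> \<le> (\<Sum>h=1..N. 1 / real h + (1 / sqrt m) * (1 / sqrt h))"
      by (rule sum_mono2) auto
    also have "\<dots> = (\<Sum>h=1..N. 1 / real h) + (1 / sqrt m) * (\<Sum>h=1..N. 1 / sqrt h)"
      by (simp add: sum.distrib sum_distrib_left)
    also have "\<dots> \<le> (1 + ln N) + (1 / sqrt m) * (2 * sqrt N)"
      by (intro add_mono mult_left_mono sum_inverse_le_ln sum_inverse_sqrt_le N) auto
    finally show ?thesis .
  qed
  have "(\<Sum>m=1..<P. \<Sum>n=Suc m..<N. 1 / (sqrt (real m * real n) * log_gap m n))
     \<le> (\<Sum>m=1..<P. (1 + ln N) + (1 / sqrt m) * (2 * sqrt N))"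
    by (intro sum_mono inner) auto
  also have "\<dots> \<le> (\<Sum>m=1..P. (1 + ln N) + (1 / sqrt m) * (2 * sqrt N))"
    using N by (intro sum_mono2) auto
  also have "\<dots> = P * (1 + ln N) + (\<Sum>m=1..P. 1 / sqrt m) * (2 * sqrt N)"
    by (simp add: sum.distrib sum_distrib_right)
  also have "\<dots> \<le> P * (1 + ln N) + (2 * sqrt P) * (2 * sqrt N)"
    by (intro add_left_mono mult_right_mono sum_inverse_sqrt_le) auto
  finally show ?thesis by (simp add: real_sqrt_mult)
qed

lemma msq_split:
  assumes P: "1 \<le> P" "P \<le> N"
  shows "\<bar>(msq 1 N \<tau> - \<tau> * (\<Sum>n=1..<N. 1 / real n)) - (msq P N \<tau> - \<tau> * (\<Sum>n=P..<N. 1 / real n))\<bar>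
      \<le> 2 * (P * (1 + ln N) + 4 * sqrt (real P * real N))"
proof -
  define f where "f = (\<lambda>m n. sin (\<tau> * log_gap m n) / (sqrt (real m * real n) * log_gap m n))"
  have "(\<Sum>m=1..<N. \<Sum>n=Suc m..<N. f m n) = (\<Sum>m=1..<P. \<Sum>n=Suc m..<N. f m n) + (\<Sum>m=P..<N. \<Sum>n=Suc m..<N. f m n)"
    using P by (simp add: sum.atLeastLessThan_concat)
  then have eq: "(msq 1 N \<tau> - \<tau> * (\<Sum>n=1..<N. 1 / real n)) - (msq P N \<tau> - \<tau> * (\<Sum>n=P..<N. 1 / real n))
     = 2 * (\<Sum>m=1..<P. \<Sum>n=Suc m..<N. f m n)"
    by (simp add: msq_def upper_sum_def f_def)
  have le: "\<bar>\<Sum>m=1..<P. \<Sum>n=Suc m..<N. f m n\<bar> \<le> (\<Sum>m=1..<P. \<Sum>n=Suc m..<N. 1 / (sqrt (real m * real n) * log_gap m n))"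
  proof (intro order_trans[OF sum_abs] sum_mono)
    fix m n assume mn: "m \<in> {1..<P}" "n \<in> {Suc m..<N}"
    have "log_gap m n > 0" using log_gap_pos mn by auto
    then show "\<bar>f m n\<bar> \<le> 1 / (sqrt (real m * real n) * log_gap m n)"
      unfolding f_def abs_divide using mn by (intro frac_le) (auto simp: abs_mult)
  qed
  also have "\<dots>
     \<le> P * (1 + ln N) + 4 * sqrt (real P * real N)"
    using P by (intro sum_pair_weights_bound) auto
  finally have "\<bar>2 * (\<Sum>m=1..<P. \<Sum>n=Suc m..<N. f m n)\<bar> \<le> 2 * (P * (1 + ln N) + 4 * sqrt (real P * real N))"
    by (simp only: abs_mult abs_numeral mult_le_cancel_left_pos zero_less_numeral)
  then show ?thesis by (simp only: eq)
qed

subsection \<open>The off-diagonal kernel\<close>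

definition pkern_part :: "nat \<Rightarrow> real \<Rightarrow> real" where
  "pkern_part H y = (\<Sum>h=1..H. (1 - cos (real h * y)) / (real h)\<^sup>2)"

text \<open>The Fourier series of the 2 pi-periodic function equal to y (2 pi - y) / 4 on [0, 2 pi].
  The development works with its bounds 0 and 4, its continuity and the rate 2 / H of its partial
  sums.\<close>

definition pkern :: "real \<Rightarrow> real" where
  "pkern y = lim (\<lambda>H. pkern_part H y)"

lemma sum_inverse_squares_tail:
  assumes "1 \<le> H" "H \<le> M"
  shows "(\<Sum>h=Suc H..M. 1 / (real h)\<^sup>2) \<le> 1 / H - 1 / M"
  using assms(2)
proof (induction M rule: dec_induct)
  case base then show ?case by simp
next
  case (step n)
  have "1 / (real (Suc n))\<^sup>2 \<le> 1 / (real n * real (Suc n))"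
    using step assms by (intro divide_left_mono) (auto simp: power2_eq_square)
  also have "\<dots> = 1 / n - 1 / Suc n"
    using step assms by (subst diff_frac_eq) auto
  finally have "1 / (real (Suc n))\<^sup>2 \<le> 1 / n - 1 / Suc n" .
  moreover have "(\<Sum>h=Suc H..Suc n. 1 / (real h)\<^sup>2) = (\<Sum>h=Suc H..n. 1 / (real h)\<^sup>2) + 1 / (real (Suc n))\<^sup>2"
    using step by simp
  ultimately show ?case using step by linarith
qed

lemma pkern_part_mono:
  assumes "H \<le> M" shows "pkern_part H y \<le> pkern_part M y"
  unfolding pkern_part_def using assms by (intro sum_mono2) auto

lemma pkern_part_diff:
  assumes "1 \<le> H" "H \<le> M" shows "pkern_part M y - pkern_part H y \<le> 2 / H"
proof -
  have "pkern_part M y = pkern_part H y + (\<Sum>h=Suc H..M. (1 - cos (real h * y)) / (real h)\<^sup>2)"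
  proof -
    obtain d where "M = H + d" using assms(2) le_Suc_ex by blast
    then show ?thesis unfolding pkern_part_def by (simp only:) (subst sum.ub_add_nat, auto)
  qed
  moreover have "(\<Sum>h=Suc H..M. (1 - cos (real h * y)) / (real h)\<^sup>2) \<le> (\<Sum>h=Suc H..M. 2 * (1 / (real h)\<^sup>2))"
  proof (rule sum_mono)
    fix h assume "h \<in> {Suc H..M}"
    have "1 - cos (real h * y) \<le> 2" using cos_ge_minus_one[of "real h * y"] by linarith
    then show "(1 - cos (real h * y)) / (real h)\<^sup>2 \<le> 2 * (1 / (real h)\<^sup>2)"
      by (simp add: divide_right_mono)
  qed
  moreover have "(\<Sum>h=Suc H..M. 2 * (1 / (real h)\<^sup>2)) \<le> 2 * (1 / H - 1 / M)"
    unfolding sum_distrib_left[symmetric] using sum_inverse_squares_tail[OF assms] by simp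
  moreover have "2 * (1 / real H - 1 / real M) \<le> 2 / H" by simp
  ultimately show ?thesis by linarith
qed

lemma pkern_part_bounds: "0 \<le> pkern_part H y" "pkern_part H y \<le> 4"
proof -
  show "0 \<le> pkern_part H y" unfolding pkern_part_def by (intro sum_nonneg) simp
  have "pkern_part 1 y \<le> 2" using cos_ge_minus_one[of y] by (simp add: pkern_part_def)
  moreover have "pkern_part (Suc H) y - pkern_part 1 y \<le> 2" using pkern_part_diff[of 1 "Suc H" y] by simp
  ultimately show "pkern_part H y \<le> 4" using pkern_part_mono[of H "Suc H" y] by simp
qed

lemma pkern_part_tendsto: "(\<lambda>H. pkern_part H y) \<longlonglongrightarrow> pkern y"
proof -
  have "Bseq (\<lambda>H. pkern_part H y)"
    using pkern_part_bounds by (intro BseqI'[of _ 4]) (simp add: abs_le_iff order_trans[of _ 0])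
  then have "convergent (\<lambda>H. pkern_part H y)"
    by (intro Bseq_monoseq_convergent) (auto simp: monoseq_def pkern_part_mono)
  then show ?thesis by (simp add: pkern_def convergent_LIMSEQ_iff)
qed

lemma pkern_bounds: "0 \<le> pkern y" "pkern y \<le> 4"
  using LIMSEQ_le_const[OF pkern_part_tendsto, of 0 y] LIMSEQ_le_const2[OF pkern_part_tendsto, of y 4]
    pkern_part_bounds by auto

lemma pkern_approx:
  assumes "H \<ge> 1" shows "\<bar>pkern_part H y - pkern y\<bar> \<le> 2 / H"
proof -
  have "pkern_part H y \<le> pkern y"
    by (rule LIMSEQ_le_const[OF pkern_part_tendsto]) (auto intro: pkern_part_mono)
  moreover have "pkern y \<le> pkern_part H y + 2 / H"
    by (rule LIMSEQ_le_const2[OF pkern_part_tendsto])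
       (use pkern_part_diff[OF assms] in \<open>force simp: algebra_simps\<close>)
  ultimately show ?thesis by simp
qed

lemma continuous_on_pkern: "continuous_on S pkern"
proof (rule uniform_limit_theorem)
  show "\<forall>\<^sub>F H in sequentially. continuous_on S (pkern_part H)"
    unfolding pkern_part_def by (intro always_eventually allI continuous_intros) auto
  show "uniform_limit S pkern_part pkern sequentially"
  proof (rule uniform_limitI)
    fix e :: real assume "e > 0"
    have "(\<lambda>H. 2 / real H) \<longlonglongrightarrow> 0" by real_asymp
    from order_tendstoD(2)[OF this \<open>e > 0\<close>] eventually_ge_at_top[of 1]
    show "\<forall>\<^sub>F H in sequentially. \<forall>y\<in>S. dist (pkern_part H y) (pkern y) < e"
    proof eventually_elim
      case (elim H)
      then show ?case using pkern_approx[of H] by (auto simp: dist_real_def intro: le_less_trans)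
    qed
  qed
qed simp

lemma isCont_pkern: "isCont pkern y"
  using continuous_on_pkern[of UNIV] by (simp add: continuous_on_eq_continuous_at)

text \<open>The off-diagonal terms sum to about the sum of m pkern (\<tau> / m) over m < N, a
  Riemann sum for the integral of x pkern (\<tau> / x) over [0, N]. Scaling x by \<tau> turns this
  integral into \<tau>^2 jkern (N / \<tau>).\<close>

definition jkern :: "real \<Rightarrow> real" where
  "jkern c = integral {0..c} (\<lambda>x. x * pkern (1 / x))"

lemma continuous_on_scaled_pkern: "continuous_on {0..} (\<lambda>x. x * pkern (\<tau> / x))"
proof -
  have "continuous (at x within {0..}) (\<lambda>x. x * pkern (\<tau> / x))" if "x \<ge> 0" for x
  proof (cases "x = 0")
    case False
    then have "isCont (\<lambda>x. x * pkern (\<tau> / x)) x"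
      by (intro continuous_intros isCont_o2[OF _ isCont_pkern]) auto
    then show ?thesis by (rule continuous_at_imp_continuous_at_within)
  next
    \<comment> \<open>Near 0 the kernel may oscillate, but it is bounded by 4 and the factor x
      forces the limit 0, which is also the value at 0.\<close>
    case True
    have "((\<lambda>x. x * pkern (\<tau> / x)) \<longlongrightarrow> 0) (at 0 within {0..})"
    proof (rule Lim_null_comparison)
      show "\<forall>\<^sub>F x in at 0 within {0..}. norm (x * pkern (\<tau> / x)) \<le> 4 * \<bar>x :: real\<bar>"
        using pkern_bounds by (intro always_eventually) (auto simp: abs_mult mult.commute[of 4] intro!: mult_left_mono)
      show "((\<lambda>x::real. 4 * \<bar>x\<bar>) \<longlongrightarrow> 0) (at 0 within {0..})"
        by (auto intro!: tendsto_eq_intros)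
    qed
    then show ?thesis using True by (simp add: continuous_within)
  qed
  then show ?thesis by (simp add: continuous_on_eq_continuous_within)
qed

lemma jkern_deriv:
  assumes "c > 0" shows "(jkern has_real_derivative c * pkern (1 / c)) (at c)"
proof -
  have "(jkern has_real_derivative c * pkern (1 / c)) (at c within {0..c+1})"
    unfolding jkern_def
    by (rule integral_has_real_derivative)
       (use assms in \<open>auto intro: continuous_on_subset[OF continuous_on_scaled_pkern[of 1]]\<close>)
  then have "(jkern has_real_derivative c * pkern (1 / c)) (at c within {0<..<c+1})"
    by (rule DERIV_subset) auto
  then show ?thesis using assms by (simp add: at_within_open[of c "{0<..<c+1}"])
qed

lemma continuous_on_jkern: "continuous_on {0..c} jkern"
  unfolding jkern_def
  by (intro indefinite_integral_continuous_1 integrable_continuous_interval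
        continuous_on_subset[OF continuous_on_scaled_pkern[of 1]]) auto

lemma scaled_pkern_has_integral:
  assumes "\<tau> > 0" "c \<ge> 0"
  shows "((\<lambda>x. x * pkern (\<tau> / x)) has_integral \<tau>\<^sup>2 * jkern (c / \<tau>)) {0..c}"
proof -
  have "((\<lambda>x. x * pkern (\<tau> / x)) has_integral \<tau>\<^sup>2 * jkern (c / \<tau>) - \<tau>\<^sup>2 * jkern (0 / \<tau>)) {0..c}"
  \<comment> \<open>The interior form is taken because \<open>jkern_deriv\<close> speaks of positive
    arguments only; at 0 continuity is used instead.\<close>
  proof (rule fundamental_theorem_of_calculus_interior)
    show "continuous_on {0..c} (\<lambda>c. \<tau>\<^sup>2 * jkern (c / \<tau>))"
      by (intro continuous_intros continuous_on_compose2[OF continuous_on_jkern[of "c / \<tau>"]])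
         (use assms in \<open>auto simp: divide_right_mono\<close>)
    show "((\<lambda>c. \<tau>\<^sup>2 * jkern (c / \<tau>)) has_vector_derivative x * pkern (\<tau> / x)) (at x)" if "x \<in> {0<..<c}" for x
    proof -
      have "((\<lambda>c. jkern (c / \<tau>)) has_real_derivative (x / \<tau> * pkern (1 / (x / \<tau>))) * (1 / \<tau>)) (at x)"
        by (rule DERIV_chain2[OF jkern_deriv]) (use that assms in \<open>auto intro!: derivative_eq_intros\<close>)
      from DERIV_cmult[OF this, of "\<tau>\<^sup>2"] show ?thesis
        using assms by (simp add: has_real_derivative_iff_has_vector_derivative[symmetric] power2_eq_square field_simps)
    qed
  qed (use assms in auto)
  then show ?thesis by (simp add: jkern_def)
qed

section \<open>Replacing the off-diagonal terms by kernel terms\<close>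

lemma abs_cos_diff_le: "\<bar>cos a - cos b\<bar> \<le> \<bar>a - b\<bar>" for a b :: real
proof -
  have *: "\<bar>cos a - cos b\<bar> \<le> \<bar>a - b\<bar>" if ab: "a < b" for a b :: real
  proof -
    obtain z where "cos b - cos a = (b - a) * - sin z"
      using MVT2[OF ab, of cos "\<lambda>x. - sin x"] by (auto intro: derivative_eq_intros)
    then have "\<bar>cos a - cos b\<bar> = \<bar>b - a\<bar> * \<bar>sin z\<bar>" 
      by (metis abs_minus_commute abs_mult abs_minus_cancel)
    also have "\<dots> \<le> \<bar>b - a\<bar> * 1" by (intro mult_left_mono) auto
    finally show ?thesis by (simp add: abs_minus_commute)
  qed
  show ?thesis using *[of a b] *[of b a] by (cases a b rule: linorder_cases) (auto simp: abs_minus_commute)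
qed

text \<open>With n = m (1 + r) the denominator of a twice integrated term is m D. Here D differs
  from r^2 by at most 2 r^3 and is at least r^2 / 4 for r \<le> 1/2; the quotient of these bounds
  gives 8 / r.\<close>

lemma sqrt_ln_weight_approx:
  fixes r :: real
  assumes r: "0 < r" "r \<le> 1/2"
  defines "D \<equiv> sqrt (1 + r) * (ln (1 + r))\<^sup>2"
  shows "D > 0" "\<bar>1 / D - 1 / r\<^sup>2\<bar> \<le> 8 / r"
proof -
  have lo: "r - r\<^sup>2 \<le> ln (1 + r)" by (rule ln_one_plus_pos_lower_bound) (use r in auto)
  have up: "ln (1 + r) \<le> r" by (rule ln_add_one_self_le_self) (use r in auto)
  have pos: "r - r\<^sup>2 > 0" using r by (simp add: power2_eq_square)
  have s1: "1 \<le> sqrt (1 + r)" using r by simp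
  have s2: "sqrt (1 + r) \<le> 1 + r" using r by (intro real_le_lsqrt) (auto simp: power2_eq_square algebra_simps add_nonneg_nonneg)
  have "1 * (r - r\<^sup>2)\<^sup>2 \<le> D" unfolding D_def
    by (intro mult_mono power_mono lo s1) (use pos r in auto)
  then have D1: "D \<ge> r\<^sup>2 * (1 - r)\<^sup>2" by (simp add: power2_eq_square algebra_simps)
  have "r\<^sup>2 * (1/2)\<^sup>2 \<le> r\<^sup>2 * (1 - r)\<^sup>2" by (intro mult_left_mono power_mono) (use r in auto)
  then have D4: "D \<ge> r\<^sup>2 / 4" using D1 by (simp add: power2_eq_square)
  show D0: "D > 0" using D4 r by (smt (verit) zero_less_power divide_pos_pos)
  have "D \<le> (1 + r) * r\<^sup>2" unfolding D_def
    by (intro mult_mono power_mono s2 up) (use lo pos r in \<open>auto intro: order_trans[OF _ lo]\<close>)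
  moreover have "r\<^sup>2 * (1 - 2 * r) \<le> D"
  proof -
    have "1 - 2 * r \<le> (1 - r)\<^sup>2" by (simp add: power2_eq_square algebra_simps)
    then show ?thesis using D1 mult_left_mono[of "1 - 2*r" "(1 - r)\<^sup>2" "r\<^sup>2"] by simp
  qed
  moreover have "r * r\<^sup>2 \<ge> 0" using r by simp
  ultimately have "\<bar>r\<^sup>2 - D\<bar> \<le> 2 * r * r\<^sup>2" unfolding abs_le_iff by (simp add: algebra_simps)
  moreover have "\<bar>1 / D - 1 / r\<^sup>2\<bar> = \<bar>r\<^sup>2 - D\<bar> / (D * r\<^sup>2)"
    using D0 r by (simp add: diff_frac_eq abs_mult)
  ultimately have "\<bar>1 / D - 1 / r\<^sup>2\<bar> \<le> (2 * r * r\<^sup>2) / ((r\<^sup>2 / 4) * r\<^sup>2)"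
    using D4 r by (simp only:) (intro frac_le mult_right_mono mult_pos_pos, auto)
  also have "\<dots> = 8 / r" using r by (simp add: power2_eq_square field_simps)
  finally show "\<bar>1 / D - 1 / r\<^sup>2\<bar> \<le> 8 / r" .
qed

text \<open>The error 16 / h comes from replacing the weight, with 1 - cos at most 2, and \<tau> / m
  from replacing ln (1 + r) by r inside the cosine.\<close>

lemma kernel_term_approx:
  assumes h: "h \<ge> 1" "2 * h \<le> m" and \<tau>: "\<tau> \<ge> 0"
  shows "\<bar>(1 - cos (\<tau> * log_gap m (m + h))) / (sqrt (real m * real (m + h)) * (log_gap m (m + h))\<^sup>2)
           - m * ((1 - cos (h * (\<tau> / m))) / (real h)\<^sup>2)\<bar> \<le> 16 / h + \<tau> / m"
proof -
  define r where "r = real h / real m"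
  have m0: "real m > 0" using h by auto
  have r: "0 < r" "r \<le> 1/2" using h m0 by (auto simp: r_def field_simps)
  define D where "D = sqrt (1 + r) * (ln (1 + r))\<^sup>2"
  have D: "D > 0" "\<bar>1 / D - 1 / r\<^sup>2\<bar> \<le> 8 / r"
    using sqrt_ln_weight_approx[OF r] by (auto simp: D_def)
  have mh: "real (m + h) = m * (1 + r)" using m0 by (simp add: r_def field_simps)
  have l: "log_gap m (m + h) = ln (1 + r)"
    unfolding log_gap_def mh using m0 r by (simp add: ln_mult)
  have "sqrt (real m * real (m + h)) = sqrt ((real m * real m) * (1 + r))"
    unfolding mh by (simp add: mult_ac)
  also have "\<dots> = m * sqrt (1 + r)" by (simp add: real_sqrt_mult)
  finally have s: "sqrt (real m * real (m + h)) = m * sqrt (1 + r)" .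
  define A where "A = 1 - cos (\<tau> * ln (1 + r))"
  define B where "B = 1 - cos (\<tau> * r)"
  have 1: "(1 - cos (\<tau> * log_gap m (m + h))) / (sqrt (real m * real (m + h)) * (log_gap m (m + h))\<^sup>2) = (A * (1 / D)) / m"
    unfolding l s A_def D_def by (simp add: mult_ac)
  have 2: "m * ((1 - cos (h * (\<tau> / m))) / (real h)\<^sup>2) = (B * (1 / r\<^sup>2)) / m"
  proof -
    have "h * (\<tau> / m) = \<tau> * r" by (simp add: r_def)
    then have "m * ((1 - cos (h * (\<tau> / m))) / (real h)\<^sup>2) = m * (B / (real h)\<^sup>2)" by (simp add: B_def)
    also have "\<dots> = (B * (1 / r\<^sup>2)) / m"
      using m0 h by (simp add: r_def power_divide power2_eq_square)
    finally show ?thesis .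
  qed
  have A2: "\<bar>A\<bar> \<le> 2" unfolding A_def
    using cos_ge_minus_one[of "\<tau> * ln (1 + r)"] cos_le_one[of "\<tau> * ln (1 + r)"] by (simp add: abs_le_iff)
  have "\<bar>A - B\<bar> \<le> \<bar>\<tau> * r - \<tau> * ln (1 + r)\<bar>"
    using abs_cos_diff_le[of "\<tau> * r" "\<tau> * ln (1 + r)"] by (simp add: A_def B_def)
  also have "\<dots> = \<tau> * \<bar>ln (1 + r) - r\<bar>"
    using \<tau> by (simp add: abs_mult abs_minus_commute flip: right_diff_distrib)
  also have "\<dots> \<le> \<tau> * r\<^sup>2"
    using \<tau> abs_ln_one_plus_x_minus_x_bound_nonneg[of r] r by (intro mult_left_mono) auto
  finally have AB: "\<bar>A - B\<bar> \<le> \<tau> * r\<^sup>2" .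
  have "A * (1 / D) - B * (1 / r\<^sup>2) = A * (1 / D - 1 / r\<^sup>2) + (A - B) * (1 / r\<^sup>2)"
    by (simp only: left_diff_distrib right_diff_distrib)
  then have "\<bar>A * (1 / D) - B * (1 / r\<^sup>2)\<bar> \<le> \<bar>A\<bar> * \<bar>1 / D - 1 / r\<^sup>2\<bar> + \<bar>A - B\<bar> * (1 / r\<^sup>2)"
    using abs_triangle_ineq[of "A * (1 / D - 1 / r\<^sup>2)" "(A - B) * (1 / r\<^sup>2)"] by (simp add: abs_mult)
  also have "\<dots> \<le> 2 * (8 / r) + (\<tau> * r\<^sup>2) * (1 / r\<^sup>2)"
    using r \<tau> by (intro add_mono mult_mono A2 D AB) auto
  also have "\<dots> = 16 / r + \<tau>" using r by simp
  finally have "\<bar>A * (1 / D) - B * (1 / r\<^sup>2)\<bar> / m \<le> (16 / r + \<tau>) / m"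
    using m0 by (intro divide_right_mono) auto
  also have "(16 / r + \<tau>) / m = 16 / h + \<tau> / m"
    using m0 h by (simp add: r_def field_simps)
  finally show ?thesis unfolding 1 2 using m0
    by (simp only: diff_divide_distrib[symmetric] abs_divide abs_of_pos)
qed

lemma kernel_term_upper:
  assumes "m \<ge> 1" "h \<ge> 1"
  shows "(1 - cos (\<tau> * log_gap m (m + h))) / (sqrt (real m * real (m + h)) * (log_gap m (m + h))\<^sup>2)
     \<le> 2 * (real (m + h))\<^sup>2 / real m * (1 / (real h)\<^sup>2)"
proof -
  define n where "n = m + h"
  have l: "log_gap m n \<ge> real h / real n"
  proof -
    have "ln (real m / real n) \<le> real m / real n - 1"
      by (rule ln_le_minus_one) (use assms n_def in auto)
    then show ?thesis using assms n_def by (simp add: log_gap_def ln_div field_simps)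
  qed
  have s: "sqrt (real m * real n) \<ge> real m"
    using assms by (intro real_le_rsqrt) (auto simp: n_def power2_eq_square)
  have hn: "real h / real n > 0" using assms by (simp add: n_def)
  have "(1 - cos (\<tau> * log_gap m n)) / (sqrt (real m * real n) * (log_gap m n)\<^sup>2)
     \<le> 2 / (real m * (real h / real n)\<^sup>2)"
  proof (rule frac_le)
    show "1 - cos (\<tau> * log_gap m n) \<le> 2" using cos_ge_minus_one[of "\<tau> * log_gap m n"] by linarith
    show "real m * (real h / real n)\<^sup>2 \<le> sqrt (real m * real n) * (log_gap m n)\<^sup>2"
      using l s hn by (intro mult_mono power_mono) auto
    show "0 < real m * (real h / real n)\<^sup>2" using assms hn by (intro mult_pos_pos zero_less_power) auto
  qed auto
  also have "\<dots> = 2 * (real n)\<^sup>2 / real m * (1 / (real h)\<^sup>2)"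
    using assms by (simp add: power_divide)
  finally show ?thesis by (simp add: n_def)
qed

text \<open>Three losses occur. For h \<le> H each term is replaced by a kernel term, where 2 H
  \<le> P keeps h / m at most 1/2. The tail h > H is bounded through the sum of 1 / h^2. Finally,
  for the at most H indices m with m + H \<ge> N, some kernel terms have m + h \<ge> N and no
  counterpart in the double sum; they cost at most 4 N for each such m.\<close>

lemma msq2_off_discrete:
  assumes H: "1 \<le> H" "2 * H \<le> P" and P: "P \<le> N" and \<tau>: "\<tau> \<ge> 0"
  shows "\<bar>msq2_off P N \<tau> - (\<Sum>m=P..<N. real m * pkern_part H (\<tau> / real m))\<bar>
     \<le> real N * (H * (16 + \<tau> / P) + 2 * (real N)\<^sup>2 / (real P * H)) + 4 * real H * real N"
proof -
  define f where "f = (\<lambda>m h. (1 - cos (\<tau> * log_gap m (m + h))) / (sqrt (real m * real (m + h)) * (log_gap m (m + h))\<^sup>2))"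
  define f0 where "f0 = (\<lambda>m h. real m * ((1 - cos (real h * (\<tau> / m))) / (real h)\<^sup>2))"
  define C where "C = real H * (16 + \<tau> / P) + 2 * (real N)\<^sup>2 / (real P * H)"
  have P1: "P \<ge> 1" using H by auto
  have fpos: "f m h \<ge> 0" for m h
    unfolding f_def by (intro divide_nonneg_nonneg mult_nonneg_nonneg) auto
  have f0pos: "f0 m h \<ge> 0" for m h unfolding f0_def by simp
  have near: "\<bar>f m h - f0 m h\<bar> \<le> 16 + \<tau> / P" if "m \<ge> P" "1 \<le> h" "h \<le> H" for m h
  proof -
    have "\<bar>f m h - f0 m h\<bar> \<le> 16 / h + \<tau> / m"
      unfolding f_def f0_def by (rule kernel_term_approx) (use that H \<tau> in auto)
    also have "\<dots> \<le> 16 / 1 + \<tau> / P"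
      by (intro add_mono divide_left_mono) (use that P1 \<tau> in auto)
    finally show ?thesis by simp
  qed
  have per_m: "\<bar>(\<Sum>n=Suc m..<N. f m (n - m)) - m * pkern_part H (\<tau> / m)\<bar> \<le> C + (if N \<le> m + H then 4 * real N else 0)"
    if m: "P \<le> m" "m < N" for m
  proof -
    have "(\<Sum>n=Suc m..<N. f m (n - m)) = (\<Sum>h\<in>(\<lambda>n. n - m) ` {Suc m..<N}. f m h)"
      by (subst sum.reindex) (auto simp: inj_on_def)
    also have "(\<lambda>n. n - m) ` {Suc m..<N} = {1..<N - m}"
    proof (intro equalityI subsetI)
      fix h assume "h \<in> {1..<N - m}"
      then have "h = (h + m) - m" "h + m \<in> {Suc m..<N}" by auto
      then show "h \<in> (\<lambda>n. n - m) ` {Suc m..<N}" by blast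
    qed auto
    finally have i: "(\<Sum>n=Suc m..<N. f m (n - m)) = (\<Sum>h=1..<N - m. f m h)" .
    have p: "m * pkern_part H (\<tau> / m) = (\<Sum>h=1..H. f0 m h)"
      by (simp add: pkern_part_def f0_def sum_distrib_left)
    have diff: "\<bar>(\<Sum>h\<in>X. f m h) - (\<Sum>h\<in>X. f0 m h)\<bar> \<le> H * (16 + \<tau> / P)" if "X \<subseteq> {1..H}" for X
    proof -
      have "\<bar>(\<Sum>h\<in>X. f m h) - (\<Sum>h\<in>X. f0 m h)\<bar> \<le> (\<Sum>h\<in>X. \<bar>f m h - f0 m h\<bar>)"
        by (simp add: sum_subtractf[symmetric] sum_abs)
      also have "\<dots> \<le> (\<Sum>h=1..H. 16 + \<tau> / P)"
        by (intro order_trans[OF sum_mono sum_mono2] near) (use that m \<tau> in auto)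
      finally show ?thesis by simp
    qed
    have c2: "2 * (real N)\<^sup>2 / (real P * H) \<ge> 0" by simp
    show ?thesis
    proof (cases "N \<le> m + H")
      case True
      define X where "X = {1..<N - m}"
      have X: "X \<subseteq> {1..H}" using True by (auto simp: X_def)
      have "(\<Sum>h=1..H. f0 m h) = (\<Sum>h\<in>X. f0 m h) + (\<Sum>h\<in>{1..H} - X. f0 m h)"
        using X by (simp add: sum.subset_diff)
      moreover have "(\<Sum>h\<in>{1..H} - X. f0 m h) \<le> (\<Sum>h=1..H. f0 m h)"
        by (intro sum_mono2 f0pos) auto
      moreover have "(\<Sum>h=1..H. f0 m h) \<le> real m * 4"
        unfolding p[symmetric] by (intro mult_left_mono pkern_part_bounds) auto
      moreover have "(\<Sum>h\<in>{1..H} - X. f0 m h) \<ge> 0" by (intro sum_nonneg f0pos)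
      moreover have "real m * 4 \<le> 4 * real N" using m by simp
      ultimately show ?thesis
        using diff[OF X] c2 unfolding i p X_def[symmetric] C_def if_P[OF True] by linarith
    next
      case False
      have "(\<Sum>h=1..<N - m. f m h) = (\<Sum>h\<in>{1..H}. f m h) + (\<Sum>h\<in>{1..<N - m} - {1..H}. f m h)"
      proof -
        have "{1..H} \<subseteq> {1..<N - m}" using False by auto
        from sum.subset_diff[OF this, of "f m"] show ?thesis by (simp only: finite_atLeastLessThan add.commute)
      qed
      moreover have "(\<Sum>h\<in>{1..<N - m} - {1..H}. f m h) \<ge> 0" by (intro sum_nonneg fpos)
      moreover have "(\<Sum>h\<in>{1..<N - m} - {1..H}. f m h) \<le> 2 * (real N)\<^sup>2 / (real P * H)"
      proof -
        have "(\<Sum>h\<in>{1..<N - m} - {1..H}. f m h) \<le> (\<Sum>h=Suc H..N. 2 * (real N)\<^sup>2 / real P * (1 / (real h)\<^sup>2))"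
        proof (rule order_trans[OF sum_mono sum_mono2])
          fix h assume h: "h \<in> {1..<N - m} - {1..H}"
          have "f m h \<le> 2 * (real (m + h))\<^sup>2 / real m * (1 / (real h)\<^sup>2)"
            unfolding f_def by (rule kernel_term_upper) (use h m P1 in auto)
          also have "\<dots> \<le> 2 * (real N)\<^sup>2 / real P * (1 / (real h)\<^sup>2)"
            by (intro mult_right_mono frac_le mult_left_mono power_mono) (use h m P1 in auto)
          finally show "f m h \<le> 2 * (real N)\<^sup>2 / real P * (1 / (real h)\<^sup>2)" .
        qed auto
        also have "\<dots> = 2 * (real N)\<^sup>2 / real P * (\<Sum>h=Suc H..N. 1 / (real h)\<^sup>2)"
          by (simp add: sum_distrib_left)
        also have "\<dots> \<le> 2 * (real N)\<^sup>2 / real P * (1 / H - 1 / N)"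
          by (intro mult_left_mono sum_inverse_squares_tail) (use H P in auto)
        also have "\<dots> \<le> 2 * (real N)\<^sup>2 / real P * (1 / H)"
          by (intro mult_left_mono) auto
        finally show ?thesis by simp
      qed
      ultimately show ?thesis
        using diff[OF order_refl] unfolding i p C_def if_not_P[OF False] by linarith
    qed
  qed
  have "msq2_off P N \<tau> = (\<Sum>m=P..<N. \<Sum>n=Suc m..<N. f m (n - m))"
    unfolding msq2_off_def upper_sum_def f_def by (intro sum.cong refl) auto
  then have "\<bar>msq2_off P N \<tau> - (\<Sum>m=P..<N. real m * pkern_part H (\<tau> / real m))\<bar>
     \<le> (\<Sum>m=P..<N. \<bar>(\<Sum>n=Suc m..<N. f m (n - m)) - m * pkern_part H (\<tau> / m)\<bar>)"
    by (simp add: sum_subtractf[symmetric] sum_abs)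
  also have "\<dots> \<le> (\<Sum>m=P..<N. C + (if N \<le> m + H then 4 * real N else 0))"
    by (intro sum_mono per_m) auto
  also have "\<dots> = real (N - P) * C + (\<Sum>m\<in>{m\<in>{P..<N}. N \<le> m + H}. 4 * real N)"
    by (simp add: sum.distrib sum.inter_filter[symmetric])
  also have "\<dots> \<le> real N * C + (\<Sum>m\<in>{N - H..<N}. 4 * real N)"
  proof (intro add_mono mult_right_mono sum_mono2)
    show "C \<ge> 0" unfolding C_def using \<tau> by simp
  qed auto
  also have "\<dots> = real N * C + 4 * real H * real N"
  proof -
    have "N - (N - H) = H" using H P by auto
    then show ?thesis by simp
  qed
  finally show ?thesis unfolding C_def .
qed

section \<open>From the sum over indices to the kernel integral\<close>

lemma sum_minus_integral_lipschitz:
  fixes f :: "real \<Rightarrow> real"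
  assumes cont: "continuous_on {real P..} f"
    and lip: "\<And>x y. real P \<le> x \<Longrightarrow> x \<le> y \<Longrightarrow> \<bar>f x - f y\<bar> \<le> L * (y - x)"
    and PN: "P \<le> N"
  shows "\<bar>(\<Sum>m=P..<N. f (real m)) - integral {real P..real N} f\<bar> \<le> L * (real N - real P)"
  using PN
proof (induction N rule: dec_induct)
  case base then show ?case by simp
next
  case (step n)
  have int: "f integrable_on {a..b}" if "real P \<le> a" for a b
    by (intro integrable_continuous_interval continuous_on_subset[OF cont]) (use that in auto)
  have L0: "L \<ge> 0"
    using order_trans[OF abs_ge_zero lip[of "real P" "real P + 1"]] by simp
  have "integral {real P..real (Suc n)} f = integral {real P..real n} f + integral {real n..real (Suc n)} f"
    using step(1) by (intro Henstock_Kurzweil_Integration.integral_combine[symmetric] int) auto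
  moreover have "\<bar>f (real n) - integral {real n..real (Suc n)} f\<bar> \<le> L"
  proof -
    have "norm (integral {real n..real (Suc n)} (\<lambda>x. f (real n) - f x)) \<le> L * (real (Suc n) - real n)"
    proof (rule integral_bound)
      show "continuous_on {real n..real (Suc n)} (\<lambda>x. f (real n) - f x)"
        by (intro continuous_intros continuous_on_subset[OF cont]) (use step(1) in auto)
      fix x assume x: "x \<in> {real n..real (Suc n)}"
      have "\<bar>f (real n) - f x\<bar> \<le> L * (x - real n)" using x step(1) by (intro lip) auto
      also have "\<dots> \<le> L * 1" using x L0 by (intro mult_left_mono) auto
      finally show "norm (f (real n) - f x) \<le> L" by simp
    qed auto
    moreover have "integral {real n..real (Suc n)} (\<lambda>x. f (real n) - f x) = f (real n) - integral {real n..real (Suc n)} f"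
      using int[of "real n" "real (Suc n)"] step(1) by (subst integral_diff) auto
    ultimately show ?thesis by simp
  qed
  moreover have "(\<Sum>m=P..<Suc n. f (real m)) = (\<Sum>m=P..<n. f (real m)) + f (real n)"
    using step(1) by simp
  moreover have "L * (real (Suc n) - real P) = L * (real n - real P) + L" by (simp add: algebra_simps)
  ultimately show ?case using step.IH by linarith
qed

lemma scaled_pkern_part_deriv:
  assumes "y > 0"
  shows "((\<lambda>y. y * pkern_part H (\<tau> / y)) has_real_derivative
     (\<Sum>h=1..H. (1 - cos (real h * (\<tau> / y))) / (real h)\<^sup>2 - \<tau> / (real h * y) * sin (real h * (\<tau> / y)))) (at y within S)"
proof -
  have "((\<lambda>y. y * ((1 - cos (real h * (\<tau> / y))) / (real h)\<^sup>2)) has_real_derivative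
     (1 - cos (real h * (\<tau> / y))) / (real h)\<^sup>2 - \<tau> / (real h * y) * sin (real h * (\<tau> / y))) (at y within S)"
    if "h \<in> {1..H}" for h
    using that assms
    by (auto intro!: derivative_eq_intros simp: power2_eq_square field_simps)
  then show ?thesis
    unfolding pkern_part_def sum_distrib_left by (intro DERIV_sum) auto
qed

text \<open>The Riemann sum is compared with its integral while the kernel is still truncated: a
  finite sum can be differentiated termwise, and each of its H terms has derivative at most 2 +
  \<tau> / P. The passage to the full kernel happens later, under the integral sign.\<close>

lemma scaled_pkern_part_lipschitz:
  assumes P: "P > 0" and \<tau>: "\<tau> \<ge> 0" and xy: "P \<le> x" "x \<le> y"
  shows "\<bar>x * pkern_part H (\<tau> / x) - y * pkern_part H (\<tau> / y)\<bar> \<le> H * (2 + \<tau> / P) * (y - x)"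
proof (cases "x = y")
  case False
  define D where "D = (\<lambda>y. \<Sum>h=1..H. (1 - cos (real h * (\<tau> / y))) / (real h)\<^sup>2 - \<tau> / (real h * y) * sin (real h * (\<tau> / y)))"
  obtain z where z: "x < z" "z < y"
    "y * pkern_part H (\<tau> / y) - x * pkern_part H (\<tau> / x) = (y - x) * D z"
    using MVT2[of x y "\<lambda>y. y * pkern_part H (\<tau> / y)" D] scaled_pkern_part_deriv[of _ H \<tau> UNIV] xy P False
    unfolding D_def by force
  have "\<bar>D z\<bar> \<le> (\<Sum>h=1..H. 2 + \<tau> / P)"
    unfolding D_def
  proof (intro order_trans[OF sum_abs] sum_mono)
    fix h assume h: "h \<in> {1..H}"
    have h1: "real h \<ge> 1" using h by simp
    have "\<bar>(1 - cos (real h * (\<tau> / z))) / (real h)\<^sup>2\<bar> \<le> 2 / 1"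
      unfolding abs_divide
      using cos_ge_minus_one[of "real h * (\<tau> / z)"] cos_le_one[of "real h * (\<tau> / z)"] h1
      by (intro frac_le) (auto simp: abs_le_iff one_le_power)
    moreover have "\<bar>\<tau> / (real h * z) * sin (real h * (\<tau> / z))\<bar> \<le> \<tau> / P * 1"
      unfolding abs_mult
    proof (intro mult_mono)
      have "1 * P \<le> real h * z" using h1 z xy P by (intro mult_mono) auto
      then show "\<bar>\<tau> / (real h * z)\<bar> \<le> \<tau> / P" using \<tau> P by (simp add: abs_divide divide_left_mono frac_le)
    qed (use \<tau> P in auto)
    ultimately show "\<bar>(1 - cos (real h * (\<tau> / z))) / (real h)\<^sup>2 - \<tau> / (real h * z) * sin (real h * (\<tau> / z))\<bar> \<le> 2 + \<tau> / P"
      by linarith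
  qed
  then have "(y - x) * \<bar>D z\<bar> \<le> (y - x) * (H * (2 + \<tau> / P))"
    using xy by (intro mult_left_mono) auto
  moreover have "\<bar>x * pkern_part H (\<tau> / x) - y * pkern_part H (\<tau> / y)\<bar> = (y - x) * \<bar>D z\<bar>"
    using z xy by (subst abs_minus_commute) (simp add: abs_mult)
  ultimately show ?thesis by (simp add: mult_ac)
qed simp

text \<open>The summand 4 P^2 accounts for [0, P], which the sum omits and where the integrand is at
  most 4 P. The last one is the truncation error 2 / H of the kernel, times a factor at most N, over
  a range of length at most N.\<close>

lemma msq2_off_approx:
  assumes H: "1 \<le> H" "2 * H \<le> P" and P: "P \<le> N" and \<tau>: "\<tau> > 0"
  shows "\<bar>msq2_off P N \<tau> - \<tau>\<^sup>2 * jkern (N / \<tau>)\<bar>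
     \<le> (real N * (H * (16 + \<tau> / P) + 2 * (real N)\<^sup>2 / (real P * H)) + 4 * real H * real N)
       + H * (2 + \<tau> / P) * real N + 4 * (real P)\<^sup>2 + 2 * (real N)\<^sup>2 / H"
proof -
  define f where "f = (\<lambda>y. y * pkern_part H (\<tau> / y))"
  define g where "g = (\<lambda>y. y * pkern (\<tau> / y))"
  have P1: "real P \<ge> 1" "real H \<ge> 1" using H by auto
  have contf: "continuous_on {real P..} f"
    unfolding f_def
    by (rule DERIV_continuous_on, rule scaled_pkern_part_deriv) (use P1 in auto)
  have contg: "continuous_on {0..} g" unfolding g_def by (rule continuous_on_scaled_pkern)
  have intg: "g integrable_on {a..b}" if "0 \<le> a" for a b
    by (intro integrable_continuous_interval continuous_on_subset[OF contg]) (use that in auto)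
  have intf: "f integrable_on {real P..b}" for b
    by (intro integrable_continuous_interval continuous_on_subset[OF contf]) auto
  have 1: "\<bar>(\<Sum>m=P..<N. real m * pkern_part H (\<tau> / real m)) - integral {real P..real N} f\<bar>
      \<le> H * (2 + \<tau> / P) * (real N - real P)"
    using sum_minus_integral_lipschitz[OF contf _ P, of "H * (2 + \<tau> / P)"]
      scaled_pkern_part_lipschitz[of "real P" \<tau>] P1 \<tau> by (simp add: f_def)
  also have "\<dots> \<le> H * (2 + \<tau> / P) * real N" using \<tau> by (intro mult_left_mono) auto
  finally have 1: "\<bar>(\<Sum>m=P..<N. real m * pkern_part H (\<tau> / real m)) - integral {real P..real N} f\<bar>
      \<le> H * (2 + \<tau> / P) * real N" .
  have "\<bar>integral {real P..real N} f - integral {real P..real N} g\<bar> \<le> 2 * (real N)\<^sup>2 / H"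
  proof -
    have "norm (integral {real P..real N} (\<lambda>y. f y - g y)) \<le> (2 * real N / H) * (real N - real P)"
    proof (rule integral_bound)
      show "continuous_on {real P..real N} (\<lambda>y. f y - g y)"
        by (intro continuous_intros continuous_on_subset[OF contf] continuous_on_subset[OF contg]) auto
      fix y assume y: "y \<in> {real P..real N}"
      have "\<bar>f y - g y\<bar> = y * \<bar>pkern_part H (\<tau> / y) - pkern (\<tau> / y)\<bar>"
        using y P1 by (simp add: f_def g_def abs_mult flip: right_diff_distrib)
      also have "\<dots> \<le> real N * (2 / H)"
        using y P1 H by (intro mult_mono pkern_approx) auto
      finally show "norm (f y - g y) \<le> 2 * real N / H" by (simp add: mult.commute)
    qed (use P in auto)
    also have "\<dots> \<le> (2 * real N / H) * real N" by (intro mult_left_mono) auto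
    finally show ?thesis using intf intg by (simp add: integral_diff power2_eq_square)
  qed
  moreover have "\<bar>integral {0..real P} g\<bar> \<le> 4 * (real P)\<^sup>2"
  proof -
    have "norm (integral {0..real P} g) \<le> (4 * real P) * (real P - 0)"
    proof (rule integral_bound)
      show "continuous_on {0..real P} g" by (rule continuous_on_subset[OF contg]) auto
      fix y assume y: "y \<in> {0..real P}"
      have "\<bar>g y\<bar> = y * pkern (\<tau> / y)" using y pkern_bounds(1) by (simp add: g_def abs_mult)
      also have "\<dots> \<le> real P * 4" using y by (intro mult_mono pkern_bounds) auto
      finally show "norm (g y) \<le> 4 * real P" by simp
    qed auto
    then show ?thesis by (simp add: power2_eq_square)
  qed
  moreover have "\<tau>\<^sup>2 * jkern (N / \<tau>) = integral {0..real P} g + integral {real P..real N} g"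
  proof -
    have "\<tau>\<^sup>2 * jkern (N / \<tau>) = integral {0..real N} g"
      using scaled_pkern_has_integral[OF \<tau>, of "real N"] by (simp add: g_def integral_unique)
    also have "\<dots> = integral {0..real P} g + integral {real P..real N} g"
      using P by (intro Henstock_Kurzweil_Integration.integral_combine[symmetric] intg) auto
    finally show ?thesis .
  qed
  ultimately show ?thesis using 1 msq2_off_discrete[OF H P less_imp_le[OF \<tau>]] by linarith
qed

lemma sum_inverse_interval_le:
  assumes "1 \<le> P" "P \<le> N"
  shows "(\<Sum>n=P..<N. 1 / real n) \<le> 1 + ln (N / P)"
proof (cases "N = P")
  case True then show ?thesis using assms by simp
next
  case False
  have s: "(\<Sum>n=P..<Suc k. 1 / real n) \<le> 1 / P + ln (k / P)" if "P \<le> k" for k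
    using that
  proof (induction k rule: dec_induct)
    case base then show ?case using assms by simp
  next
    case (step k)
    have "ln (real k / real (Suc k)) \<le> real k / real (Suc k) - 1"
      by (rule ln_le_minus_one) (use step assms in auto)
    then have "1 / real (Suc k) \<le> ln (Suc k / P) - ln (k / P)"
      using step(1) assms by (simp add: ln_div field_simps)
    moreover have "(\<Sum>n=P..<Suc (Suc k). 1 / real n) = (\<Sum>n=P..<Suc k. 1 / real n) + 1 / real (Suc k)"
      using step(1) by simp
    ultimately show ?case using step.IH by linarith
  qed
  obtain k where k: "N = Suc k" "P \<le> k" using False assms by (cases N) auto
  have "1 / real P \<le> 1" using assms by simp
  moreover have "ln (real k / P) \<le> ln (real (Suc k) / P)"
    using k assms by (simp add: divide_right_mono)
  ultimately show ?thesis using s[OF k(2)] unfolding k(1) by linarith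
qed

text \<open>The factor that remains when \<tau>^2 jkern (c / \<tau>) is differentiated in \<tau>. In
  the limit 2 \<tau> vkern (N / \<tau>) is therefore the off-diagonal part of the mean square after
  one integration.\<close>

definition vkern :: "real \<Rightarrow> real" where
  "vkern c = 2 * jkern c - c\<^sup>2 * pkern (1 / c)"

lemma scaled_jkern_deriv:
  assumes "\<tau> > 0" "c > 0"
  shows "((\<lambda>\<tau>. \<tau>\<^sup>2 * jkern (c / \<tau>)) has_real_derivative \<tau> * vkern (c / \<tau>)) (at \<tau>)"
proof -
  have "((\<lambda>\<tau>. jkern (c / \<tau>)) has_real_derivative (c / \<tau> * pkern (1 / (c / \<tau>))) * (- c / \<tau>\<^sup>2)) (at \<tau>)"
    by (rule DERIV_chain2[OF jkern_deriv]) (use assms in \<open>auto intro!: derivative_eq_intros simp: power2_eq_square\<close>)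
  moreover have "((\<lambda>\<tau>. \<tau>\<^sup>2) has_real_derivative 2 * \<tau>) (at \<tau>)"
    by (auto intro!: derivative_eq_intros)
  ultimately have "((\<lambda>\<tau>. \<tau>\<^sup>2 * jkern (c / \<tau>)) has_real_derivative
      2 * \<tau> * jkern (c / \<tau>) + (c / \<tau> * pkern (1 / (c / \<tau>))) * (- c / \<tau>\<^sup>2) * \<tau>\<^sup>2) (at \<tau>)"
    by (intro DERIV_mult)
  then show ?thesis
    by (rule DERIV_cong) (use assms in \<open>simp add: vkern_def power2_eq_square field_simps\<close>)
qed

lemma isCont_vkern:
  assumes "c > 0" shows "isCont vkern c"
  unfolding vkern_def using assms
  by (intro continuous_intros isCont_o2[OF _ isCont_pkern] DERIV_isCont[OF jkern_deriv]) auto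

subsection \<open>Asymptotics of the mean square\<close>

text \<open>\<open>cutN\<close> is the length of the partial sum of zeta; pairs with an index below \<open>cutP\<close> are estimated
  trivially, and of the remaining ones only those with index difference at most \<open>cutH\<close> matter.\<close>

definition cutN :: "real \<Rightarrow> nat" where "cutN T = nat \<lceil>8 * T\<rceil>"
definition cutP :: "real \<Rightarrow> nat" where "cutP T = nat \<lfloor>T / (ln T)\<^sup>2\<rfloor>"
definition cutH :: "real \<Rightarrow> nat" where "cutH T = nat \<lfloor>sqrt T\<rfloor>"

text \<open>The length 8T exceeds 1 + 2t for t \<le> 2T, as the approximation of zeta demands. The
  index T / ln^2 T is small enough for the discarded pairs to contribute o(T), yet leaves N / P of
  order ln^2 T. The choice sqrt T balances errors proportional to H against those proportional to 1
  / H.\<close>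

lemma cut_bounds:
  "\<forall>\<^sub>F T in at_top. 8 * T \<le> real (cutN T) \<and> real (cutN T) \<le> 8 * T + 1 \<and> real (cutN T) \<le> 9 * T \<and>
     T / (2 * (ln T)\<^sup>2) \<le> real (cutP T) \<and> real (cutP T) \<le> T / (ln T)\<^sup>2 \<and>
     sqrt T / 2 \<le> real (cutH T) \<and> real (cutH T) \<le> sqrt T \<and>
     1 \<le> cutH T \<and> 2 * cutH T \<le> cutP T \<and> cutP T \<le> cutN T"
proof -
  have "\<forall>\<^sub>F T::real in at_top. T / (ln T)\<^sup>2 - 1 \<ge> T / (2 * (ln T)\<^sup>2)" by real_asymp
  moreover have "\<forall>\<^sub>F T::real in at_top. sqrt T - 1 \<ge> sqrt T / 2" by real_asymp
  moreover have "\<forall>\<^sub>F T::real in at_top. T / (2 * (ln T)\<^sup>2) \<ge> 2 * sqrt T" by real_asymp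
  moreover have "\<forall>\<^sub>F T::real in at_top. T / (ln T)\<^sup>2 \<le> T" by real_asymp
  moreover have "\<forall>\<^sub>F T::real in at_top. T \<ge> 4" by (rule eventually_ge_at_top)
  ultimately show ?thesis
  proof eventually_elim
    case (elim T)
    have N: "8 * T \<le> real (cutN T)" "real (cutN T) \<le> 8 * T + 1"
      unfolding cutN_def using elim(5) by linarith+
    have P0: "T / (ln T)\<^sup>2 \<ge> 0" using elim(5) by simp
    have P: "real (cutP T) \<ge> T / (ln T)\<^sup>2 - 1" "real (cutP T) \<le> T / (ln T)\<^sup>2"
      unfolding cutP_def using P0 by linarith+
    have s: "sqrt T \<ge> 2" using elim(5) by (simp add: real_le_rsqrt)
    have H: "real (cutH T) \<ge> sqrt T - 1" "real (cutH T) \<le> sqrt T"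
      unfolding cutH_def using s by linarith+
    have "real 1 \<le> real (cutH T)" using H s by simp
    moreover have "real (2 * cutH T) \<le> real (cutP T)" using H P elim by simp
    moreover have "real (cutP T) \<le> real (cutN T)" using N P elim by linarith
    ultimately show ?case using N P H elim by (auto simp only: of_nat_le_iff intro!: conjI; linarith)
  qed
qed

text \<open>The error of \<open>msq2_off_approx\<close> with the three cuts inserted, divided by
  T^2; 6 ln^2 T is the bound for \<tau> / P when \<tau> \<le> 3T. It has to beat 1 / ln T because
  the difference quotients divide by the step T / ln T.\<close>

definition msq_err :: "real \<Rightarrow> real" where
  "msq_err T = (9 * T * (sqrt T * (16 + 6 * (ln T)\<^sup>2) + 2 * (9 * T)\<^sup>2 / (T / (2 * (ln T)\<^sup>2) * (sqrt T / 2)))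
      + 4 * sqrt T * (9 * T) + sqrt T * (2 + 6 * (ln T)\<^sup>2) * (9 * T)
      + 4 * (T / (ln T)\<^sup>2)\<^sup>2 + 2 * (9 * T)\<^sup>2 / (sqrt T / 2)) / T\<^sup>2"

lemma msq_err_tendsto: "((\<lambda>T. msq_err T * ln T) \<longlongrightarrow> 0) at_top"
  unfolding msq_err_def by real_asymp

lemma msq2_off_asymp:
  "\<forall>\<^sub>F T in at_top. \<forall>\<tau>. 0 < \<tau> \<and> \<tau> \<le> 3 * T \<longrightarrow>
     \<bar>msq2_off (cutP T) (cutN T) \<tau> - \<tau>\<^sup>2 * jkern (cutN T / \<tau>)\<bar> \<le> T\<^sup>2 * msq_err T"
  using cut_bounds eventually_gt_at_top[of 1]
proof eventually_elim
  case (elim T)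
  define N P H where "N = cutN T" and "P = cutP T" and "H = cutH T"
  have b: "8 * T \<le> real N" "real N \<le> 9 * T"
     "T / (2 * (ln T)\<^sup>2) \<le> real P" "real P \<le> T / (ln T)\<^sup>2"
     "sqrt T / 2 \<le> real H" "real H \<le> sqrt T"
     "1 \<le> H" "2 * H \<le> P" "P \<le> N" using elim unfolding N_def P_def H_def by auto
  have T: "T > 1" "ln T > 0" using elim by auto
  show ?case
  proof (intro allI impI)
    fix \<tau> assume \<tau>: "0 < \<tau> \<and> \<tau> \<le> 3 * T"
    have q: "\<tau> / P \<le> 6 * (ln T)\<^sup>2"
    proof -
      have "\<tau> / P \<le> 3 * T / (T / (2 * (ln T)\<^sup>2))"
        using \<tau> b T by (intro frac_le) auto
      also have "\<dots> = 6 * (ln T)\<^sup>2" using T by simp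
      finally show ?thesis .
    qed
    have q0: "\<tau> / P \<ge> 0" using \<tau> by simp
    have "\<bar>msq2_off P N \<tau> - \<tau>\<^sup>2 * jkern (N / \<tau>)\<bar>
     \<le> (real N * (H * (16 + \<tau> / P) + 2 * (real N)\<^sup>2 / (real P * H)) + 4 * real H * real N)
       + H * (2 + \<tau> / P) * real N + 4 * (real P)\<^sup>2 + 2 * (real N)\<^sup>2 / H"
      using msq2_off_approx[of H P N \<tau>] b \<tau> by blast
    also have "\<dots> \<le> (9 * T * (sqrt T * (16 + 6 * (ln T)\<^sup>2) + 2 * (9 * T)\<^sup>2 / (T / (2 * (ln T)\<^sup>2) * (sqrt T / 2)))
      + 4 * sqrt T * (9 * T)) + sqrt T * (2 + 6 * (ln T)\<^sup>2) * (9 * T)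
      + 4 * (T / (ln T)\<^sup>2)\<^sup>2 + 2 * (9 * T)\<^sup>2 / (sqrt T / 2)"
      by (intro add_mono mult_mono frac_le power_mono b q order_refl)
         (use T q0 in \<open>auto intro!: add_nonneg_nonneg mult_nonneg_nonneg divide_nonneg_nonneg\<close>)
    also have "\<dots> = T\<^sup>2 * msq_err T" using T by (simp add: msq_err_def)
    finally show "\<bar>msq2_off (cutP T) (cutN T) \<tau> - \<tau>\<^sup>2 * jkern (cutN T / \<tau>)\<bar> \<le> T\<^sup>2 * msq_err T"
      by (simp add: N_def P_def)
  qed
qed

definition diagL :: "real \<Rightarrow> real" where
  "diagL T = (\<Sum>n=cutP T..<cutN T. 1 / real n)"

text \<open>N / P is at most 18 ln^2 T, so the sum is O(ln ln T), and a step T / ln T in \<tau>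
  moves the diagonal part by o(T) only.\<close>

lemma diagL_over_ln: "((\<lambda>T. diagL T / ln T) \<longlongrightarrow> 0) at_top"
proof (rule tendsto_sandwich)
  show "\<forall>\<^sub>F T in at_top. 0 \<le> diagL T / ln T"
    using eventually_gt_at_top[of 1] by eventually_elim (simp add: diagL_def sum_nonneg)
  show "\<forall>\<^sub>F T in at_top. diagL T / ln T \<le> (1 + ln (18 * (ln T)\<^sup>2)) / ln T"
    using cut_bounds eventually_gt_at_top[of 1]
  proof eventually_elim
    case (elim T)
    have "diagL T \<le> 1 + ln (cutN T / cutP T)"
      unfolding diagL_def using elim by (intro sum_inverse_interval_le) auto
    also have "cutN T / cutP T \<le> 9 * T / (T / (2 * (ln T)\<^sup>2))"
      using elim by (intro frac_le) auto
    then have "ln (cutN T / cutP T) \<le> ln (18 * (ln T)\<^sup>2)"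
      using elim by (subst ln_le_cancel_iff) (auto simp: field_simps)
    finally show ?case using elim by (intro divide_right_mono) auto
  qed
  show "((\<lambda>T::real. (1 + ln (18 * (ln T)\<^sup>2)) / ln T) \<longlongrightarrow> 0) at_top" by real_asymp
qed simp

lemma cutN_over: "((\<lambda>T. cutN T / T) \<longlongrightarrow> 8) at_top"
proof (rule tendsto_sandwich)
  show "\<forall>\<^sub>F T in at_top. 8 \<le> cutN T / T"
    using cut_bounds eventually_gt_at_top[of 1] by eventually_elim (auto simp: field_simps)
  show "\<forall>\<^sub>F T in at_top. cutN T / T \<le> 8 + 1 / T"
    using cut_bounds eventually_gt_at_top[of 1] by eventually_elim (auto simp: field_simps)
  show "((\<lambda>T::real. 8 + 1 / T) \<longlongrightarrow> 8) at_top" by real_asymp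
qed simp

lemma tendsto_mean_point:
  assumes "((\<lambda>T. \<xi> T / T) \<longlongrightarrow> u) at_top" "u > 0"
  shows "((\<lambda>T. \<xi> T * vkern (cutN T / \<xi> T) / T) \<longlongrightarrow> u * vkern (8 / u)) at_top"
proof -
  have "((\<lambda>T. (cutN T / T) / (\<xi> T / T)) \<longlongrightarrow> 8 / u) at_top"
    using assms by (intro tendsto_divide cutN_over) auto
  moreover have "\<forall>\<^sub>F T in at_top. (cutN T / T) / (\<xi> T / T) = cutN T / \<xi> T"
    using eventually_gt_at_top[of 0] by eventually_elim auto
  ultimately have "((\<lambda>T. cutN T / \<xi> T) \<longlongrightarrow> 8 / u) at_top"
    by (rule Lim_transform_eventually)
  then have "((\<lambda>T. vkern (cutN T / \<xi> T)) \<longlongrightarrow> vkern (8 / u)) at_top"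
    using assms(2) by (intro isCont_tendsto_compose[OF isCont_vkern]) auto
  from tendsto_mult[OF assms(1) this] show ?thesis by simp
qed

text \<open>The double antiderivative \<open>msq2\<close> is convex, so its difference quotients with the small step
  \<open>T / ln T\<close> squeeze the single integral \<open>msq\<close>.\<close>

lemma msq_tendsto:
  assumes u: "0 < u" "u \<le> 2"
  shows "((\<lambda>T. msq (cutP T) (cutN T) (u * T) / T - u * diagL T) \<longlongrightarrow> 2 * (u * vkern (8 / u))) at_top"
proof -
  define D where "D = (\<lambda>T::real. T / ln T)"
  define m where "m = (\<lambda>T. msq (cutP T) (cutN T) (u * T))"
  \<comment> \<open>The first summand is the effect of evaluating the diagonal part at the midpoint
    of the step instead of at u T. The second collects the errors at the two endpoints, each doubled
    and divided by D T * T.\<close>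
  define e where "e = (\<lambda>T. diagL T / ln T / 2 + 4 * (msq_err T * ln T))"
  have e0: "(e \<longlongrightarrow> 0) at_top"
    unfolding e_def using tendsto_add[OF tendsto_divide[OF diagL_over_ln tendsto_const[of 2]]
        tendsto_mult[OF tendsto_const[of 4] msq_err_tendsto]] by simp
  have ev: "\<forall>\<^sub>F T in at_top. D T < u * T / 2 \<and> u * T + D T \<le> 3 * T"
  proof -
    have "\<forall>\<^sub>F T in at_top. D T < u * T / 2" unfolding D_def using u by real_asymp
    moreover have "\<forall>\<^sub>F T in at_top. D T \<le> T" unfolding D_def by real_asymp
    ultimately show ?thesis using eventually_gt_at_top[of 0]
    proof eventually_elim
      case (elim T)
      have "u * T \<le> 2 * T" using u elim by (intro mult_right_mono) auto
      then show ?case using elim by linarith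
    qed
  qed
  define W where "W = (\<lambda>T \<tau>. \<tau>\<^sup>2 * jkern (cutN T / \<tau>))"
  define W' where "W' = (\<lambda>T \<tau>. \<tau> * vkern (cutN T / \<tau>))"
  \<comment> \<open>The mean value theorem is applied to the smooth approximation W and not to
    \<open>msq2_off\<close>; the unknown point z thus enters only through W', which depends
    continuously on it.\<close>
  have main: "\<forall>\<^sub>F T in at_top. (\<forall>x y. 0 < x \<and> x < y \<and> y \<le> 3 * T \<and> y - x = D T \<longrightarrow>
      (\<exists>z. x < z \<and> z < y \<and>
        \<bar>(msq2 (cutP T) (cutN T) y - msq2 (cutP T) (cutN T) x) / (D T * T)
           - diagL T * ((x + y) / (2 * T)) - 2 * W' T z / T\<bar> \<le> 4 * (msq_err T * ln T)))"
    using msq2_off_asymp cut_bounds eventually_gt_at_top[of 1]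
  proof eventually_elim
    case (elim T)
    show ?case
    proof (intro allI impI)
      fix x y assume xy: "0 < x \<and> x < y \<and> y \<le> 3 * T \<and> y - x = D T"
      have T: "T > 1" "ln T > 0" "D T > 0" using elim by (auto simp: D_def)
      have dW: "(W T has_real_derivative W' T z) (at z)" if "z > 0" for z
        unfolding W_def W'_def by (rule scaled_jkern_deriv) (use that elim T in auto)
      obtain z where z: "x < z" "z < y" "W T y - W T x = (y - x) * W' T z"
        using MVT2[of x y "W T" "W' T"] dW xy by auto
      define oy ox where "oy = msq2_off (cutP T) (cutN T) y" and "ox = msq2_off (cutP T) (cutN T) x"
      have o: "\<bar>oy - W T y\<bar> \<le> T\<^sup>2 * msq_err T" "\<bar>ox - W T x\<bar> \<le> T\<^sup>2 * msq_err T"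
        using elim(1) xy by (auto simp: W_def oy_def ox_def)
      have sq: "y\<^sup>2 / 2 * diagL T - x\<^sup>2 / 2 * diagL T = D T * (diagL T * ((x + y) / 2))"
      proof -
        have "D T = y - x" using xy by simp
        then show ?thesis by (simp only:) (simp add: power2_eq_square field_simps)
      qed
      have id: "msq2 (cutP T) (cutN T) y - msq2 (cutP T) (cutN T) x
          = D T * (diagL T * ((x + y) / 2)) + D T * (2 * W' T z) + 2 * ((oy - W T y) - (ox - W T x))"
      proof -
        have "W T y - W T x = D T * W' T z" using z(3) xy by simp
        then have W: "W T y = W T x + D T * W' T z" by simp
        have "msq2 (cutP T) (cutN T) y - msq2 (cutP T) (cutN T) x
            = (y\<^sup>2 / 2 * diagL T - x\<^sup>2 / 2 * diagL T) + 2 * (oy - ox)"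
          unfolding msq2_def diagL_def[symmetric] oy_def[symmetric] ox_def[symmetric] by simp
        then show ?thesis unfolding sq W by (simp add: algebra_simps)
      qed
      have "(msq2 (cutP T) (cutN T) y - msq2 (cutP T) (cutN T) x) / (D T * T)
           - diagL T * ((x + y) / (2 * T)) - 2 * W' T z / T = 2 * ((oy - W T y) - (ox - W T x)) / (D T * T)"
        unfolding id using T by (simp add: field_simps)
      moreover have "\<bar>2 * ((oy - W T y) - (ox - W T x)) / (D T * T)\<bar> \<le> 4 * (T\<^sup>2 * msq_err T) / (D T * T)"
        unfolding abs_divide using o T by (intro frac_le) auto
      moreover have "4 * (T\<^sup>2 * msq_err T) / (D T * T) = 4 * (msq_err T * ln T)"
        using T by (simp add: D_def power2_eq_square)
      ultimately show "\<exists>z. x < z \<and> z < y \<and>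
        \<bar>(msq2 (cutP T) (cutN T) y - msq2 (cutP T) (cutN T) x) / (D T * T)
           - diagL T * ((x + y) / (2 * T)) - 2 * W' T z / T\<bar> \<le> 4 * (msq_err T * ln T)"
        using z by auto
    qed
  qed
  have DT: "((\<lambda>T. u - D T / T) \<longlongrightarrow> u) at_top" "((\<lambda>T. u + D T / T) \<longlongrightarrow> u) at_top"
    unfolding D_def by real_asymp+
  have aux1: "M - A \<le> Z + (B + E)" if "\<bar>X - Y - Z\<bar> \<le> E" "M \<le> X" "Y = A + B" for X Y Z E M A B :: real
    using that by linarith
  have aux2: "Z - (B + E) \<le> M - A" if "\<bar>X - Y - Z\<bar> \<le> E" "X \<le> M" "Y = A - B" for X Y Z E M A B :: real
    using that by linarith
  have up: "\<forall>\<^sub>F T in at_top. \<exists>z. u * T < z \<and> z < u * T + D T \<and> m T / T - u * diagL T \<le> 2 * W' T z / T + e T"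
    using main ev cut_bounds eventually_gt_at_top[of 1]
  proof eventually_elim
    case (elim T)
    have T: "T > 1" "ln T > 0" "D T > 0" using elim by (auto simp: D_def)
    have uT: "u * T > 0" using u T by simp
    obtain z where z: "u * T < z" "z < u * T + D T"
      "\<bar>(msq2 (cutP T) (cutN T) (u * T + D T) - msq2 (cutP T) (cutN T) (u * T)) / (D T * T)
           - diagL T * ((u * T + (u * T + D T)) / (2 * T)) - 2 * W' T z / T\<bar> \<le> 4 * (msq_err T * ln T)"
      using elim(1)[rule_format, of "u * T" "u * T + D T"] uT T elim(2) by auto
    have "D T * m T \<le> msq2 (cutP T) (cutN T) (u * T + D T) - msq2 (cutP T) (cutN T) (u * T)"
      using msq_le_difference_quotient(1)[of "cutP T" "u * T" "u * T + D T" "cutN T"] elim(3) T by (simp add: m_def)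
    then have "D T * m T / (D T * T) \<le> (msq2 (cutP T) (cutN T) (u * T + D T) - msq2 (cutP T) (cutN T) (u * T)) / (D T * T)"
      using T by (intro divide_right_mono) auto
    then have a: "m T / T \<le> (msq2 (cutP T) (cutN T) (u * T + D T) - msq2 (cutP T) (cutN T) (u * T)) / (D T * T)" using T by simp
    have b: "diagL T * ((u * T + (u * T + D T)) / (2 * T)) = u * diagL T + diagL T / ln T / 2"
      using T by (simp add: D_def field_simps)
    show ?case unfolding e_def by (intro exI[of _ z] conjI z(1,2) aux1[OF z(3) a b])
  qed
  have lo: "\<forall>\<^sub>F T in at_top. \<exists>z. u * T - D T < z \<and> z < u * T \<and> m T / T - u * diagL T \<ge> 2 * W' T z / T - e T"
    using main ev cut_bounds eventually_gt_at_top[of 1]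
  proof eventually_elim
    case (elim T)
    have T: "T > 1" "ln T > 0" "D T > 0" using elim by (auto simp: D_def)
    have uT: "u * T > 0" using u T by simp
    have pr: "0 < u * T - D T \<and> u * T - D T < u * T \<and> u * T \<le> 3 * T \<and> u * T - (u * T - D T) = D T"
      using uT T elim(2) by linarith
    obtain z where z: "u * T - D T < z" "z < u * T"
      "\<bar>(msq2 (cutP T) (cutN T) (u * T) - msq2 (cutP T) (cutN T) (u * T - D T)) / (D T * T)
           - diagL T * (((u * T - D T) + u * T) / (2 * T)) - 2 * W' T z / T\<bar> \<le> 4 * (msq_err T * ln T)"
      using elim(1)[rule_format, OF pr] by blast
    have "msq2 (cutP T) (cutN T) (u * T) - msq2 (cutP T) (cutN T) (u * T - D T) \<le> D T * m T"
      using msq_le_difference_quotient(2)[of "cutP T" "u * T - D T" "u * T" "cutN T"] elim(3) T by (simp add: m_def)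
    then have "(msq2 (cutP T) (cutN T) (u * T) - msq2 (cutP T) (cutN T) (u * T - D T)) / (D T * T) \<le> D T * m T / (D T * T)"
      using T by (intro divide_right_mono) auto
    then have a: "(msq2 (cutP T) (cutN T) (u * T) - msq2 (cutP T) (cutN T) (u * T - D T)) / (D T * T) \<le> m T / T" using T by simp
    have b: "diagL T * (((u * T - D T) + u * T) / (2 * T)) = u * diagL T - diagL T / ln T / 2"
      using T by (simp add: D_def field_simps)
    show ?case unfolding e_def by (intro exI[of _ z] conjI z(1,2) aux2[OF z(3) a b])
  qed
  \<comment> \<open>Choosing the intermediate points as functions of T allows taking limits: they
    stay within D T of u T, so their ratio to T tends to u.\<close>
  obtain zu where zu: "\<forall>\<^sub>F T in at_top. u * T < zu T \<and> zu T < u * T + D T \<and> m T / T - u * diagL T \<le> 2 * W' T (zu T) / T + e T"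
    using up by (auto simp: eventually_ex)
  obtain zl where zl: "\<forall>\<^sub>F T in at_top. u * T - D T < zl T \<and> zl T < u * T \<and> m T / T - u * diagL T \<ge> 2 * W' T (zl T) / T - e T"
    using lo by (auto simp: eventually_ex)
  have zu_lim: "((\<lambda>T. zu T / T) \<longlongrightarrow> u) at_top"
  proof (rule tendsto_sandwich[OF _ _ tendsto_const DT(2)])
    show "\<forall>\<^sub>F T in at_top. u \<le> zu T / T"
      using zu eventually_gt_at_top[of 0] by eventually_elim (auto simp: field_simps)
    show "\<forall>\<^sub>F T in at_top. zu T / T \<le> u + D T / T"
      using zu eventually_gt_at_top[of 0]
    proof eventually_elim
      case (elim T)
      have "zu T / T \<le> (u * T + D T) / T" using elim by (intro divide_right_mono) auto
      then show ?case using elim by (simp add: add_divide_distrib)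
    qed
  qed
  have zl_lim: "((\<lambda>T. zl T / T) \<longlongrightarrow> u) at_top"
  proof (rule tendsto_sandwich[OF _ _ DT(1) tendsto_const])
    show "\<forall>\<^sub>F T in at_top. zl T / T \<le> u"
      using zl eventually_gt_at_top[of 0] by eventually_elim (auto simp: field_simps)
    show "\<forall>\<^sub>F T in at_top. u - D T / T \<le> zl T / T"
      using zl eventually_gt_at_top[of 0]
    proof eventually_elim
      case (elim T)
      have "(u * T - D T) / T \<le> zl T / T" using elim by (intro divide_right_mono) auto
      then show ?case using elim by (simp add: diff_divide_distrib)
    qed
  qed
  have "((\<lambda>T. m T / T - u * diagL T) \<longlongrightarrow> 2 * (u * vkern (8 / u))) at_top"
  proof (rule tendsto_sandwich)
    show "\<forall>\<^sub>F T in at_top. 2 * (W' T (zl T) / T) - e T \<le> m T / T - u * diagL T"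
      using zl by eventually_elim simp
    show "\<forall>\<^sub>F T in at_top. m T / T - u * diagL T \<le> 2 * (W' T (zu T) / T) + e T"
      using zu by eventually_elim simp
    show "((\<lambda>T. 2 * (W' T (zl T) / T) - e T) \<longlongrightarrow> 2 * (u * vkern (8 / u))) at_top"
      using tendsto_diff[OF tendsto_mult[OF tendsto_const[of 2] tendsto_mean_point[OF zl_lim u(1)]] e0]
      by (simp add: W'_def)
    show "((\<lambda>T. 2 * (W' T (zu T) / T) + e T) \<longlongrightarrow> 2 * (u * vkern (8 / u))) at_top"
      using tendsto_add[OF tendsto_mult[OF tendsto_const[of 2] tendsto_mean_point[OF zu_lim u(1)]] e0]
      by (simp add: W'_def)
  qed
  then show ?thesis by (simp add: m_def)
qed

text \<open>The low indices return: their off-diagonal pairs change the quotient by o(1), while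
  their diagonal terms are carried along in the full harmonic sum.\<close>

lemma msq_full_tendsto:
  assumes u: "0 < u" "u \<le> 2"
  shows "((\<lambda>T. msq 1 (cutN T) (u * T) / T - u * (\<Sum>n=1..<cutN T. 1 / real n)) \<longlongrightarrow> 2 * (u * vkern (8 / u))) at_top"
proof -
  define f where "f = (\<lambda>T. msq 1 (cutN T) (u * T) / T - u * (\<Sum>n=1..<cutN T. 1 / real n))"
  define g where "g = (\<lambda>T. msq (cutP T) (cutN T) (u * T) / T - u * diagL T)"
  have "((\<lambda>T. f T - g T) \<longlongrightarrow> 0) at_top"
  proof (rule Lim_null_comparison)
    show "\<forall>\<^sub>F T in at_top. norm (f T - g T)
        \<le> 2 * (T / (ln T)\<^sup>2 * (1 + ln (9 * T)) + 4 * sqrt (T / (ln T)\<^sup>2 * (9 * T))) / T"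
      using cut_bounds eventually_gt_at_top[of 1]
    proof eventually_elim
      case (elim T)
      define N P where "N = cutN T" and "P = cutP T"
      have b: "real N \<le> 9 * T" "real P \<le> T / (ln T)\<^sup>2" "1 \<le> P" "P \<le> N" "T > 1"
        using elim unfolding N_def P_def by auto
      have "f T - g T = ((msq 1 N (u * T) - u * T * (\<Sum>n=1..<N. 1 / real n))
            - (msq P N (u * T) - u * T * (\<Sum>n=P..<N. 1 / real n))) / T"
        using b(5) by (simp add: f_def g_def N_def P_def diagL_def diff_divide_distrib)
      then have "norm (f T - g T) = \<bar>(msq 1 N (u * T) - u * T * (\<Sum>n=1..<N. 1 / real n))
            - (msq P N (u * T) - u * T * (\<Sum>n=P..<N. 1 / real n))\<bar> / T"
        using b(5) by simp
      also have "\<dots> \<le> 2 * (P * (1 + ln N) + 4 * sqrt (real P * real N)) / T"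
        using b by (intro divide_right_mono msq_split) auto
      also have "\<dots> \<le> 2 * (T / (ln T)\<^sup>2 * (1 + ln (9 * T)) + 4 * sqrt (T / (ln T)\<^sup>2 * (9 * T))) / T"
      proof (intro divide_right_mono mult_left_mono add_mono mult_mono real_sqrt_le_mono)
        show "ln (real N) \<le> ln (9 * T)" using b by (subst ln_le_cancel_iff) auto
      qed (use b in auto)
      finally show ?case .
    qed
    show "((\<lambda>T::real. 2 * (T / (ln T)\<^sup>2 * (1 + ln (9 * T)) + 4 * sqrt (T / (ln T)\<^sup>2 * (9 * T))) / T) \<longlongrightarrow> 0) at_top"
      by real_asymp
  qed
  from tendsto_add[OF this msq_tendsto[OF u]] show ?thesis by (simp add: f_def g_def)
qed

lemma filterlim_cutN: "filterlim cutN at_top at_top"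
proof -
  have "filterlim (\<lambda>T. real (cutN T)) at_top at_top"
  proof (rule filterlim_at_top_mono[of "\<lambda>T::real. T"])
    show "\<forall>\<^sub>F T in at_top. T \<le> real (cutN T)"
      using cut_bounds eventually_ge_at_top[of 0] by eventually_elim auto
  qed (rule filterlim_ident)
  then show ?thesis by (simp add: filterlim_sequentially_iff_filterlim_real)
qed

lemma sum_inverse_cutN:
  "((\<lambda>T. (\<Sum>n=1..<cutN T. 1 / real n) - ln T) \<longlongrightarrow> euler_mascheroni + ln 8) at_top"
proof -
  have h: "(\<Sum>n=1..<N. 1 / real n) = harm N - 1 / real N" if "N \<ge> 1" for N :: nat
  proof -
    have "{1..N} = insert N {1..<N}" using that by auto
    then show ?thesis by (simp add: harm_def inverse_eq_divide)
  qed
  have "((\<lambda>T. (harm (cutN T) - ln (cutN T)) + ln (cutN T / T) - 1 / real (cutN T)) \<longlongrightarrow> euler_mascheroni + ln 8 - 0) at_top"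
    by (intro tendsto_intros filterlim_compose[OF euler_mascheroni_LIMSEQ filterlim_cutN] cutN_over
          filterlim_compose[OF lim_1_over_n filterlim_cutN]) auto
  moreover have "\<forall>\<^sub>F T in at_top. (harm (cutN T) - ln (cutN T)) + ln (cutN T / T) - 1 / real (cutN T)
       = (\<Sum>n=1..<cutN T. 1 / real n) - ln T"
    using cut_bounds eventually_gt_at_top[of 1]
  proof eventually_elim
    case (elim T)
    then have "cutN T \<ge> 1" by linarith
    then show ?case using elim h[of "cutN T"] by (simp add: ln_div)
  qed
  ultimately show ?thesis by (simp add: tendsto_cong)
qed

text \<open>Subtracting the case u = 1 from u = 2 leaves exactly one harmonic sum, that is ln T plus
  a convergent quantity. The limit c combines two kernel values with Euler's constant and ln
  8.\<close>

lemma msq_dyadic_tendsto: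
  "\<exists>c. ((\<lambda>T. (msq 1 (cutN T) (2 * T) - msq 1 (cutN T) T) / T - ln T) \<longlongrightarrow> c) at_top"
proof -
  define L where "L = (\<lambda>T. \<Sum>n=1..<cutN T. 1 / real n)"
  have "((\<lambda>T. (msq 1 (cutN T) (2 * T) / T - 2 * L T) - (msq 1 (cutN T) (1 * T) / T - 1 * L T) + (L T - ln T))
     \<longlongrightarrow> 2 * (2 * vkern (8 / 2)) - 2 * (1 * vkern (8 / 1)) + (euler_mascheroni + ln 8)) at_top"
    unfolding L_def by (intro tendsto_add tendsto_diff msq_full_tendsto sum_inverse_cutN) auto
  moreover have "(msq 1 (cutN T) (2 * T) / T - 2 * L T) - (msq 1 (cutN T) (1 * T) / T - 1 * L T) + (L T - ln T)
      = (msq 1 (cutN T) (2 * T) - msq 1 (cutN T) T) / T - ln T" for T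
    by (simp add: diff_divide_distrib)
  ultimately show ?thesis by (simp only:) blast
qed

section \<open>From Dirichlet polynomials back to zeta\<close>

lemma zeta_approx_dpoly:
  assumes "real N \<ge> 1 + 2 * \<bar>t\<bar>" "t > 0"
  shows "cmod (riemann_zeta (1/2 + \<i> * t) - dpoly 1 N t) \<le> 5 / sqrt N + sqrt N / t"
proof -
  have N: "N \<ge> 1" using assms by (cases N) auto
  have e: "zeta_approx N t = dpoly 1 N t - of_nat N powr (1/2 - \<i> * t) / (1/2 - \<i> * t)"
    by (simp add: zeta_approx_def dpoly_def)
  have "cmod (of_nat N powr (1/2 - \<i> * t)) = sqrt N"
    using norm_powr_real_base[of "real N" "1/2 - \<i> * t"] N by (simp add: powr_half_sqrt)
  moreover have "cmod (1/2 - \<i> * t) \<ge> t"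
    using abs_Im_le_cmod[of "1/2 - \<i> * t"] assms(2) by simp
  ultimately have "cmod (of_nat N powr (1/2 - \<i> * t) / (1/2 - \<i> * t)) \<le> sqrt N / t"
    using assms(2) by (simp add: norm_divide frac_le)
  moreover have "riemann_zeta (1/2 + \<i> * t) - dpoly 1 N t
     = (riemann_zeta (1/2 + \<i> * t) - zeta_approx N t) - of_nat N powr (1/2 - \<i> * t) / (1/2 - \<i> * t)"
    by (simp add: e)
  then have "cmod (riemann_zeta (1/2 + \<i> * t) - dpoly 1 N t)
     \<le> cmod (riemann_zeta (1/2 + \<i> * t) - zeta_approx N t) + cmod (of_nat N powr (1/2 - \<i> * t) / (1/2 - \<i> * t))"
    by (metis norm_triangle_ineq4)
  ultimately show ?thesis using riemann_zeta_approx[OF assms(1)] by linarith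
qed

text \<open>The cross term 2 |s| d is split by the arithmetic-geometric mean inequality with weight
  \<eta>. The result can be integrated directly, since the mean of |s|^2 is known.\<close>

lemma norm_squared_perturb:
  fixes z s :: complex
  assumes "cmod (z - s) \<le> d" "0 < \<eta>" "\<eta> \<le> 1"
  shows "\<bar>(cmod z)\<^sup>2 - (cmod s)\<^sup>2\<bar> \<le> \<eta> * (cmod s)\<^sup>2 + 2 / \<eta> * d\<^sup>2"
proof -
  define x where "x = cmod s"
  define y where "y = cmod z - cmod s"
  have d0: "d \<ge> 0" using assms(1) norm_ge_zero[of "z - s"] by linarith
  have y: "\<bar>y\<bar> \<le> d" using norm_triangle_ineq3[of z s] assms(1) by (simp add: y_def)
  have y2: "y\<^sup>2 \<le> d\<^sup>2" using y d0 by (simp add: abs_le_square_iff[symmetric])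
  have "(cmod z)\<^sup>2 - (cmod s)\<^sup>2 = 2 * x * y + y\<^sup>2"
    by (simp add: x_def y_def power2_eq_square algebra_simps)
  then have "\<bar>(cmod z)\<^sup>2 - (cmod s)\<^sup>2\<bar> \<le> \<bar>2 * x * y\<bar> + y\<^sup>2" by (metis abs_triangle_ineq abs_power2)
  moreover have "\<bar>2 * x * y\<bar> \<le> \<eta> * x\<^sup>2 + y\<^sup>2 / \<eta>"
  proof -
    have "(\<eta> * x - \<bar>y\<bar>)\<^sup>2 \<ge> 0" by simp
    then have "2 * (\<eta> * x * \<bar>y\<bar>) \<le> \<eta>\<^sup>2 * x\<^sup>2 + y\<^sup>2"
      by (simp add: power2_diff power_mult_distrib)
    then have "2 * (\<eta> * x * \<bar>y\<bar>) / \<eta> \<le> (\<eta>\<^sup>2 * x\<^sup>2 + y\<^sup>2) / \<eta>"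
      using assms(2) by (intro divide_right_mono) auto
    moreover have "2 * (\<eta> * x * \<bar>y\<bar>) / \<eta> = \<bar>2 * x * y\<bar>"
      using assms(2) by (simp add: abs_mult x_def)
    moreover have "(\<eta>\<^sup>2 * x\<^sup>2 + y\<^sup>2) / \<eta> = \<eta> * x\<^sup>2 + y\<^sup>2 / \<eta>"
      using assms(2) by (simp add: add_divide_distrib power2_eq_square)
    ultimately show ?thesis by linarith
  qed
  moreover have "y\<^sup>2 / \<eta> \<le> d\<^sup>2 / \<eta>" using y2 assms(2) by (intro divide_right_mono) auto
  moreover have "y\<^sup>2 \<le> d\<^sup>2 / \<eta>"
  proof -
    have "y\<^sup>2 \<le> d\<^sup>2 / 1" using y2 by simp
    also have "\<dots> \<le> d\<^sup>2 / \<eta>" using assms by (intro divide_left_mono) auto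
    finally show ?thesis .
  qed
  moreover have "2 / \<eta> * d\<^sup>2 = d\<^sup>2 / \<eta> + d\<^sup>2 / \<eta>" by simp
  ultimately show ?thesis unfolding x_def by linarith
qed

lemma integrable_Z2: "Z2 integrable_on {a..b}"
  by (intro integrable_continuous_interval continuous_on_Z2)

lemma Z2_dyadic_tendsto:
  "\<exists>c. ((\<lambda>T. integral {T..2*T} Z2 / T - ln T) \<longlongrightarrow> c) at_top"
proof -
  define S where "S = (\<lambda>T. msq 1 (cutN T) (2 * T) - msq 1 (cutN T) T)"
  obtain c where c: "((\<lambda>T. S T / T - ln T) \<longlongrightarrow> c) at_top"
    using msq_dyadic_tendsto by (auto simp: S_def)
  have "((\<lambda>T. integral {T..2*T} Z2 / T - S T / T) \<longlongrightarrow> 0) at_top"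
  proof (rule Lim_null_comparison)
    show "\<forall>\<^sub>F T in at_top. norm (integral {T..2*T} Z2 / T - S T / T)
       \<le> 1 / (ln T)\<^sup>2 * (S T / T - ln T) + 1 / ln T + 128 * (ln T)\<^sup>2 / T"
      using cut_bounds eventually_gt_at_top[of "exp 1"]
    proof eventually_elim
      case (elim T)
      define N where "N = cutN T"
      have T: "T > 1" "ln T > 1"
      proof -
        have "1 < exp (1::real)" by simp
        then show "T > 1" using elim(2) by linarith
        then have "ln (exp 1) < ln T" using elim(2) by (subst ln_less_cancel_iff) auto
        then show "ln T > 1" by simp
      qed
      have N: "8 * T \<le> real N" "real N \<le> 9 * T" using elim by (auto simp: N_def)
      \<comment> \<open>The mean of |s|^2 over [T, 2T] is about ln T and d^2 is of order 1 / T; this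
        \<eta> makes both \<eta> ln T and d^2 / \<eta> tend to 0.\<close>
      define \<eta> where "\<eta> = 1 / (ln T)\<^sup>2"
      have eta: "0 < \<eta>" "\<eta> \<le> 1" using T by (auto simp: \<eta>_def divide_simps one_le_power)
      \<comment> \<open>Here 8 = 5 + sqrt 9: the two errors are 5 / sqrt N and sqrt N / t, with T
        \<le> N \<le> 9T and t \<ge> T.\<close>
      define d where "d = 8 / sqrt T"
      have near: "\<bar>Z2 t - (cmod (dpoly 1 N t))\<^sup>2\<bar> \<le> \<eta> * (cmod (dpoly 1 N t))\<^sup>2 + 2 / \<eta> * d\<^sup>2"
        if t: "t \<in> {T..2*T}" for t
        unfolding Z2_def
      proof (rule norm_squared_perturb[OF _ eta])
        have "cmod (riemann_zeta (1/2 + \<i> * t) - dpoly 1 N t) \<le> 5 / sqrt N + sqrt N / t"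
          using t T N by (intro zeta_approx_dpoly) auto
        also have "\<dots> \<le> 5 / sqrt T + sqrt (9 * T) / T"
          using t T N by (intro add_mono frac_le) auto
        also have "\<dots> = d"
          using T by (simp add: d_def real_sqrt_mult field_simps)
        finally show "cmod (riemann_zeta (1/2 + \<i> * complex_of_real t) - dpoly 1 N t) \<le> d" .
      qed
      have sI: "((\<lambda>t. (cmod (dpoly 1 N t))\<^sup>2) has_integral S T) {T..2*T}"
        unfolding S_def N_def by (rule msq_has_integral) (use T in auto)
      have zI: "(Z2 has_integral (integral {T..2*T} Z2)) {T..2*T}"
        by (rule integrable_integral[OF integrable_Z2])
      have bI: "((\<lambda>t. \<eta> * (cmod (dpoly 1 N t))\<^sup>2 + 2 / \<eta> * d\<^sup>2) has_integral (\<eta> * S T + 2 / \<eta> * d\<^sup>2 * T)) {T..2*T}"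
        using has_integral_add[OF has_integral_mult_right[OF sI, of \<eta>] has_integral_const_real[of "2 / \<eta> * d\<^sup>2" T "2*T"]] T
        by (simp add: mult.commute)
      have "norm (integral {T..2*T} (\<lambda>t. Z2 t - (cmod (dpoly 1 N t))\<^sup>2)) \<le> integral {T..2*T} (\<lambda>t. \<eta> * (cmod (dpoly 1 N t))\<^sup>2 + 2 / \<eta> * d\<^sup>2)"
        by (rule integral_norm_bound_integral)
           (use near bI has_integral_diff[OF zI sI] in \<open>auto simp: has_integral_integrable_integral\<close>)
      then have "\<bar>integral {T..2*T} Z2 - S T\<bar> \<le> \<eta> * S T + 2 / \<eta> * d\<^sup>2 * T"
        using integral_unique[OF bI] integral_unique[OF has_integral_diff[OF zI sI]] by simp
      then have "\<bar>integral {T..2*T} Z2 - S T\<bar> / T \<le> (\<eta> * S T + 2 / \<eta> * d\<^sup>2 * T) / T"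
        using T by (intro divide_right_mono) auto
      moreover have "norm (integral {T..2*T} Z2 / T - S T / T) = \<bar>integral {T..2*T} Z2 - S T\<bar> / T"
        using T by (simp add: diff_divide_distrib[symmetric])
      moreover have "(\<eta> * S T + 2 / \<eta> * d\<^sup>2 * T) / T = \<eta> * (S T / T - ln T) + \<eta> * ln T + 2 / \<eta> * d\<^sup>2"
        using T by (simp add: field_simps)
      moreover have "\<eta> * ln T = 1 / ln T" using T by (simp add: \<eta>_def power2_eq_square)
      moreover have "2 / \<eta> * d\<^sup>2 = 128 * (ln T)\<^sup>2 / T"
        using T by (simp add: \<eta>_def d_def power_divide)
      ultimately show ?case unfolding \<eta>_def by linarith
    qed
    have a: "((\<lambda>T::real. 1 / (ln T)\<^sup>2) \<longlongrightarrow> 0) at_top" by real_asymp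
    have b: "((\<lambda>T::real. 1 / ln T + 128 * (ln T)\<^sup>2 / T) \<longlongrightarrow> 0) at_top" by real_asymp
    show "((\<lambda>T. 1 / (ln T)\<^sup>2 * (S T / T - ln T) + 1 / ln T + 128 * (ln T)\<^sup>2 / T) \<longlongrightarrow> 0) at_top"
      using tendsto_add[OF tendsto_mult[OF a c] b] by (simp add: add.assoc)
  qed
  from tendsto_add[OF this c] show ?thesis by (intro exI[of _ c]) simp
qed

text \<open>Halving T down to the first block [a, 2a] adds increments d T / 2, d T / 4, ..., a
  geometric series; the bound B + 2 d T has enough slack to pass through the induction. Since a
  depends on the tolerance, boundedness is asked for on every block.\<close>

lemma dyadic_little_o:
  fixes E :: "real \<Rightarrow> real"
  assumes lim: "((\<lambda>T. (E (2 * T) - E T) / T) \<longlongrightarrow> 0) at_top"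
    and bdd: "\<And>a. a \<ge> 1 \<Longrightarrow> \<exists>B. \<forall>x\<in>{a..2*a}. \<bar>E x\<bar> \<le> B"
  shows "((\<lambda>T. E T / T) \<longlongrightarrow> 0) at_top"
proof (rule tendstoI)
  fix e :: real assume e: "e > 0"
  define d where "d = e / 3"
  have d: "d > 0" using e by (simp add: d_def)
  have "\<forall>\<^sub>F T in at_top. \<bar>(E (2 * T) - E T) / T\<bar> < d"
    using tendstoD[OF lim d] by (simp add: dist_real_def)
  then obtain T1 where T1: "\<And>T. T \<ge> T1 \<Longrightarrow> \<bar>(E (2 * T) - E T) / T\<bar> < d"
    by (auto simp: eventually_at_top_linorder)
  define a where "a = max 1 T1"
  have a: "a \<ge> 1" "a \<ge> T1" by (auto simp: a_def)
  obtain B where B: "\<And>x. x \<in> {a..2*a} \<Longrightarrow> \<bar>E x\<bar> \<le> B" using bdd[OF a(1)] by blast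
  have step: "\<bar>E (2 * T) - E T\<bar> \<le> d * T" if "T \<ge> a" for T
  proof -
    have "\<bar>E (2 * T) - E T\<bar> / T < d" using T1[of T] that a by (simp add: abs_divide)
    then show ?thesis using that a by (simp add: field_simps)
  qed
  have claim: "\<forall>T. a \<le> T \<and> T \<le> 2 ^ Suc j * a \<longrightarrow> \<bar>E T\<bar> \<le> B + 2 * d * T" for j
  proof (induction j)
    case 0
    show ?case
    proof (intro allI impI)
      fix T assume T: "a \<le> T \<and> T \<le> 2 ^ Suc 0 * a"
      then have "\<bar>E T\<bar> \<le> B" by (intro B) auto
      moreover have "2 * d * T \<ge> 0" using T a d by simp
      ultimately show "\<bar>E T\<bar> \<le> B + 2 * d * T" by linarith
    qed
  next
    case (Suc j)
    show ?case
    proof (intro allI impI)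
      fix T assume T: "a \<le> T \<and> T \<le> 2 ^ Suc (Suc j) * a"
      have dT: "2 * d * T \<ge> 0" using T a d by simp
      show "\<bar>E T\<bar> \<le> B + 2 * d * T"
      proof (cases "T \<le> 2 * a")
        case True
        then have "\<bar>E T\<bar> \<le> B" using T by (intro B) auto
        then show ?thesis using dT by linarith
      next
        case False
        have "\<bar>E (T / 2)\<bar> \<le> B + 2 * d * (T / 2)" using Suc.IH[rule_format, of "T / 2"] T False by auto
        moreover have "\<bar>E T - E (T / 2)\<bar> \<le> d * (T / 2)" using step[of "T / 2"] False by simp
        moreover have "2 * d * (T / 2) = d * T" "d * (T / 2) = d * T / 2" "2 * d * T = d * T + d * T" by simp_all
        ultimately show ?thesis using dT by linarith
      qed
    qed
  qed
  have all: "\<bar>E T\<bar> \<le> B + 2 * d * T" if "T \<ge> a" for T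
  proof -
    obtain j where "T / a < 2 ^ j" using real_arch_pow[of 2 "T / a"] by auto
    then have "T < 2 ^ j * a" using a by (simp add: field_simps)
    also have "\<dots> \<le> 2 ^ Suc j * a" using a by simp
    finally show ?thesis using claim[of j] that by auto
  qed
  have "((\<lambda>T. B / T) \<longlongrightarrow> 0) at_top" by real_asymp
  from order_tendstoD(2)[OF this d] eventually_ge_at_top[of a]
  show "\<forall>\<^sub>F T in at_top. dist (E T / T) 0 < e"
  proof eventually_elim
    case (elim T)
    have "\<bar>E T\<bar> / T \<le> (B + 2 * d * T) / T" using all[OF elim(2)] elim a by (intro divide_right_mono) auto
    also have "\<dots> = B / T + 2 * d" using elim a by (simp add: add_divide_distrib)
    also have "\<dots> < d + 2 * d" using elim by simp
    also have "\<dots> = e" by (simp add: d_def)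
    finally show ?case using elim a by (simp add: dist_real_def abs_divide)
  qed
qed

definition Z2_int :: "real \<Rightarrow> real" where
  "Z2_int T = integral {0..T} Z2"

lemma Z2_int_asymp: "\<exists>C. ((\<lambda>T. (Z2_int T - T * ln T - C * T) / T) \<longlongrightarrow> 0) at_top"
proof -
  obtain c where c: "((\<lambda>T. integral {T..2*T} Z2 / T - ln T) \<longlongrightarrow> c) at_top"
    using Z2_dyadic_tendsto by blast
  \<comment> \<open>Over [T, 2T] the function T ln T + C T grows by T (ln T + 2 ln 2 + C), which has
    to equal T (ln T + c).\<close>
  define C where "C = c - 2 * ln 2"
  define E where "E = (\<lambda>T. Z2_int T - T * ln T - C * T)"
  have "((\<lambda>T. E T / T) \<longlongrightarrow> 0) at_top"
  proof (rule dyadic_little_o)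
    have "((\<lambda>T. (integral {T..2*T} Z2 / T - ln T) - c) \<longlongrightarrow> c - c) at_top"
      by (intro tendsto_diff c tendsto_const)
    moreover have "\<forall>\<^sub>F T in at_top. (integral {T..2*T} Z2 / T - ln T) - c = (E (2 * T) - E T) / T"
      using eventually_gt_at_top[of 0]
    proof eventually_elim
      case (elim T)
      have "Z2_int (2 * T) = Z2_int T + integral {T..2*T} Z2"
        unfolding Z2_int_def using elim
        by (intro Henstock_Kurzweil_Integration.integral_combine[symmetric] integrable_Z2) auto
      then show ?case using elim by (simp add: E_def C_def ln_mult field_simps)
    qed
    ultimately show "((\<lambda>T. (E (2 * T) - E T) / T) \<longlongrightarrow> 0) at_top"
      by (simp add: tendsto_cong)
    fix a :: real assume a: "a \<ge> 1"
    have "continuous_on {0..2*a} Z2_int"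
      unfolding Z2_int_def by (intro indefinite_integral_continuous_1 integrable_Z2)
    then have "continuous_on {a..2*a} Z2_int" by (rule continuous_on_subset) (use a in auto)
    then have "continuous_on {a..2*a} E"
      unfolding E_def using a by (intro continuous_intros) auto
    then have "bounded (E ` {a..2*a})" by (intro compact_imp_bounded compact_continuous_image) auto
    then show "\<exists>B. \<forall>x\<in>{a..2*a}. \<bar>E x\<bar> \<le> B" by (auto simp: bounded_iff)
  qed
  then show ?thesis unfolding E_def by blast
qed

subsection \<open>Laplace averages\<close>

lemma continuous_on_mult_ln: "continuous_on {0..} (\<lambda>u::real. u * ln u)"
proof -
  have "continuous (at x within {0..}) (\<lambda>u::real. u * ln u)" if "x \<ge> 0" for x
  proof (cases "x = 0")
    case True
    have "((\<lambda>u::real. u * ln u) \<longlongrightarrow> 0) (at_right 0)" by real_asymp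
    then show ?thesis using True by (simp add: continuous_within at_within_Ici_at_right)
  next
    case False
    then have "isCont (\<lambda>u::real. u * ln u) x" using that by (intro continuous_intros) auto
    then show ?thesis by (rule continuous_at_imp_continuous_at_within)
  qed
  then show ?thesis by (simp add: continuous_on_eq_continuous_within)
qed

lemma abs_mult_ln_le:
  assumes "t \<ge> (0::real)" shows "\<bar>t * ln t\<bar> \<le> 1 + t\<^sup>2"
proof (cases "t = 0")
  case False
  then have t: "t > 0" using assms by simp
  have "ln t \<le> t - 1" using t by (rule ln_le_minus_one)
  then have "t * ln t \<le> t * (t - 1)" using t by (intro mult_left_mono) auto
  also have "\<dots> \<le> t\<^sup>2" using t by (simp add: power2_eq_square algebra_simps)
  finally have "t * ln t \<le> t\<^sup>2" .
  moreover have "- ln t \<le> 1 / t - 1" using ln_le_minus_one[of "1 / t"] t by (simp add: ln_div)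
  then have "t * (- ln t) \<le> t * (1 / t - 1)" using t by (intro mult_left_mono) auto
  then have "- (t * ln t) \<le> 1" using t by (simp add: algebra_simps)
  moreover have "t\<^sup>2 \<ge> 0" by simp
  ultimately show ?thesis by linarith
qed simp

section \<open>The constant produced by the Laplace weight\<close>

lemma integral_id_exp:
  fixes v :: real
  assumes "v \<ge> 0"
  shows "((\<lambda>u. u * exp (- u)) has_integral (1 - (1 + v) * exp (- v))) {0..v}"
proof -
  have "((\<lambda>u. u * exp (- u)) has_integral (- (1 + v) * exp (- v)) - (- (1 + 0) * exp (- 0))) {0..v}"
    by (rule fundamental_theorem_of_calculus[where f = "\<lambda>v. - (1 + v) * exp (- v)", OF assms])
       (auto intro!: derivative_eq_intros simp: has_real_derivative_iff_has_vector_derivative[symmetric] algebra_simps)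
  then show ?thesis by (simp add: algebra_simps)
qed

lemma integral_square_exp:
  fixes v :: real
  assumes "v \<ge> 0"
  shows "((\<lambda>u. (1 + u\<^sup>2) * exp (- u)) has_integral (3 - (v\<^sup>2 + 2 * v + 3) * exp (- v))) {0..v}"
proof -
  have "((\<lambda>u. (1 + u\<^sup>2) * exp (- u)) has_integral (- (v\<^sup>2 + 2 * v + 3) * exp (- v)) - (- (0\<^sup>2 + 2 * 0 + 3) * exp (- (0::real)))) {0..v}"
    by (rule fundamental_theorem_of_calculus[where f = "\<lambda>v. - (v\<^sup>2 + 2 * v + 3) * exp (- v)", OF assms])
       (auto intro!: derivative_eq_intros simp: has_real_derivative_iff_has_vector_derivative[symmetric] power2_eq_square algebra_simps)
  then show ?thesis by (simp add: algebra_simps)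
qed

definition ulnu_part :: "real \<Rightarrow> real" where
  "ulnu_part v = integral {0..v} (\<lambda>u. u * ln u * exp (- u))"

text \<open>From 1 on the integrand is nonnegative, so the supremum over v \<ge> 1 is the value of
  the improper integral over [0, \<infinity>).\<close>

definition ulnu_const :: real where
  "ulnu_const = (SUP v\<in>{1..}. ulnu_part v)"

lemma integrable_ulnu:
  assumes "a \<ge> 0" shows "(\<lambda>u::real. u * ln u * exp (- u)) integrable_on {a..b}"
  using assms
  by (intro integrable_continuous_interval continuous_on_mult continuous_on_subset[OF continuous_on_mult_ln])
     (auto intro!: continuous_intros)

lemma ulnu_part_mono:
  assumes "1 \<le> v" "v \<le> w" shows "ulnu_part v \<le> ulnu_part w"
proof -
  have "ulnu_part w = ulnu_part v + integral {v..w} (\<lambda>u. u * ln u * exp (- u))"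
    unfolding ulnu_part_def using assms
    by (intro Henstock_Kurzweil_Integration.integral_combine[symmetric] integrable_ulnu) auto
  moreover have "integral {v..w} (\<lambda>u. u * ln u * exp (- u)) \<ge> 0"
    using assms by (intro integral_nonneg integrable_ulnu) auto
  ultimately show ?thesis by simp
qed

lemma ulnu_part_le:
  assumes "v \<ge> 0" shows "ulnu_part v \<le> 3"
proof -
  have "ulnu_part v \<le> integral {0..v} (\<lambda>u. (1 + u\<^sup>2) * exp (- u))"
    unfolding ulnu_part_def
  proof (rule integral_le[OF integrable_ulnu])
    show "(\<lambda>u. (1 + u\<^sup>2) * exp (- u)) integrable_on {0..v}"
      using integral_square_exp[OF assms] by blast
    fix u assume "u \<in> {0..v}"
    then have "u * ln u \<le> 1 + u\<^sup>2" using abs_mult_ln_le[of u] by simp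
    then show "u * ln u * exp (- u) \<le> (1 + u\<^sup>2) * exp (- u)" by (intro mult_right_mono) auto
  qed simp
  also have "\<dots> = 3 - (v\<^sup>2 + 2 * v + 3) * exp (- v)"
    using integral_square_exp[OF assms] by (rule integral_unique)
  also have "\<dots> \<le> 3" using assms by simp
  finally show ?thesis .
qed

lemma ulnu_part_tendsto: "(ulnu_part \<longlongrightarrow> ulnu_const) at_top"
proof (rule order_tendstoI)
  have bdd: "bdd_above (ulnu_part ` {1..})" using ulnu_part_le by (intro bdd_aboveI[of _ 3]) auto
  fix a assume "a < ulnu_const"
  then obtain v where v: "v \<ge> 1" "a < ulnu_part v"
    unfolding ulnu_const_def using less_cSUP_iff[OF _ bdd, of a] by auto
  show "\<forall>\<^sub>F w in at_top. a < ulnu_part w"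
    using eventually_ge_at_top[of v]
    by eventually_elim (use v ulnu_part_mono in \<open>blast intro: less_le_trans\<close>)
next
  have bdd: "bdd_above (ulnu_part ` {1..})" using ulnu_part_le by (intro bdd_aboveI[of _ 3]) auto
  fix a assume a: "ulnu_const < a"
  show "\<forall>\<^sub>F w in at_top. ulnu_part w < a"
    using eventually_ge_at_top[of 1]
  proof eventually_elim
    case (elim w)
    have "ulnu_part w \<le> ulnu_const" unfolding ulnu_const_def
      by (rule cSUP_upper[OF _ bdd]) (use elim in auto)
    then show ?case using a by simp
  qed
qed

text \<open>In fact \<open>ulnu_const = \<Gamma>'(2)\<close>. The lower bound follows from
  \<open>ln u \<ge> (1 - u\<^sup>-\<^sup>\<epsilon>) / \<epsilon>\<close> by letting \<open>\<epsilon>\<close> tend to \<open>0\<close>.\<close>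

lemma ulnu_const_ge_difference_quotient:
  assumes e: "0 < e" "e < 1"
  shows "(1 - Gamma (2 - e)) / e \<le> ulnu_const"
proof (rule tendsto_le[OF _ ulnu_part_tendsto])
  have "((\<lambda>v::real. 1 - (1 + v) * exp (- v)) \<longlongrightarrow> 1) at_top" by real_asymp
  then show "((\<lambda>v. (1 - (1 + v) * exp (- v) - Gamma (2 - e)) / e) \<longlongrightarrow> (1 - Gamma (2 - e)) / e) at_top"
    using e by (intro tendsto_intros) auto
  show "\<forall>\<^sub>F v in at_top. (1 - (1 + v) * exp (- v) - Gamma (2 - e)) / e \<le> ulnu_part v"
    using eventually_ge_at_top[of 0]
  proof eventually_elim
    case (elim v)
    have G: "((\<lambda>u. u powr (1 - e) / exp u) has_integral Gamma (2 - e)) {0..}"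
      using Gamma_integral_real[of "2 - e"] e by simp
    have cont: "continuous_on {0..v} (\<lambda>u. u powr (1 - e) * exp (- u))"
      using e by (intro continuous_intros continuous_on_powr') auto
    define I where "I = integral {0..v} (\<lambda>u. u powr (1 - e) * exp (- u))"
    have I: "((\<lambda>u. u powr (1 - e) * exp (- u)) has_integral I) {0..v}"
      unfolding I_def by (intro integrable_integral integrable_continuous_interval cont)
    have "I \<le> Gamma (2 - e)"
      using has_integral_subset_le[OF _ I, of "{0..}" "Gamma (2 - e)"] G
      by (auto simp: exp_minus divide_inverse)
    have "((\<lambda>u. (u * exp (- u) - u powr (1 - e) * exp (- u)) / e) has_integral (1 - (1 + v) * exp (- v) - I) / e) {0..v}"
      by (intro has_integral_divide has_integral_diff integral_id_exp elim I)
    moreover have "((\<lambda>u. u * ln u * exp (- u)) has_integral ulnu_part v) {0..v}"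
      unfolding ulnu_part_def by (intro integrable_integral integrable_ulnu) simp
    ultimately have "(1 - (1 + v) * exp (- v) - I) / e \<le> ulnu_part v"
    proof (rule has_integral_le)
      fix u assume u: "u \<in> {0..v}"
      show "(u * exp (- u) - u powr (1 - e) * exp (- u)) / e \<le> u * ln u * exp (- u)"
      proof (cases "u = 0")
        case False
        then have u0: "u > 0" using u by simp
        have "1 + (- e * ln u) \<le> exp (- e * ln u)" by (rule exp_ge_add_one_self)
        also have "\<dots> = u powr - e" using u0 by (simp add: powr_def)
        finally have "1 - u powr - e \<le> e * ln u" by simp
        then have "u * exp (- u) * (1 - u powr - e) \<le> u * exp (- u) * (e * ln u)"
          using u0 by (intro mult_left_mono) auto
        moreover have "u powr (1 - e) = u * u powr - e" using u0 by (simp add: powr_diff powr_minus divide_inverse)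
        ultimately have "u * exp (- u) - u powr (1 - e) * exp (- u) \<le> (u * ln u * exp (- u)) * e"
          by (simp add: algebra_simps)
        then show ?thesis using e by (simp add: divide_le_eq)
      qed simp
    qed
    moreover have "(1 - (1 + v) * exp (- v) - Gamma (2 - e)) / e \<le> (1 - (1 + v) * exp (- v) - I) / e"
      using \<open>I \<le> Gamma (2 - e)\<close> e by (intro divide_right_mono) auto
    ultimately show ?case by linarith
  qed
qed simp

text \<open>Left difference quotients of Gamma at 2 are bounded by \<open>ulnu_const\<close>, hence
  so is the derivative Gamma 2 * Digamma 2 = 1 - \<gamma>. Euler's constant is below 13/22, and 9/22
  > 0.4.\<close>

lemma ulnu_const_bound: "ulnu_const > 0.4"
proof -
  have "(Gamma has_real_derivative (Gamma 2 * Digamma 2)) (at (2::real))"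
    by (rule has_field_derivative_Gamma) auto
  then have "((\<lambda>h. (Gamma (2 + h) - Gamma 2) / h) \<longlongrightarrow> Gamma 2 * Digamma 2) (at (0::real))"
    by (simp add: DERIV_def)
  then have "((\<lambda>h. (Gamma (2 + h) - Gamma 2) / h) \<longlongrightarrow> Gamma 2 * Digamma 2) (at_left (0::real))"
    by (rule filterlim_mono) (auto simp: at_le)
  moreover have "\<forall>\<^sub>F h in at_left (0::real). (Gamma (2 + h) - Gamma 2) / h \<le> ulnu_const"
  proof -
    have "\<forall>\<^sub>F h in at_left (0::real). h \<in> {-1<..<0}" by (rule eventually_at_leftI[of "-1"]) auto
    then show ?thesis
    proof eventually_elim
      case (elim h)
      have "(Gamma (2 + h) - Gamma 2) / h = (1 - Gamma (2 - (- h))) / (- h)"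
        using elim by (simp add: Gamma_numeral minus_divide_left)
      also have "\<dots> \<le> ulnu_const" by (rule ulnu_const_ge_difference_quotient) (use elim in auto)
      finally show ?case .
    qed
  qed
  ultimately have "Gamma 2 * Digamma 2 \<le> ulnu_const"
    by (rule tendsto_upperbound) simp
  moreover have "Gamma 2 * Digamma (2::real) = 1 - euler_mascheroni"
    by (simp add: Gamma_numeral Digamma_numeral harm_def)
  ultimately show ?thesis using euler_mascheroni_less_13_over_22 by simp
qed

section \<open>The Laplace average of the mean square\<close>

lemma Z2_int_deriv:
  assumes "t \<in> {0..b}"
  shows "(Z2_int has_real_derivative Z2 t) (at t within {0..b})"
  unfolding Z2_int_def using assms by (intro integral_has_real_derivative continuous_on_Z2)

lemma continuous_on_Z2_int: "continuous_on {0..b} Z2_int"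
  by (rule DERIV_continuous_on, rule Z2_int_deriv)

lemma Z2_int_nonneg: "Z2_int t \<ge> 0"
  unfolding Z2_int_def by (intro integral_nonneg integrable_Z2) (simp add: Z2_nonneg)

text \<open>With X = \<phi> / 2 the weight exp (- t / X) is the exp (- 2 t / \<phi>) of the integral
  equation, so X is the value of the ladder itself.\<close>

definition Z2_laplace :: "real \<Rightarrow> real \<Rightarrow> real" where
  "Z2_laplace m X = integral {0..m} (\<lambda>t. Z2 t * exp (- t / X))"

lemma Z2_laplace_by_parts:
  assumes X: "X > 0" and m: "m \<ge> 0"
  shows "Z2_laplace m X = Z2_int m * exp (- m / X) + integral {0..m} (\<lambda>t. Z2_int t * exp (- t / X)) / X"
proof -
  have i1: "(\<lambda>t. Z2 t * exp (- t / X)) integrable_on {0..m}"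
    by (intro integrable_continuous_interval continuous_intros continuous_on_Z2) (use X in auto)
  have i2: "(\<lambda>t. Z2_int t * exp (- t / X)) integrable_on {0..m}"
    by (intro integrable_continuous_interval continuous_intros continuous_on_Z2_int) (use X in auto)
  have "((\<lambda>t. Z2 t * exp (- t / X) - Z2_int t * exp (- t / X) / X) has_integral
      Z2_int m * exp (- m / X) - Z2_int 0 * exp (- 0 / X)) {0..m}"
  proof (rule fundamental_theorem_of_calculus[OF m])
    fix t assume t: "t \<in> {0..m}"
    have "((\<lambda>t. Z2_int t * exp (- t / X)) has_real_derivative
        Z2 t * exp (- t / X) - Z2_int t * exp (- t / X) / X) (at t within {0..m})"
      using X by (auto intro!: derivative_eq_intros Z2_int_deriv[OF t])
    then show "((\<lambda>t. Z2_int t * exp (- t / X)) has_vector_derivative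
        Z2 t * exp (- t / X) - Z2_int t * exp (- t / X) / X) (at t within {0..m})"
      by (simp add: has_real_derivative_iff_has_vector_derivative)
  qed
  moreover have "((\<lambda>t. Z2 t * exp (- t / X) - Z2_int t * exp (- t / X) / X) has_integral
      (Z2_laplace m X - integral {0..m} (\<lambda>t. Z2_int t * exp (- t / X)) / X)) {0..m}"
    unfolding Z2_laplace_def
    by (intro has_integral_diff has_integral_divide integrable_integral i1 i2)
  ultimately have "Z2_int m * exp (- m / X) - Z2_int 0 * exp (- 0 / X)
      = Z2_laplace m X - integral {0..m} (\<lambda>t. Z2_int t * exp (- t / X)) / X"
    by (rule has_integral_unique)
  moreover have "Z2_int 0 = 0" by (simp add: Z2_int_def)
  ultimately show ?thesis by simp
qed

text \<open>Substituting t = X u turns ln t into ln X + ln u. The first part leads to the elementary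
  integral of u exp (- u), the second to \<open>ulnu_part\<close>; it is the source of the shift
  \<kappa>.\<close>

lemma mult_ln_laplace:
  assumes X: "X > 0" and v: "v \<ge> 0"
  shows "((\<lambda>t. (t * ln t + C * t) * exp (- t / X)) has_integral
     X * (X * (ln X + C) * (1 - (1 + v) * exp (- v)) + X * ulnu_part v)) {0..X * v}"
proof -
  have "((\<lambda>u. u * ln u * exp (- u)) has_integral ulnu_part v) {0..v}"
    unfolding ulnu_part_def by (intro integrable_integral integrable_ulnu) simp
  then have "((\<lambda>u. X * (ln X + C) * (u * exp (- u)) + X * (u * ln u * exp (- u))) has_integral
     X * (ln X + C) * (1 - (1 + v) * exp (- v)) + X * ulnu_part v) {0..v}"
    by (intro has_integral_add has_integral_mult_right integral_id_exp v)
  from has_integral_stretch_real[OF this, of "1 / X"]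
  have "((\<lambda>t. X * (ln X + C) * (t / X * exp (- (t / X))) + X * (t / X * ln (t / X) * exp (- (t / X)))) has_integral
     X * (X * (ln X + C) * (1 - (1 + v) * exp (- v)) + X * ulnu_part v)) ((\<lambda>x. x * X) ` {0..v})"
    using X by simp
  moreover have "(\<lambda>x. x * X) ` {0..v} = {0..X * v}"
    using X image_mult_atLeastAtMost[of X 0 v] by (simp add: mult.commute)
  ultimately have "((\<lambda>t. X * (ln X + C) * (t / X * exp (- (t / X))) + X * (t / X * ln (t / X) * exp (- (t / X)))) has_integral
     X * (X * (ln X + C) * (1 - (1 + v) * exp (- v)) + X * ulnu_part v)) {0..X * v}" by simp
  then show ?thesis
  proof (rule has_integral_eq[rotated])
    fix t assume t: "t \<in> {0..X * v}"
    show "X * (ln X + C) * (t / X * exp (- (t / X))) + X * (t / X * ln (t / X) * exp (- (t / X)))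
      = (t * ln t + C * t) * exp (- t / X)"
    proof (cases "t = 0")
      case False
      then have "t > 0" using t by simp
      then have "ln (t / X) = ln t - ln X" using X by (simp add: ln_div)
      note ln_eq = this
      have key: "X * a * (t / X * y) + X * (t / X * b * y) = (a + b) * t * y" for a b y
        using X by (simp add: algebra_simps)
      show ?thesis unfolding key ln_eq by (simp add: algebra_simps)
    qed simp
  qed
qed

lemma affine_laplace_le:
  fixes X m e B :: real
  assumes X: "X > 0" and m: "m \<ge> 0" and e: "e \<ge> 0" "B \<ge> 0"
  shows "integral {0..m} (\<lambda>t. (e * t + B) * exp (- t / X)) / X \<le> e * X + B"
proof -
  have "((\<lambda>t. (e * t + B) * exp (- t / X) / X) has_integral
      (- (e * m + e * X + B) * exp (- m / X)) - (- (e * 0 + e * X + B) * exp (- 0 / X))) {0..m}"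
    by (rule fundamental_theorem_of_calculus[where f = "\<lambda>t. - (e * t + e * X + B) * exp (- t / X)", OF m])
       (use X in \<open>auto intro!: derivative_eq_intros
          simp: has_real_derivative_iff_has_vector_derivative[symmetric] field_simps\<close>)
  note I = integral_unique[OF this]
  have "integral {0..m} (\<lambda>t. (e * t + B) * exp (- t / X) / X)
     = e * X + B - (e * m + e * X + B) * exp (- m / X)"
    unfolding I by (simp add: algebra_simps)
  moreover have "(e * m + e * X + B) * exp (- m / X) \<ge> 0" using assms by simp
  ultimately show ?thesis by simp
qed

text \<open>The Laplace integral starts at 0, so the o(T) has to become a bound valid for all t
  \<ge> 0. The initial compact range goes into the constant B, whose Laplace average is at most B
  and thus negligible against X.\<close>

lemma Z2_int_approx:
  assumes C: "((\<lambda>T. (Z2_int T - T * ln T - C * T) / T) \<longlongrightarrow> 0) at_top" and e: "e > 0"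
  obtains B where "B \<ge> 0" "\<And>t. t \<ge> 0 \<Longrightarrow> \<bar>Z2_int t - (t * ln t + C * t)\<bar> \<le> e * t + B"
proof -
  have "\<forall>\<^sub>F T in at_top. \<bar>(Z2_int T - T * ln T - C * T) / T\<bar> < e"
    using tendstoD[OF C e] by (simp add: dist_real_def)
  then obtain T1 where T1: "\<And>T. T \<ge> T1 \<Longrightarrow> \<bar>(Z2_int T - T * ln T - C * T) / T\<bar> < e"
    by (auto simp: eventually_at_top_linorder)
  define a where "a = max 1 T1"
  have "continuous_on {0..a} (\<lambda>t. Z2_int t - (t * ln t + C * t))"
    by (intro continuous_intros continuous_on_Z2_int continuous_on_subset[OF continuous_on_mult_ln]) auto
  then have "bounded ((\<lambda>t. Z2_int t - (t * ln t + C * t)) ` {0..a})"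
    by (intro compact_imp_bounded compact_continuous_image) auto
  then obtain B where B: "B > 0" "\<And>t. t \<in> {0..a} \<Longrightarrow> \<bar>Z2_int t - (t * ln t + C * t)\<bar> \<le> B"
    by (auto simp: bounded_pos)
  show ?thesis
  proof
    fix t :: real assume t: "t \<ge> 0"
    show "\<bar>Z2_int t - (t * ln t + C * t)\<bar> \<le> e * t + B"
    proof (cases "t \<le> a")
      case True
      then have "\<bar>Z2_int t - (t * ln t + C * t)\<bar> \<le> B" using B(2)[of t] t by simp
      moreover have "e * t \<ge> 0" using e t by simp
      ultimately show ?thesis by linarith
    next
      case False
      then have ta: "t \<ge> T1" "t > 0" by (auto simp: a_def)
      have "\<bar>Z2_int t - t * ln t - C * t\<bar> < e * t"
        using T1[OF ta(1)] ta(2) by (simp add: abs_divide divide_less_eq)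
      then show ?thesis using B(1) by (simp add: algebra_simps)
    qed
  qed (use B in auto)
qed

lemma exp_half_bounds:
  assumes "v \<ge> (0::real)"
  shows "(1 + v) * exp (- v) \<le> 2 * exp (- v / 2)" "(1 + v\<^sup>2) * exp (- v) \<le> 8 * exp (- v / 2)"
proof -
  have e: "exp (- v) = exp (- v / 2) * exp (- v / 2)" by (simp add: exp_add[symmetric])
  have q: "1 + v / 2 + (v / 2)\<^sup>2 / 2 \<le> exp (v / 2)" by (rule exp_lower_Taylor_quadratic) (use assms in auto)
  have i: "exp (v / 2) * exp (- v / 2) = 1" by (simp add: exp_add[symmetric])
  have k: "x * exp (- v) \<le> c * exp (- v / 2)" if "x \<le> c * exp (v / 2)" for x c
  proof -
    have "x * exp (- v / 2) \<le> c * exp (v / 2) * exp (- v / 2)" using that by (intro mult_right_mono) auto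
    also have "\<dots> = c" using i by (simp add: mult.assoc)
    finally have "x * exp (- v / 2) * exp (- v / 2) \<le> c * exp (- v / 2)" by (intro mult_right_mono) auto
    then show ?thesis by (simp add: e mult.assoc)
  qed
  have v2: "v\<^sup>2 \<ge> 0" by simp
  have q': "8 + 4 * v + v\<^sup>2 \<le> 8 * exp (v / 2)" using q by (simp add: power_divide)
  show "(1 + v) * exp (- v) \<le> 2 * exp (- v / 2)"
    by (rule k) (use q' v2 assms in linarith)
  show "(1 + v\<^sup>2) * exp (- v) \<le> 8 * exp (- v / 2)"
    by (rule k) (use q' assms in linarith)
qed

lemma Z2_laplace_asymp:
  assumes C: "((\<lambda>T. (Z2_int T - T * ln T - C * T) / T) \<longlongrightarrow> 0) at_top" and e: "e > 0"
  shows "\<forall>\<^sub>F X in at_top. \<forall>m\<ge>14 * X * ln (2 * X). \<bar>Z2_laplace m X - (X * ln X + (C + ulnu_const) * X)\<bar> \<le> e * X"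
proof -
  define d where "d = e / 4"
  have d: "d > 0" using e by (simp add: d_def)
  obtain B where B: "B \<ge> 0" "\<And>t. t \<ge> 0 \<Longrightarrow> \<bar>Z2_int t - (t * ln t + C * t)\<bar> \<le> d * t + B"
    using Z2_int_approx[OF C d] by blast
  \<comment> \<open>K is the constant of a crude quadratic majorant of \<open>Z2_int\<close>, which
    is all that the boundary term at m calls for.\<close>
  define K where "K = 2 + \<bar>C\<bar> + d + B"
  have M_le: "Z2_int t \<le> K * (1 + t\<^sup>2)" if "t \<ge> 0" for t
  proof -
    define s where "s = 1 + t\<^sup>2"
    have tt: "t \<le> s"
    proof -
      have "(t - 1)\<^sup>2 \<ge> 0" by simp
      then have "2 * t \<le> s" by (simp add: power2_diff s_def)
      then show ?thesis using that by simp
    qed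
    have s1: "1 \<le> s" by (simp add: s_def)
    have "Z2_int t \<le> t * ln t + C * t + d * t + B" using B(2)[OF that] by linarith
    also have "\<dots> \<le> s + \<bar>C\<bar> * s + d * s + B * s"
    proof (intro add_mono)
      show "t * ln t \<le> s" using abs_mult_ln_le[OF that] by (simp add: s_def)
      show "C * t \<le> \<bar>C\<bar> * s" using tt that by (intro mult_mono) auto
      show "d * t \<le> d * s" using tt d by (intro mult_left_mono) auto
      show "B \<le> B * s" using mult_left_mono[OF s1 B(1)] by simp
    qed
    also have "\<dots> = (1 + \<bar>C\<bar> + d + B) * s" by (simp add: distrib_right)
    also have "\<dots> \<le> K * s" using s1 by (intro mult_right_mono) (auto simp: K_def)
    finally show ?thesis by (simp only: s_def)
  qed
  have K0: "K \<ge> 0" using B d by (simp add: K_def)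
  have "\<forall>\<^sub>F v in at_top. \<bar>ulnu_part v - ulnu_const\<bar> < d"
    using tendstoD[OF ulnu_part_tendsto d] by (simp add: dist_real_def)
  then obtain V where V: "\<And>v. v \<ge> V \<Longrightarrow> \<bar>ulnu_part v - ulnu_const\<bar> < d"
    by (auto simp: eventually_at_top_linorder)
  have "filterlim (\<lambda>X::real. 14 * ln (2 * X)) at_top at_top" by real_asymp
  then have "\<forall>\<^sub>F X in at_top. V \<le> 14 * ln (2 * X)" by (simp add: filterlim_at_top)
  moreover have "\<forall>\<^sub>F X::real in at_top. 8 * K + B + 2 * (ln X + \<bar>C\<bar>) \<le> d * X" using d by real_asymp
  moreover have "\<forall>\<^sub>F X::real in at_top. X \<ge> 1" by (rule eventually_ge_at_top)
  ultimately show ?thesis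
  proof eventually_elim
    case (elim X)
    have X: "X \<ge> 1" "X > 0" "ln X \<ge> 0" using elim by auto
    show ?case
    proof (intro allI impI)
      fix m assume m: "m \<ge> 14 * X * ln (2 * X)"
      define v where "v = m / X"
      have mv: "m = X * v" using X by (simp add: v_def)
      have v: "v \<ge> 14 * ln (2 * X)" using m X by (simp add: v_def field_simps)
      have lnX: "ln X \<le> ln (2 * X)" using X by simp
      have v0: "v \<ge> 0" using v lnX X by linarith
      have m0: "m \<ge> 0" using mv v0 X by simp
      \<comment> \<open>Of the decay exp (- v) one half absorbs the polynomials in v by
        \<open>exp_half_bounds\<close>; the other half, estimated here, absorbs the factor
        X^2.\<close>
      have ev: "exp (- v / 2) \<le> 1 / X\<^sup>2"
      proof -
        have "4 * ln X \<le> v" using v lnX X(3) by linarith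
        then have "exp (- v / 2) \<le> exp (- (2 * ln X))" by simp
        also have "\<dots> = inverse (exp (ln X) ^ 2)" by (simp add: exp_minus exp_of_nat_mult[of 2, simplified])
        also have "\<dots> = 1 / X\<^sup>2" using X by (simp add: inverse_eq_divide)
        finally show ?thesis .
      qed
      have i2: "(\<lambda>t. Z2_int t * exp (- t / X)) integrable_on {0..m}"
        by (intro integrable_continuous_interval continuous_intros continuous_on_Z2_int) (use X in auto)
      have i4: "(\<lambda>t. (d * t + B) * exp (- t / X)) integrable_on {0..m}"
        by (intro integrable_continuous_interval continuous_intros) (use X in auto)
      define A where "A = (1 + v) * exp (- v)"
      define F where "F = X * (ln X + C) * (1 - A) + X * ulnu_part v"
      have FI: "((\<lambda>t. (t * ln t + C * t) * exp (- t / X)) has_integral X * F) {0..m}"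
        unfolding mv F_def A_def by (rule mult_ln_laplace[OF X(2) v0])
      have "norm (integral {0..m} (\<lambda>t. Z2_int t * exp (- t / X) - (t * ln t + C * t) * exp (- t / X)))
          \<le> integral {0..m} (\<lambda>t. (d * t + B) * exp (- t / X))"
      proof (rule integral_norm_bound_integral[OF _ i4])
        show "(\<lambda>t. Z2_int t * exp (- t / X) - (t * ln t + C * t) * exp (- t / X)) integrable_on {0..m}"
          by (intro integrable_diff i2) (use FI in blast)
        fix t assume t: "t \<in> {0..m}"
        have "norm (Z2_int t * exp (- t / X) - (t * ln t + C * t) * exp (- t / X))
            = \<bar>Z2_int t - (t * ln t + C * t)\<bar> * exp (- t / X)"
          by (simp add: abs_mult left_diff_distrib[symmetric])
        also have "\<dots> \<le> (d * t + B) * exp (- t / X)"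
          using t by (intro mult_right_mono B) auto
        finally show "norm (Z2_int t * exp (- t / X) - (t * ln t + C * t) * exp (- t / X)) \<le> (d * t + B) * exp (- t / X)" .
      qed
      then have "\<bar>integral {0..m} (\<lambda>t. Z2_int t * exp (- t / X)) - X * F\<bar> \<le> integral {0..m} (\<lambda>t. (d * t + B) * exp (- t / X))"
        using integral_unique[OF FI] FI i2 by (subst (asm) integral_diff) auto
      then have "\<bar>integral {0..m} (\<lambda>t. Z2_int t * exp (- t / X)) - X * F\<bar> / X \<le> integral {0..m} (\<lambda>t. (d * t + B) * exp (- t / X)) / X"
        using X by (intro divide_right_mono) auto
      also have "\<dots> \<le> d * X + B" using X m0 d B by (intro affine_laplace_le) auto
      finally have e1: "\<bar>integral {0..m} (\<lambda>t. Z2_int t * exp (- t / X)) / X - F\<bar> \<le> d * X + B"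
      proof -
        have "integral {0..m} (\<lambda>t. Z2_int t * exp (- t / X)) / X - F = (integral {0..m} (\<lambda>t. Z2_int t * exp (- t / X)) - X * F) / X"
          using X by (simp add: diff_divide_distrib)
        moreover assume "\<bar>integral {0..m} (\<lambda>t. Z2_int t * exp (- t / X)) - X * F\<bar> / X \<le> d * X + B"
        ultimately show ?thesis using X by (simp add: abs_divide)
      qed
      have e2: "0 \<le> Z2_int m * exp (- m / X)" "Z2_int m * exp (- m / X) \<le> 8 * K"
      proof -
        show "0 \<le> Z2_int m * exp (- m / X)" by (simp add: Z2_int_nonneg)
        have "1 + m\<^sup>2 \<le> X\<^sup>2 * (1 + v\<^sup>2)" using X by (simp add: mv power_mult_distrib distrib_left one_le_power)
        then have "Z2_int m \<le> K * (X\<^sup>2 * (1 + v\<^sup>2))"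
          using M_le[OF m0] K0 by (meson mult_left_mono order_trans)
        then have "Z2_int m * exp (- v) \<le> K * (X\<^sup>2 * (1 + v\<^sup>2)) * exp (- v)" by (intro mult_right_mono) auto
        also have "\<dots> = K * X\<^sup>2 * ((1 + v\<^sup>2) * exp (- v))" by (simp add: mult_ac)
        also have "\<dots> \<le> K * X\<^sup>2 * (8 * (1 / X\<^sup>2))"
          using exp_half_bounds(2)[OF v0] ev K0 by (intro mult_left_mono) auto
        also have "\<dots> = 8 * K" using X by simp
        finally show "Z2_int m * exp (- m / X) \<le> 8 * K" by (simp add: v_def)
      qed
      have A: "0 \<le> A" "X * A \<le> 2"
      proof -
        show "0 \<le> A" using v0 by (simp add: A_def)
        have "A \<le> 2 * (1 / X\<^sup>2)" using exp_half_bounds(1)[OF v0] ev by (simp add: A_def)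
        then have "X * A \<le> X * (2 * (1 / X\<^sup>2))" using X by (intro mult_left_mono) auto
        also have "\<dots> = 2 / X" using X by (simp add: power2_eq_square)
        also have "\<dots> \<le> 2" using X by (simp add: divide_le_eq)
        finally show "X * A \<le> 2" .
      qed
      have "\<bar>F - (X * ln X + (C + ulnu_const) * X)\<bar> \<le> 2 * (ln X + \<bar>C\<bar>) + d * X"
      proof -
        have "F - (X * ln X + (C + ulnu_const) * X) = - ((ln X + C) * (X * A)) + X * (ulnu_part v - ulnu_const)"
          by (simp add: F_def algebra_simps)
        moreover have "\<bar>(ln X + C) * (X * A)\<bar> \<le> (ln X + \<bar>C\<bar>) * 2"
        proof -
          have "\<bar>ln X + C\<bar> \<le> ln X + \<bar>C\<bar>" using X(3) by linarith
          then show ?thesis unfolding abs_mult using A X(1) by (intro mult_mono) auto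
        qed
        moreover have "\<bar>X * (ulnu_part v - ulnu_const)\<bar> \<le> X * d"
          unfolding abs_mult using V[of v] v elim(1) X by (intro mult_mono) auto
        ultimately show ?thesis by (simp add: mult.commute)
      qed
      then have "\<bar>Z2_laplace m X - (X * ln X + (C + ulnu_const) * X)\<bar>
          \<le> 8 * K + (d * X + B) + (2 * (ln X + \<bar>C\<bar>) + d * X)"
        unfolding Z2_laplace_by_parts[OF X(2) m0] using e1 e2 by linarith
      also have "\<dots> \<le> 3 * (d * X)" using elim(2) by linarith
      also have "\<dots> \<le> e * X" using X e by (simp add: d_def)
      finally show "\<bar>Z2_laplace m X - (X * ln X + (C + ulnu_const) * X)\<bar> \<le> e * X" .
    qed
  qed
qed

subsection \<open>The gap of a Jacob ladder and its iterates\<close>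

lemma Z2_laplace_mono:
  assumes "0 < X" "X \<le> Y" "m \<le> m'"
  shows "Z2_laplace m X \<le> Z2_laplace m' Y"
proof -
  have i: "(\<lambda>t. Z2 t * exp (- t / X)) integrable_on {a..b}" if "X > 0" for X a b
    by (intro integrable_continuous_interval continuous_intros continuous_on_Z2) (use that in auto)
  have "Z2_laplace m X \<le> Z2_laplace m Y"
    unfolding Z2_laplace_def
  proof (intro integral_le i)
    fix t assume t: "t \<in> {0..m}"
    have "t / Y \<le> t / X" using assms t by (intro divide_left_mono) auto
    then show "Z2 t * exp (- t / X) \<le> Z2 t * exp (- t / Y)"
      by (intro mult_left_mono) (auto simp: Z2_nonneg)
  qed (use assms in auto)
  also have "\<dots> \<le> Z2_laplace m' Y"
    unfolding Z2_laplace_def using assms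
    by (intro integral_subset_le i) (auto simp: Z2_nonneg)
  finally show ?thesis .
qed

lemma Z2_int_tendsto_at_top: "filterlim Z2_int at_top at_top"
proof -
  obtain C where C: "((\<lambda>T. (Z2_int T - T * ln T - C * T) / T) \<longlongrightarrow> 0) at_top"
    using Z2_int_asymp by blast
  have "\<forall>\<^sub>F T in at_top. \<bar>(Z2_int T - T * ln T - C * T) / T\<bar> < 1"
    using tendstoD[OF C, of 1] by (simp add: dist_real_def)
  moreover have "\<forall>\<^sub>F T::real in at_top. T * ln T + C * T - T \<ge> T" by real_asymp
  ultimately have "\<forall>\<^sub>F T in at_top. T \<le> Z2_int T"
    using eventually_gt_at_top[of 0]
  proof eventually_elim
    case (elim T)
    then have "\<bar>Z2_int T - T * ln T - C * T\<bar> < T" by (simp add: abs_divide)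
    then show ?case using elim by linarith
  qed
  then show ?thesis by (rule filterlim_at_top_mono[OF filterlim_ident])
qed

text \<open>As long as X \<le> K, monotonicity in both arguments bounds the left side of the
  integral equation by a number R free of T, whereas the right side is unbounded. The upper limit is
  first raised with \<open>max\<close>, so that the asymptotic formula applies at the larger
  X.\<close>

lemma jacob_half_tendsto_at_top:
  assumes sol: "jacob_solution \<mu> \<phi>"
  shows "filterlim (\<lambda>T. \<phi> T / 2) at_top at_top"
proof -
  obtain C where C: "((\<lambda>T. (Z2_int T - T * ln T - C * T) / T) \<longlongrightarrow> 0) at_top"
    using Z2_int_asymp by blast
  have eq: "\<forall>\<^sub>F T in at_top. \<phi> T > 0 \<and> Z2_laplace (\<mu> (\<phi> T)) (\<phi> T / 2) = Z2_int T"
    using sol by (auto simp: jacob_solution_def Z2_laplace_def Z2_int_def mult.commute elim!: eventually_mono)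
  show ?thesis
    unfolding filterlim_at_top
  proof
    fix K :: real
    from Z2_laplace_asymp[OF C, of 1] obtain X0 where X0:
      "\<And>X m. X \<ge> X0 \<Longrightarrow> m \<ge> 14 * X * ln (2 * X) \<Longrightarrow> \<bar>Z2_laplace m X - (X * ln X + (C + ulnu_const) * X)\<bar> \<le> 1 * X"
      unfolding eventually_at_top_linorder by (metis zero_less_one)
    define X where "X = max K X0"
    define R where "R = X * ln X + (C + ulnu_const) * X + X"
    have le: "Z2_laplace m Y \<le> R" if "0 < Y" "Y \<le> K" for m Y
    proof -
      have "Z2_laplace m Y \<le> Z2_laplace (max m (14 * X * ln (2 * X))) X"
        using that by (intro Z2_laplace_mono) (auto simp: X_def)
      also have "\<dots> \<le> R"
      proof -
        have "\<bar>Z2_laplace (max m (14 * X * ln (2 * X))) X - (X * ln X + (C + ulnu_const) * X)\<bar> \<le> 1 * X"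
          by (rule X0) (auto simp: X_def)
        then show ?thesis unfolding R_def by linarith
      qed
      finally show ?thesis .
    qed
    have "\<forall>\<^sub>F T in at_top. Z2_int T > R"
      using Z2_int_tendsto_at_top by (simp add: filterlim_at_top_dense)
    with eq show "\<forall>\<^sub>F T in at_top. K \<le> \<phi> T / 2"
    proof eventually_elim
      case (elim T)
      show ?case
      proof (rule ccontr)
        assume "\<not> ?thesis"
        then have "Z2_laplace (\<mu> (\<phi> T)) (\<phi> T / 2) \<le> R" using elim by (intro le) auto
        then show False using elim by simp
      qed
    qed
  qed
qed

text \<open>With \<open>f x = x ln x + C x\<close> the integral equation reads \<open>f T - f (\<phi> T / 2) = \<kappa> (\<phi> T / 2) + o(T)\<close>;
  the unknown linear coefficient \<open>C\<close> cancels to first order.\<close>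

lemma jacob_ratio_and_gap:
  assumes sol: "jacob_solution \<mu> \<phi>"
  shows "((\<lambda>T. (\<phi> T / 2) / T) \<longlongrightarrow> 1) at_top"
    and "((\<lambda>T. (T - \<phi> T / 2) * ln T / T) \<longlongrightarrow> ulnu_const) at_top"
proof -
  obtain C where C: "((\<lambda>T. (Z2_int T - T * ln T - C * T) / T) \<longlongrightarrow> 0) at_top"
    using Z2_int_asymp by blast
  define \<kappa> where "\<kappa> = ulnu_const"
  define X where "X = (\<lambda>T. \<phi> T / 2)"
  have Xtop: "filterlim X at_top at_top" unfolding X_def by (rule jacob_half_tendsto_at_top[OF sol])
  have eq: "\<forall>\<^sub>F T in at_top. Z2_laplace (\<mu> (\<phi> T)) (X T) = Z2_int T"
    using sol by (auto simp: jacob_solution_def Z2_laplace_def Z2_int_def X_def mult.commute elim!: eventually_mono)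
  have mu: "\<forall>\<^sub>F T in at_top. \<mu> (\<phi> T) \<ge> 14 * X T * ln (2 * X T)"
  proof -
    have "\<forall>\<^sub>F T in at_top. \<phi> T > 0" using sol by (auto simp: jacob_solution_def elim!: eventually_mono)
    then show ?thesis
    proof eventually_elim
      case (elim T)
      then have "\<mu> (\<phi> T) \<ge> 7 * \<phi> T * ln (\<phi> T)" using sol by (simp add: jacob_solution_def)
      then show ?case by (simp add: X_def)
    qed
  qed
  define f where "f = (\<lambda>x. x * ln x + C * x)"
  define a where "a = (\<lambda>T. (Z2_int T - T * ln T - C * T) / T)"
  define b where "b = (\<lambda>T. (Z2_laplace (\<mu> (\<phi> T)) (X T) - (X T * ln (X T) + (C + \<kappa>) * X T)) / X T)"
  have a0: "(a \<longlongrightarrow> 0) at_top" unfolding a_def by (rule C)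
  have b0: "(b \<longlongrightarrow> 0) at_top"
  proof (rule tendstoI)
    fix e :: real assume e: "e > 0"
    have "\<forall>\<^sub>F T in at_top. \<forall>m\<ge>14 * X T * ln (2 * X T). \<bar>Z2_laplace m (X T) - (X T * ln (X T) + (C + \<kappa>) * X T)\<bar> \<le> (e / 2) * X T"
      using eventually_compose_filterlim[OF Z2_laplace_asymp[OF C, of "e / 2"] Xtop] e by (simp add: \<kappa>_def)
    moreover have "\<forall>\<^sub>F T in at_top. X T > 0" using Xtop by (simp add: filterlim_at_top_dense)
    ultimately show "\<forall>\<^sub>F T in at_top. dist (b T) 0 < e"
      using mu
    proof eventually_elim
      case (elim T)
      then have "\<bar>Z2_laplace (\<mu> (\<phi> T)) (X T) - (X T * ln (X T) + (C + \<kappa>) * X T)\<bar> \<le> (e / 2) * X T" by blast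
      then have "\<bar>b T\<bar> \<le> e / 2" using elim(2) by (simp add: b_def abs_divide divide_le_eq)
      then show ?case using e by simp
    qed
  qed
  have fin: "\<forall>\<^sub>F T in at_top. f T + a T * T = f (X T) + (\<kappa> + b T) * X T \<and> X T > 0 \<and> T > 0"
  proof -
    have "\<forall>\<^sub>F T in at_top. X T > 0" using Xtop by (simp add: filterlim_at_top_dense)
    then show ?thesis using eq eventually_gt_at_top[of 0]
      by eventually_elim (simp add: f_def a_def b_def field_simps)
  qed
  have lin0: "((\<lambda>x. 1 / (ln x + C)) \<longlongrightarrow> 0) at_top" by real_asymp
  have lpos: "\<forall>\<^sub>F x::real in at_top. ln x + C > 0" by real_asymp
  have lposX: "\<forall>\<^sub>F T in at_top. ln (X T) + C > 0"
    using eventually_compose_filterlim[OF lpos Xtop] .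
  have r1: "((\<lambda>T. (1 + a T * (1 / (ln T + C))) / (1 + (\<kappa> + b T) * (1 / (ln (X T) + C)))) \<longlongrightarrow> (1 + 0 * 0) / (1 + (\<kappa> + 0) * 0)) at_top"
    by (intro tendsto_intros a0 b0 lin0 filterlim_compose[OF lin0 Xtop]) auto
  have den: "\<forall>\<^sub>F T in at_top. 1 + (\<kappa> + b T) * (1 / (ln (X T) + C)) > 0"
  proof -
    have "((\<lambda>T. 1 + (\<kappa> + b T) * (1 / (ln (X T) + C))) \<longlongrightarrow> 1 + (\<kappa> + 0) * 0) at_top"
      by (intro tendsto_intros b0 filterlim_compose[OF lin0 Xtop])
    then show ?thesis by (rule order_tendstoD) simp
  qed
  \<comment> \<open>The error terms are proportional to T and X, hence of relative size 1 / ln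
    against f, so the equation divides out to ratio 1.\<close>
  have ratio_f: "((\<lambda>T. f (X T) / f T) \<longlongrightarrow> 1) at_top"
  proof -
    have "\<forall>\<^sub>F T in at_top. (1 + a T * (1 / (ln T + C))) / (1 + (\<kappa> + b T) * (1 / (ln (X T) + C))) = f (X T) / f T"
      using fin lpos lposX den
    proof eventually_elim
      case (elim T)
      define p q where "p = ln T + C" and "q = ln (X T) + C"
      have fp: "f T = T * p" "f (X T) = X T * q" by (auto simp: f_def p_def q_def algebra_simps)
      have pq: "p > 0" "q > 0" using elim by (auto simp: p_def q_def)
      have d: "1 + (\<kappa> + b T) * (1 / q) > 0" using elim by (simp add: q_def)
      have "f T * (1 + a T * (1 / p)) = f T + a T * T" using pq by (simp add: fp field_simps)
      also have "\<dots> = f (X T) + (\<kappa> + b T) * X T" using elim by simp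
      also have "\<dots> = f (X T) * (1 + (\<kappa> + b T) * (1 / q))" using pq by (simp add: fp field_simps)
      finally have "f T * (1 + a T * (1 / p)) = f (X T) * (1 + (\<kappa> + b T) * (1 / q))" .
      moreover have "f T > 0" using pq elim by (simp add: fp)
      ultimately show ?case using d unfolding p_def[symmetric] q_def[symmetric]
        by (simp add: frac_eq_eq mult.commute)
    qed
    from Lim_transform_eventually[OF r1 this] show ?thesis by simp
  qed
  \<comment> \<open>f x is x times the increasing factor ln x + C. Therefore q / p lies on the same
    side of 1 as X / T, and X / T is at least as close to 1 as the ratio of the f-values.\<close>
  have rX: "((\<lambda>T. X T / T) \<longlongrightarrow> 1) at_top"
  proof -
    have "((\<lambda>T. X T / T - 1) \<longlongrightarrow> 0) at_top"
    proof (rule Lim_null_comparison)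
      show "((\<lambda>T. \<bar>f (X T) / f T - 1\<bar>) \<longlongrightarrow> 0) at_top"
        using tendsto_rabs[OF tendsto_diff[OF ratio_f tendsto_const[of 1]]] by simp
      show "\<forall>\<^sub>F T in at_top. norm (X T / T - 1) \<le> \<bar>f (X T) / f T - 1\<bar>"
        using fin lpos lposX
      proof eventually_elim
        case (elim T)
        define p q where "p = ln T + C" and "q = ln (X T) + C"
        have "f T = T * p" "f (X T) = X T * q" by (auto simp: f_def p_def q_def algebra_simps)
        then have fp: "f (X T) / f T = (X T / T) * (q / p)" by simp
        have pq: "p > 0" "q > 0" using elim by (auto simp: p_def q_def)
        have XT: "X T > 0" "T > 0" using elim by auto
        show ?case
        proof (cases "X T \<le> T")
          case True
          then have "q \<le> p" using XT by (simp add: p_def q_def)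
          then have "q / p \<le> 1" using pq by simp
          then have "(X T / T) * (q / p) \<le> (X T / T) * 1" using XT by (intro mult_left_mono) auto
          moreover have "X T / T \<le> 1" using True XT by simp
          ultimately show ?thesis unfolding fp by simp
        next
          case False
          then have "p \<le> q" using XT by (simp add: p_def q_def)
          then have "q / p \<ge> 1" using pq by simp
          then have "(X T / T) * (q / p) \<ge> (X T / T) * 1" using XT by (intro mult_left_mono) auto
          moreover have "X T / T \<ge> 1" using False XT by simp
          ultimately show ?thesis unfolding fp by simp
        qed
      qed
    qed
    from tendsto_add[OF this tendsto_const[of 1]] show ?thesis by simp
  qed
  show "((\<lambda>T. (\<phi> T / 2) / T) \<longlongrightarrow> 1) at_top" using rX by (simp add: X_def)
  have l1: "((\<lambda>T. ln T / (ln T + C)) \<longlongrightarrow> 1) at_top" by real_asymp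
  \<comment> \<open>Based on the exact identity f T - f X + X ln (X / T) = (T - X) (ln T + C): the
    term X ln (X / T) is o(T) because X / T tends to 1, and f T - f X is \<kappa> X + o(T) by the
    integral equation.\<close>
  have "((\<lambda>T. ((\<kappa> + b T) * (X T / T) - a T + X T / T * ln (X T / T)) * (ln T / (ln T + C))) \<longlongrightarrow> ((\<kappa> + 0) * 1 - 0 + 1 * ln 1) * 1) at_top"
    by (intro tendsto_intros a0 b0 rX l1) auto
  moreover have "\<forall>\<^sub>F T in at_top. ((\<kappa> + b T) * (X T / T) - a T + X T / T * ln (X T / T)) * (ln T / (ln T + C))
      = (T - X T) * ln T / T"
    using fin lpos
  proof eventually_elim
    case (elim T)
    have XT: "X T > 0" "T > 0" using elim by auto
    define p where "p = ln T + C"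
    have p: "p > 0" using elim by (simp add: p_def)
    have "T * ((\<kappa> + b T) * (X T / T) - a T + X T / T * ln (X T / T)) = (\<kappa> + b T) * X T - a T * T + X T * (ln (X T) - ln T)"
      using XT by (simp add: ln_div field_simps)
    also have "\<dots> = f T - f (X T) + X T * (ln (X T) - ln T)" using elim by linarith
    also have "\<dots> = (T - X T) * p" by (simp add: f_def p_def algebra_simps)
    finally have e: "T * ((\<kappa> + b T) * (X T / T) - a T + X T / T * ln (X T / T)) = (T - X T) * p" .
    have "y = z / T" if "T * y = z" for y z using that XT by auto
    from this[OF e] have "(\<kappa> + b T) * (X T / T) - a T + X T / T * ln (X T / T) = (T - X T) * p / T" .
    then show ?case using p unfolding p_def[symmetric] by simp
  qed
  ultimately have "((\<lambda>T. (T - X T) * ln T / T) \<longlongrightarrow> \<kappa>) at_top"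
    by (simp add: Lim_transform_eventually)
  then show "((\<lambda>T. (T - \<phi> T / 2) * ln T / T) \<longlongrightarrow> ulnu_const) at_top" by (simp add: X_def \<kappa>_def)
qed

text \<open>Gaps add up: T - g (s T) = (T - s T) + (s T - g (s T)). The second gap is measured in
  units s T / ln (s T), and these agree asymptotically with T / ln T because s T / T tends to
  1.\<close>

lemma iterate_gap:
  fixes g :: "real \<Rightarrow> real"
  assumes top: "filterlim g at_top at_top"
    and ratio: "((\<lambda>T. g T / T) \<longlongrightarrow> 1) at_top"
    and gap: "((\<lambda>T. (T - g T) * ln T / T) \<longlongrightarrow> \<kappa>) at_top"
  shows "filterlim (g ^^ k) at_top at_top \<and> ((\<lambda>T. (g ^^ k) T / T) \<longlongrightarrow> 1) at_top
     \<and> ((\<lambda>T. (T - (g ^^ k) T) * ln T / T) \<longlongrightarrow> real k * \<kappa>) at_top"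
proof (induction k)
  case 0
  have "((\<lambda>T::real. T / T) \<longlongrightarrow> 1) at_top" by real_asymp
  then show ?case by (simp add: filterlim_ident id_def)
next
  case (Suc k)
  define s where "s = g ^^ k"
  have IH: "filterlim s at_top at_top" "((\<lambda>T. s T / T) \<longlongrightarrow> 1) at_top"
    "((\<lambda>T. (T - s T) * ln T / T) \<longlongrightarrow> real k * \<kappa>) at_top"
    using Suc.IH by (auto simp: s_def)
  have S: "(g ^^ Suc k) T = g (s T)" for T by (simp add: s_def)
  have spos: "\<forall>\<^sub>F T in at_top. s T > 1" using IH(1) by (simp add: filterlim_at_top_dense)
  have "((\<lambda>T. g (s T) / s T * (s T / T)) \<longlongrightarrow> 1 * 1) at_top"
    by (intro tendsto_mult IH filterlim_compose[OF ratio IH(1)])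
  moreover have "\<forall>\<^sub>F T in at_top. g (s T) / s T * (s T / T) = g (s T) / T"
    using spos by eventually_elim auto
  ultimately have r: "((\<lambda>T. g (s T) / T) \<longlongrightarrow> 1) at_top"
    by (simp add: Lim_transform_eventually)
  have il: "((\<lambda>T::real. 1 / ln T) \<longlongrightarrow> 0) at_top" by real_asymp
  have "((\<lambda>T. (T - s T) * ln T / T + (s T - g (s T)) * ln (s T) / s T * (s T / T) * (1 / (1 + ln (s T / T) * (1 / ln T)))) \<longlongrightarrow>
      real k * \<kappa> + \<kappa> * 1 * (1 / (1 + ln 1 * 0))) at_top"
    by (intro tendsto_intros IH filterlim_compose[OF gap IH(1)] il) auto
  moreover have "\<forall>\<^sub>F T in at_top. (T - s T) * ln T / T + (s T - g (s T)) * ln (s T) / s T * (s T / T) * (1 / (1 + ln (s T / T) * (1 / ln T)))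
      = (T - g (s T)) * ln T / T"
    using spos eventually_gt_at_top[of 1]
  proof eventually_elim
    case (elim T)
    have l: "ln T > 0" "ln (s T) > 0" using elim by auto
    have "1 + ln (s T / T) * (1 / ln T) = ln (s T) / ln T" using elim l by (simp add: ln_div field_simps)
    then have e: "1 / (1 + ln (s T / T) * (1 / ln T)) = ln T / ln (s T)" by simp
    show ?case unfolding e using elim l by (simp add: field_simps)
  qed
  ultimately have "((\<lambda>T. (T - g (s T)) * ln T / T) \<longlongrightarrow> real k * \<kappa> + \<kappa>) at_top"
    by (simp add: Lim_transform_eventually)
  moreover have "filterlim (\<lambda>T. g (s T)) at_top at_top" by (rule filterlim_compose[OF top IH(1)])
  ultimately show ?case using r by (simp add: S[abs_def] distrib_right add.commute o_def s_def[symmetric])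
qed

text \<open>The shift U is at most T / ln^2 T and hence invisible on the scale T / ln T. The gap
  asymptotics are evaluated at T + U T and then rescaled to T as for the iterates.\<close>

lemma iterate_gap_shifted:
  fixes g U :: "real \<Rightarrow> real"
  assumes gap: "((\<lambda>T. (T - (g ^^ k) T) * ln T / T) \<longlongrightarrow> c) at_top"
    and U: "\<forall>T>1. 0 < U T \<and> U T \<le> T / (ln T)\<^sup>2"
  shows "((\<lambda>T. (T - (g ^^ k) (T + U T)) * ln T / T) \<longlongrightarrow> c) at_top"
proof -
  define S where "S = (\<lambda>T. T + U T)"
  have Ul: "((\<lambda>T. U T * ln T / T) \<longlongrightarrow> 0) at_top"
  proof (rule tendsto_sandwich)
    show "\<forall>\<^sub>F T in at_top. 0 \<le> U T * ln T / T"
      using eventually_gt_at_top[of 1] by eventually_elim (use U in \<open>auto simp: less_imp_le\<close>)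
    show "\<forall>\<^sub>F T in at_top. U T * ln T / T \<le> 1 / ln T"
      using eventually_gt_at_top[of 1]
    proof eventually_elim
      case (elim T)
      then have "U T * ln T / T \<le> T / (ln T)\<^sup>2 * ln T / T"
        using U by (intro divide_right_mono mult_right_mono) auto
      also have "\<dots> = 1 / ln T" using elim by (simp add: power2_eq_square)
      finally show ?case .
    qed
    show "((\<lambda>T::real. 1 / ln T) \<longlongrightarrow> 0) at_top" by real_asymp
  qed simp
  have il: "((\<lambda>T::real. 1 / ln T) \<longlongrightarrow> 0) at_top" by real_asymp
  have "((\<lambda>T. 1 + U T * ln T / T * (1 / ln T)) \<longlongrightarrow> 1 + 0 * 0) at_top"
    by (intro tendsto_intros Ul il)
  moreover have "\<forall>\<^sub>F T in at_top. 1 + U T * ln T / T * (1 / ln T) = S T / T"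
    using eventually_gt_at_top[of 1] by eventually_elim (simp add: S_def field_simps)
  ultimately have ST: "((\<lambda>T. S T / T) \<longlongrightarrow> 1) at_top" by (simp add: Lim_transform_eventually)
  have Stop: "filterlim S at_top at_top"
  proof (rule filterlim_at_top_mono[OF filterlim_ident])
    show "\<forall>\<^sub>F T in at_top. T \<le> S T"
      using eventually_gt_at_top[of 1] by eventually_elim (use U in \<open>auto simp: S_def less_imp_le\<close>)
  qed
  have "((\<lambda>T. (S T - (g ^^ k) (S T)) * ln (S T) / S T * (S T / T) * (1 / (1 + ln (S T / T) * (1 / ln T))) - U T * ln T / T) \<longlongrightarrow>
      c * 1 * (1 / (1 + ln 1 * 0)) - 0) at_top"
    by (intro tendsto_intros filterlim_compose[OF gap Stop] ST Ul il) auto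
  moreover have "\<forall>\<^sub>F T in at_top. (S T - (g ^^ k) (S T)) * ln (S T) / S T * (S T / T) * (1 / (1 + ln (S T / T) * (1 / ln T))) - U T * ln T / T
      = (T - (g ^^ k) (T + U T)) * ln T / T"
    using eventually_gt_at_top[of 1]
  proof eventually_elim
    case (elim T)
    have s: "S T > 1" using U elim by (auto simp: S_def intro: add_strict_increasing)
    have l: "ln T > 0" "ln (S T) > 0" using elim s by auto
    have "1 + ln (S T / T) * (1 / ln T) = ln (S T) / ln T" using elim s l by (simp add: ln_div field_simps)
    then have e: "1 / (1 + ln (S T / T) * (1 / ln T)) = ln T / ln (S T)" by simp
    have "(S T - (g ^^ k) (S T)) * ln (S T) / S T * (S T / T) * (ln T / ln (S T)) = (S T - (g ^^ k) (S T)) * ln T / T"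
      using elim s l by simp
    moreover have "S T - (g ^^ k) (S T) = (T - (g ^^ k) (T + U T)) + U T" by (simp add: S_def)
    ultimately show ?case unfolding e by (simp add: distrib_right add_divide_distrib)
  qed
  ultimately show ?thesis by (simp add: Lim_transform_eventually)
qed

theorem mainTheorem2:
  fixes \<mu> \<phi> U :: "real \<Rightarrow> real" and n :: nat
  defines "\<phi>\<^sub>1 \<equiv> (\<lambda>T. \<phi> T / 2)"
  assumes sol: "jacob_solution \<mu> \<phi>"
    and incr: "\<exists>T0. strict_mono_on {T0..} \<phi>\<^sub>1"
    and U: "\<forall>T>1. 0 < U T \<and> U T \<le> T / (ln T)^2"
  shows "(\<forall>k\<le>n+1. ((\<lambda>t. (\<phi>\<^sub>1 ^^ k) t / t) \<longlongrightarrow> 1) at_top) \<and>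
    (\<forall>\<epsilon>>0. \<forall>\<^sub>F T in at_top.
       (\<forall>k\<le>n+1. (\<phi>\<^sub>1 ^^ k) T \<ge> (1 - \<epsilon>) * T) \<and>
       (\<forall>k\<in>{1..n+1}. (\<phi>\<^sub>1 ^^ k) (T + U T) - (\<phi>\<^sub>1 ^^ k) T
                         < 1 / (2 * real n + 5) * (T / ln T)) \<and>
       (\<forall>k\<le>n. (\<phi>\<^sub>1 ^^ k) T - (\<phi>\<^sub>1 ^^ Suc k) (T + U T) > 0.18 * (T / ln T)) \<and>
       \<not> connected (\<Union>k\<le>n+1. {(\<phi>\<^sub>1 ^^ k) T .. (\<phi>\<^sub>1 ^^ k) (T + U T)}))"
proof -
  have top: "filterlim \<phi>\<^sub>1 at_top at_top"
    unfolding \<phi>\<^sub>1_def by (rule jacob_half_tendsto_at_top[OF sol])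
  have ratio: "((\<lambda>T. \<phi>\<^sub>1 T / T) \<longlongrightarrow> 1) at_top"
    and gap: "((\<lambda>T. (T - \<phi>\<^sub>1 T) * ln T / T) \<longlongrightarrow> ulnu_const) at_top"
    unfolding \<phi>\<^sub>1_def by (rule jacob_ratio_and_gap[OF sol])+
  note it = iterate_gap[OF top ratio gap]
  have itr: "((\<lambda>t. (\<phi>\<^sub>1 ^^ k) t / t) \<longlongrightarrow> 1) at_top" for k using it by blast
  have itg: "((\<lambda>T. (T - (\<phi>\<^sub>1 ^^ k) T) * ln T / T) \<longlongrightarrow> k * ulnu_const) at_top" for k using it by blast
  have its: "((\<lambda>T. (T - (\<phi>\<^sub>1 ^^ k) (T + U T)) * ln T / T) \<longlongrightarrow> k * ulnu_const) at_top" for k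
    by (rule iterate_gap_shifted[OF itg U])
  have scale: "x < c * (T / ln T)" if "x * ln T / T < c" "T > 1" for x c T :: real
    using that by (simp add: field_simps)
  have scale': "c * (T / ln T) < x" if "c < x * ln T / T" "T > 1" for x c T :: real
    using that by (simp add: field_simps)
  \<comment> \<open>Both endpoints lie at the same limiting distance k \<kappa> from T in units of T
    / ln T, so in these units the length tends to 0.\<close>
  have ii: "\<forall>\<^sub>F T in at_top. (\<phi>\<^sub>1 ^^ k) (T + U T) - (\<phi>\<^sub>1 ^^ k) T < 1 / (2 * real n + 5) * (T / ln T)" for k
  proof -
    have "((\<lambda>T. (T - (\<phi>\<^sub>1 ^^ k) T) * ln T / T - (T - (\<phi>\<^sub>1 ^^ k) (T + U T)) * ln T / T) \<longlongrightarrow> 0) at_top"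
      using tendsto_diff[OF itg its, of k k] by simp
    then have "\<forall>\<^sub>F T in at_top. (T - (\<phi>\<^sub>1 ^^ k) T) * ln T / T - (T - (\<phi>\<^sub>1 ^^ k) (T + U T)) * ln T / T < 1 / (2 * real n + 5)"
      by (rule order_tendstoD) simp
    then show ?thesis using eventually_gt_at_top[of 1]
      by eventually_elim (rule scale, auto simp: left_diff_distrib diff_divide_distrib)
  qed
  \<comment> \<open>The limits for k + 1 and k differ by \<kappa>, which exceeds 0.4.\<close>
  have iii: "\<forall>\<^sub>F T in at_top. (\<phi>\<^sub>1 ^^ k) T - (\<phi>\<^sub>1 ^^ Suc k) (T + U T) > 0.18 * (T / ln T)" for k
  proof -
    have "((\<lambda>T. (T - (\<phi>\<^sub>1 ^^ Suc k) (T + U T)) * ln T / T - (T - (\<phi>\<^sub>1 ^^ k) T) * ln T / T) \<longlongrightarrow> ulnu_const) at_top"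
      using tendsto_diff[OF its itg, of "Suc k" k] by (simp add: distrib_right del: funpow.simps)
    then have "\<forall>\<^sub>F T in at_top. (T - (\<phi>\<^sub>1 ^^ Suc k) (T + U T)) * ln T / T - (T - (\<phi>\<^sub>1 ^^ k) T) * ln T / T > 0.18"
      by (rule order_tendstoD) (use ulnu_const_bound in simp)
    then show ?thesis using eventually_gt_at_top[of 1]
      by eventually_elim (rule scale', auto simp: left_diff_distrib diff_divide_distrib simp del: funpow.simps)
  qed
  have below: "\<forall>\<^sub>F T in at_top. (\<phi>\<^sub>1 ^^ k) (T + U T) < T" if "k \<ge> 1" for k
  proof -
    have "\<forall>\<^sub>F T in at_top. (T - (\<phi>\<^sub>1 ^^ k) (T + U T)) * ln T / T > 0"
      by (rule order_tendstoD(1)[OF its]) (use that ulnu_const_bound in simp)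
    then show ?thesis using eventually_gt_at_top[of 1]
      by eventually_elim (simp add: zero_less_mult_iff zero_less_divide_iff)
  qed
  obtain T0 where T0: "strict_mono_on {T0..} \<phi>\<^sub>1" using incr by blast
  have disc: "\<forall>\<^sub>F T in at_top. \<not> connected (\<Union>k\<le>n+1. {(\<phi>\<^sub>1 ^^ k) T .. (\<phi>\<^sub>1 ^^ k) (T + U T)})"
  proof -
    have "\<forall>\<^sub>F T in at_top. \<forall>k\<in>{1..n+1}. (\<phi>\<^sub>1 ^^ k) (T + U T) < T"
      by (intro eventually_ball_finite ballI below) auto
    then show ?thesis using eventually_gt_at_top[of 1] eventually_ge_at_top[of T0]
    proof eventually_elim
      case (elim T)
      define A where "A = (\<Union>k\<le>n+1. {(\<phi>\<^sub>1 ^^ k) T .. (\<phi>\<^sub>1 ^^ k) (T + U T)})"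
      define w where "w = Max ((\<lambda>k. (\<phi>\<^sub>1 ^^ k) (T + U T)) ` {1..n+1})"
      \<comment> \<open>A point strictly between the interval for k = 0, which starts at T, and all
        the others, whose right endpoints are at most w.\<close>
      define z where "z = (w + T) / 2"
      have UT: "U T > 0" using U elim by blast
      have wT: "w < T" unfolding w_def using elim(1) by (subst Max_less_iff) auto
      have wk: "(\<phi>\<^sub>1 ^^ k) (T + U T) \<le> w" if "k \<in> {1..n+1}" for k
        unfolding w_def by (rule Max_ge) (use that in auto)
      \<comment> \<open>Monotonicity makes the interval for k = 1 nonempty, so A has a point on each
        side of the gap.\<close>
      have m: "\<phi>\<^sub>1 T < \<phi>\<^sub>1 (T + U T)"
        using strict_mono_onD[OF T0, of T "T + U T"] elim UT by auto
      have TA: "T \<in> A" unfolding A_def by (rule UN_I[of 0]) (use UT in auto)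
      have PA: "\<phi>\<^sub>1 T \<in> A" unfolding A_def by (rule UN_I[of 1]) (use m in auto)
      have "\<phi>\<^sub>1 T \<le> z" "z \<le> T"
        using wk[of 1] m wT by (auto simp: z_def)
      moreover have "z \<notin> A"
      proof
        assume "z \<in> A"
        then obtain k where k: "k \<le> n + 1" "(\<phi>\<^sub>1 ^^ k) T \<le> z" "z \<le> (\<phi>\<^sub>1 ^^ k) (T + U T)"
          by (auto simp: A_def)
        show False
        proof (cases "k = 0")
          case True
          then show False using k(2) wT by (simp add: z_def)
        next
          case False
          then show False using k wk[of k] wT by (simp add: z_def)
        qed
      qed
      ultimately have "\<not> connected A"
        using connected_contains_Icc[OF _ PA TA] by (meson atLeastAtMost_iff subsetD)
      then show ?case by (simp add: A_def)
    qed
  qed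
  show ?thesis
  proof (intro conjI allI impI)
    fix k show "((\<lambda>t. (\<phi>\<^sub>1 ^^ k) t / t) \<longlongrightarrow> 1) at_top" by (rule itr)
  next
    fix \<epsilon> :: real assume e: "\<epsilon> > 0"
    have i: "\<forall>\<^sub>F T in at_top. (\<phi>\<^sub>1 ^^ k) T \<ge> (1 - \<epsilon>) * T" for k
    proof -
      have "\<forall>\<^sub>F T in at_top. (\<phi>\<^sub>1 ^^ k) T / T > 1 - \<epsilon>"
        by (rule order_tendstoD(1)[OF itr]) (use e in simp)
      then show ?thesis using eventually_gt_at_top[of 0]
        by eventually_elim (simp add: field_simps)
    qed
    have "\<forall>\<^sub>F T in at_top. \<forall>k\<in>{..n+1}. (\<phi>\<^sub>1 ^^ k) T \<ge> (1 - \<epsilon>) * T"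
      by (intro eventually_ball_finite ballI i) auto
    moreover have "\<forall>\<^sub>F T in at_top. \<forall>k\<in>{1..n+1}. (\<phi>\<^sub>1 ^^ k) (T + U T) - (\<phi>\<^sub>1 ^^ k) T < 1 / (2 * real n + 5) * (T / ln T)"
      by (intro eventually_ball_finite ballI ii) auto
    moreover have "\<forall>\<^sub>F T in at_top. \<forall>k\<in>{..n}. (\<phi>\<^sub>1 ^^ k) T - (\<phi>\<^sub>1 ^^ Suc k) (T + U T) > 0.18 * (T / ln T)"
      by (intro eventually_ball_finite ballI iii) auto
    ultimately show "\<forall>\<^sub>F T in at_top.
       (\<forall>k\<le>n+1. (\<phi>\<^sub>1 ^^ k) T \<ge> (1 - \<epsilon>) * T) \<and>
       (\<forall>k\<in>{1..n+1}. (\<phi>\<^sub>1 ^^ k) (T + U T) - (\<phi>\<^sub>1 ^^ k) T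
                         < 1 / (2 * real n + 5) * (T / ln T)) \<and>
       (\<forall>k\<le>n. (\<phi>\<^sub>1 ^^ k) T - (\<phi>\<^sub>1 ^^ Suc k) (T + U T) > 0.18 * (T / ln T)) \<and>
       \<not> connected (\<Union>k\<le>n+1. {(\<phi>\<^sub>1 ^^ k) T .. (\<phi>\<^sub>1 ^^ k) (T + U T)})"
      using disc by eventually_elim auto
  qed
qed

end
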